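(* Let $(M^2,[\nabla])$ be a smooth projective surface with fixed volume form $\epsilon$, let $\nabla\in[\nabla]$ be the connection with $\nabla_a\epsilon_{bc}=0$, and let $\mathrm{P}_{ab}$, $Y_a$, $Y^a$, $\phi$, $W^a$, $\rho$, $\ell$ be as defined in the context. Assume that $\rho\neq 0$ everywhere on $M$. Suppose $M$ admits a solution $\alpha_a$ of the pEW equation $\nabla_{(a}\alpha_{b)}+\alpha_a\alpha_b+\mathrm{P}_{(ab)}=0$, and put $F=\epsilon^{ab}\nabla_{[a}\alpha_{b]}$. Then there exist polynomials $P_1(t),P_2(t),P_3(t)$ in a single variable $t$, whose coefficients are (smooth functions on $M$ which are) invariants of the projective structure, such that at every point of $M$ $$P_1(F)=P_2(F)=P_3(F)=0 .$$ Explicitly, the polynomials are $$P_1(t)=-90t^6+a_1t^4+a_2t^2-9\rho t+a_3,$$ $$P_2(t)=-275t^8+b_1t^4+20\rho t^3+b_2t^2+b_3,$$ $$P_3(t)=-40t^6+c_1t^4+c_2t^2+\rho t+c_3,$$ where $$a_1=15\left(\frac{Y^a\nabla_a\rho}{\rho}-\frac{5\phi}{2}\right),\qquad a_2=-\left(\frac{3W^a\nabla_a\rho}{\rho}+6\ell-3\nabla_aW^a\right),$$ $$a_3=\frac{W^a\nabla_a\phi}{2}+\frac{\phi}{2}\nabla_aW^a+Y^a\nabla_a\ell+\frac{\phi\ell}{2}-\frac{\phi W^a\nabla_a\rho}{2\rho}-\ell\,\frac{Y^a\nabla_a\rho}{\rho},$$ $$b_1=-\frac{5W^eY^d\nabla_eW_d}{\rho}+\frac{50\ell}{3},\qquad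 b_2=\frac{W^eW^a\nabla_eW_a}{\rho},$$ $$b_3=\frac{\phi W^eW^a\nabla_eW_a}{6\rho}+\mathrm{P}_{ea}W^eW^a+\frac{\ell^2}{9}+\frac{\ell W^eY^d\nabla_eW_d}{3\rho}+\frac{W^e\nabla_e\ell}{3},$$ $$c_1=-\frac{5Y^a(W^e\nabla_eY_a+Y^e\nabla_aW_e)}{2\rho}-\frac{25\phi}{6},\qquad c_2=\frac{2\ell}{3}+\frac{W^e(W^d\nabla_eY_d+Y^d\nabla_dW_e)}{2\rho},$$ $$c_3=-\frac{W^e\nabla_e\phi}{12}+\frac{\phi W^bW^e\nabla_eY_b}{12\rho}+\frac{\ell W^eY^a\nabla_eY_a}{6\rho}+\mathrm{P}_{ae}W^eY^a+\frac{Y^e\nabla_e\ell}{6}+\frac{\phi W^eY^a\nabla_aW_e}{12\rho}-\frac{\ell\phi}{18}+\frac{\ell Y^bY^a\nabla_aW_b}{6\rho}.$$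
   Context: Abstract index notation is used; round and square brackets on indices denote symmetrization and skew-symmetrization with factor $1/2$. Everything is smooth. A projective structure $[\nabla]$ on a manifold $M$ is an equivalence class of torsion-free affine connections having the same unparametrized geodesics; equivalently, $\hat\nabla$ and $\nabla$ are projectively equivalent iff $\hat\nabla_a\omega_b=\nabla_a\omega_b-\Upsilon_a\omega_b-\Upsilon_b\omega_a$ for some 1-form $\Upsilon_a$. A projective surface is a 2-dimensional manifold with a projective structure. The curvature is $(\nabla_a\nabla_b-\nabla_b\nabla_a)X^c=R_{ab}{}^c{}_dX^d$, the Ricci tensor is $R_{ab}=R_{ca}{}^c{}_b$, and in dimension $n$ the projective rho tensor is $\mathrm{P}_{ab}=\frac{n}{n^2-1}R_{ab}+\frac{1}{n^2-1}R_{ba}$ (here $n=2$). A volume form $\epsilon_{ab}$ on $M$ is fixed, with inverse $\epsilon^{ab}$ normalized by $\epsilon^{ab}\epsilon_{ab}=2$, $\epsilon^{ac}\epsilon_{bc}=\delta^a{}_b$. The connection $\nabla\in[\nabla]$ is chosen so that $\nabla_a\epsilon_{bc}=0$; then $\mathrm{P}_{ab}$ is symmetric. Indices are raised and lowered by $V^a=\epsilon^{ab}V_b$, $V_b=V^a\epsilon_{ab}$. The Cotton-York tensor is $Y_{abc}=\nabla_a\mathrm{P}_{bc}-\nabla_b\mathrm{P}_{ac}$, and $Y_a:=\epsilon^{bc}Y_{bca}$, so $Y_{abc}=\frac12\epsilon_{ab}Y_c$. Define $$\phi=2\nabla_aY^a,\qquad W^a=Y^b\nabla_bY^a-\frac{2\phi}{3}Y^a,\qquad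 \rho=Y_aW^a,\qquad \ell=\frac{5\phi^2}{12}+3\mathrm{P}_{ac}Y^aY^c-\frac{Y^a\nabla_a\phi}{2}.$$ The projective Einstein-Weyl (pEW) equation for a 1-form $\alpha_a$ on $M$ is $\nabla_{(a}\alpha_{b)}+\alpha_a\alpha_b+\mathrm{P}_{(ab)}=0$; it expresses that some connection in $[\nabla]$ has skew-symmetric Ricci tensor. Projective invariance of a quantity built from $(\epsilon,\nabla)$ is understood in the sense of weighted densities: if $g$ is a smooth function, $\epsilon_{ab}$ is replaced by $\hat\epsilon_{ab}=e^{3g}\epsilon_{ab}$ and $\nabla$ by the projectively equivalent connection $\hat\nabla$ with $\Upsilon_a=\nabla_ag$ (so $\hat\nabla_a\hat\epsilon_{bc}=0$), then the quantity is multiplied by $e^{wg}$ for a constant $w$ (its weight) not depending on $g$. *)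

theory Defs
  imports "HOL-Analysis.Analysis" "HOL-Computational_Algebra.Polynomial"
begin

section \<open>Smooth surfaces\<close>

definition partial :: "2 \<Rightarrow> (real^2 \<Rightarrow> real) \<Rightarrow> real^2 \<Rightarrow> real" where
  "partial a f x = frechet_derivative f (at x) (axis a 1)"

primrec Ck_on :: "nat \<Rightarrow> (real^2) set \<Rightarrow> (real^2 \<Rightarrow> real) \<Rightarrow> bool" where
  "Ck_on 0 U f \<longleftrightarrow> continuous_on U f"
| "Ck_on (Suc k) U f \<longleftrightarrow> f differentiable_on U \<and> (\<forall>a. Ck_on k U (partial a f))"

definition smooth_on :: "(real^2) set \<Rightarrow> (real^2 \<Rightarrow> real) \<Rightarrow> bool" where
  "smooth_on U f \<longleftrightarrow> (\<forall>k. Ck_on k U f)"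

text \<open>The surface is the whole type \<open>'m\<close>. A chart is a pair of its domain and its coordinate map.
  Only the values of the coordinate map on the domain matter.\<close>

type_synonym 'm chart = "'m set \<times> ('m \<Rightarrow> real^2)"

definition coord :: "'m chart \<Rightarrow> 2 \<Rightarrow> 'm \<Rightarrow> real" where
  "coord \<kappa> b p = snd \<kappa> p $ b"

definition in_chart :: "'m chart \<Rightarrow> ('m \<Rightarrow> real) \<Rightarrow> real^2 \<Rightarrow> real" where
  "in_chart \<kappa> f = f \<circ> inv_into (fst \<kappa>) (snd \<kappa>)"

definition pd :: "'m chart \<Rightarrow> 2 \<Rightarrow> ('m \<Rightarrow> real) \<Rightarrow> 'm \<Rightarrow> real" where
  "pd \<kappa> a f p = partial a (in_chart \<kappa> f) (snd \<kappa> p)"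

definition smooth_in :: "'m chart \<Rightarrow> 'm set \<Rightarrow> ('m \<Rightarrow> real) \<Rightarrow> bool" where
  "smooth_in \<kappa> V f \<longleftrightarrow> smooth_on (snd \<kappa> ` V) (in_chart \<kappa> f)"

definition smooth_atlas :: "('m::{t2_space,second_countable_topology}) chart set \<Rightarrow> bool" where
  "smooth_atlas A \<longleftrightarrow>
     (\<forall>\<kappa>\<in>A. open (fst \<kappa>) \<and> open (snd \<kappa> ` fst \<kappa>) \<and>
        (\<exists>\<psi>. homeomorphism (fst \<kappa>) (snd \<kappa> ` fst \<kappa>) (snd \<kappa>) \<psi>)) \<and>
     (\<Union>\<kappa>\<in>A. fst \<kappa>) = UNIV \<and>
     (\<forall>\<kappa>\<in>A. \<forall>\<kappa>'\<in>A. \<forall>b. smooth_in \<kappa> (fst \<kappa> \<inter> fst \<kappa>') (coord \<kappa>' b))"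

definition smooth_function :: "'m chart set \<Rightarrow> ('m \<Rightarrow> real) \<Rightarrow> bool" where
  "smooth_function A f \<longleftrightarrow> (\<forall>\<kappa>\<in>A. smooth_in \<kappa> (fst \<kappa>) f)"


section \<open>Tensor fields and connections\<close>

text \<open>A tensor field is given by its components in every chart of the atlas, as functions of the
  point, subject to the transformation law on overlaps. The types \<open>tens1\<close>, \<open>tens2\<close>,
  \<open>tens3\<close> hold the components in one chart, with index type \<open>2\<close>.\<close>

type_synonym 'm tens1 = "2 \<Rightarrow> 'm \<Rightarrow> real"
type_synonym 'm tens2 = "2 \<Rightarrow> 2 \<Rightarrow> 'm \<Rightarrow> real"
type_synonym 'm tens3 = "2 \<Rightarrow> 2 \<Rightarrow> 2 \<Rightarrow> 'm \<Rightarrow> real"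

text \<open>\<open>jac \<kappa>' \<kappa> a b\<close> is \<open>\<partial>x\<^sup>b / \<partial>x'\<^sup>a\<close>, for the coordinates \<open>x\<close> of
  \<open>\<kappa>\<close> and \<open>x'\<close> of \<open>\<kappa>'\<close>.\<close>

definition jac :: "'m chart \<Rightarrow> 'm chart \<Rightarrow> 'm tens2" where
  "jac \<kappa>' \<kappa> a b p = pd \<kappa>' a (coord \<kappa> b) p"

text \<open>A family of functions indexed by charts that comes from one smooth function on the surface.\<close>

definition smooth_scalar :: "'m chart set \<Rightarrow> ('m chart \<Rightarrow> 'm \<Rightarrow> real) \<Rightarrow> bool" where
  "smooth_scalar A f \<longleftrightarrow>
     (\<exists>h. smooth_function A h \<and> (\<forall>\<kappa>\<in>A. \<forall>p\<in>fst \<kappa>. f \<kappa> p = h p))"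

definition one_form :: "'m chart set \<Rightarrow> ('m chart \<Rightarrow> 'm tens1) \<Rightarrow> bool" where
  "one_form A \<omega> \<longleftrightarrow>
     (\<forall>\<kappa>\<in>A. \<forall>a. smooth_in \<kappa> (fst \<kappa>) (\<omega> \<kappa> a)) \<and>
     (\<forall>\<kappa>\<in>A. \<forall>\<kappa>'\<in>A. \<forall>p\<in>fst \<kappa> \<inter> fst \<kappa>'. \<forall>a.
        \<omega> \<kappa>' a p = (\<Sum>b\<in>UNIV. jac \<kappa>' \<kappa> a b p * \<omega> \<kappa> b p))"

definition volume_form :: "'m chart set \<Rightarrow> ('m chart \<Rightarrow> 'm tens2) \<Rightarrow> bool" where
  "volume_form A e \<longleftrightarrow>
     (\<forall>\<kappa>\<in>A. \<forall>a b. smooth_in \<kappa> (fst \<kappa>) (e \<kappa> a b)) \<and>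
     (\<forall>\<kappa>\<in>A. \<forall>\<kappa>'\<in>A. \<forall>p\<in>fst \<kappa> \<inter> fst \<kappa>'. \<forall>a b.
        e \<kappa>' a b p = (\<Sum>c\<in>UNIV. \<Sum>d\<in>UNIV. jac \<kappa>' \<kappa> a c p * jac \<kappa>' \<kappa> b d p * e \<kappa> c d p)) \<and>
     (\<forall>\<kappa>\<in>A. \<forall>p\<in>fst \<kappa>. (\<forall>a b. e \<kappa> a b p = - e \<kappa> b a p) \<and> e \<kappa> 1 2 p \<noteq> 0)"

text \<open>A connection is given by its Christoffel symbols: \<open>N \<kappa> c a b\<close> is
  \<open>\<Gamma>\<^sup>c\<^sub>a\<^sub>b\<close> in the chart \<open>\<kappa>\<close>, where
  \<open>\<nabla>\<^sub>a X\<^sup>c = \<partial>\<^sub>a X\<^sup>c + \<Gamma>\<^sup>c\<^sub>a\<^sub>b X\<^sup>b\<close>.\<close>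

definition affine_connection :: "'m chart set \<Rightarrow> ('m chart \<Rightarrow> 'm tens3) \<Rightarrow> bool" where
  "affine_connection A N \<longleftrightarrow>
     (\<forall>\<kappa>\<in>A. \<forall>c a b. smooth_in \<kappa> (fst \<kappa>) (N \<kappa> c a b)) \<and>
     (\<forall>\<kappa>\<in>A. \<forall>\<kappa>'\<in>A. \<forall>p\<in>fst \<kappa> \<inter> fst \<kappa>'. \<forall>c a b.
        N \<kappa>' c a b p =
          (\<Sum>f\<in>UNIV. jac \<kappa> \<kappa>' f c p *
             ((\<Sum>d\<in>UNIV. \<Sum>e\<in>UNIV. jac \<kappa>' \<kappa> a d p * jac \<kappa>' \<kappa> b e p * N \<kappa> f d e p)
              + pd \<kappa>' a (jac \<kappa>' \<kappa> b f) p)))"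

definition torsion_free :: "'m chart set \<Rightarrow> ('m chart \<Rightarrow> 'm tens3) \<Rightarrow> bool" where
  "torsion_free A N \<longleftrightarrow>
     (\<forall>\<kappa>\<in>A. \<forall>p\<in>fst \<kappa>. \<forall>c a b. N \<kappa> c a b p = N \<kappa> c b a p)"


section \<open>Tensor calculus in one chart\<close>

context
  fixes \<kappa> :: "'m chart" and e :: "'m tens2" and G :: "'m tens3"
begin

definition nabla_vec :: "'m tens1 \<Rightarrow> 'm tens2" where  \<comment> \<open>\<open>\<nabla>\<^sub>a X\<^sup>c\<close>\<close>
  "nabla_vec X a c p = pd \<kappa> a (X c) p + (\<Sum>b\<in>UNIV. G c a b p * X b p)"

definition nabla_form :: "'m tens1 \<Rightarrow> 'm tens2" where  \<comment> \<open>\<open>\<nabla>\<^sub>a \<omega>\<^sub>b\<close>\<close>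
  "nabla_form \<omega> a b p = pd \<kappa> a (\<omega> b) p - (\<Sum>c\<in>UNIV. G c a b p * \<omega> c p)"

definition nabla_form2 :: "'m tens2 \<Rightarrow> 'm tens3" where  \<comment> \<open>\<open>\<nabla>\<^sub>a T\<^sub>b\<^sub>c\<close>\<close>
  "nabla_form2 T a b c p = pd \<kappa> a (T b c) p
     - (\<Sum>d\<in>UNIV. G d a b p * T d c p) - (\<Sum>d\<in>UNIV. G d a c p * T b d p)"

definition nabla_mixed :: "'m tens2 \<Rightarrow> 'm tens3" where  \<comment> \<open>\<open>\<nabla>\<^sub>a T\<^sub>b\<^sup>c\<close>\<close>
  "nabla_mixed T a b c p = pd \<kappa> a (T b c) p
     - (\<Sum>d\<in>UNIV. G d a b p * T d c p) + (\<Sum>d\<in>UNIV. G c a d p * T b d p)"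

text \<open>\<open>X\<^sup>a \<nabla>\<^sub>a f\<close> and \<open>X\<^sup>a V\<^sup>b \<nabla>\<^sub>a \<omega>\<^sub>b\<close>\<close>

definition along :: "'m tens1 \<Rightarrow> ('m \<Rightarrow> real) \<Rightarrow> 'm \<Rightarrow> real" where
  "along X f p = (\<Sum>a\<in>UNIV. X a p * pd \<kappa> a f p)"

definition along_form :: "'m tens1 \<Rightarrow> 'm tens1 \<Rightarrow> 'm tens1 \<Rightarrow> 'm \<Rightarrow> real" where
  "along_form X V \<omega> p = (\<Sum>a\<in>UNIV. \<Sum>b\<in>UNIV. X a p * V b p * nabla_form \<omega> a b p)"

definition div_vec :: "'m tens1 \<Rightarrow> 'm \<Rightarrow> real" where
  "div_vec X p = (\<Sum>a\<in>UNIV. nabla_vec X a a p)"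

text \<open>\<open>riem a b c d\<close> is \<open>R\<^sub>a\<^sub>b\<^sup>c\<^sub>d\<close>; see \<open>riem_commutator\<close> below for the sign and
  index order.\<close>

definition riem :: "2 \<Rightarrow> 2 \<Rightarrow> 2 \<Rightarrow> 2 \<Rightarrow> 'm \<Rightarrow> real" where
  "riem a b c d p = pd \<kappa> a (G c b d) p - pd \<kappa> b (G c a d) p
     + (\<Sum>k\<in>UNIV. G c a k p * G k b d p) - (\<Sum>k\<in>UNIV. G c b k p * G k a d p)"

definition ric :: "'m tens2" where
  "ric a b p = (\<Sum>c\<in>UNIV. riem c a c b p)"

definition Rho :: "'m tens2" where  \<comment> \<open>\<open>n/(n\<^sup>2 - 1) = 2/3\<close> and \<open>1/(n\<^sup>2 - 1) = 1/3\<close>\<close>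
  "Rho a b p = 2/3 * ric a b p + 1/3 * ric b a p"

definition Rho2 :: "'m tens1 \<Rightarrow> 'm tens1 \<Rightarrow> 'm \<Rightarrow> real" where
  "Rho2 X V p = (\<Sum>a\<in>UNIV. \<Sum>b\<in>UNIV. Rho a b p * X a p * V b p)"

text \<open>\<open>eps_inv\<close> is the solution of \<open>\<epsilon>\<^sup>a\<^sup>c \<epsilon>\<^sub>b\<^sub>c = \<delta>\<^sup>a\<^sub>b\<close>.\<close>

definition eps_inv :: "'m tens2" where
  "eps_inv a b p = matrix_inv (transpose (\<chi> c d. e c d p)) $ a $ b"

definition raise :: "'m tens1 \<Rightarrow> 'm tens1" where
  "raise \<omega> a p = (\<Sum>b\<in>UNIV. eps_inv a b p * \<omega> b p)"

definition lower :: "'m tens1 \<Rightarrow> 'm tens1" where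
  "lower X b p = (\<Sum>a\<in>UNIV. X a p * e a b p)"

definition cotton_york :: "'m tens3" where
  "cotton_york a b c p = nabla_form2 Rho a b c p - nabla_form2 Rho b a c p"

definition Yl :: "'m tens1" where  \<comment> \<open>\<open>Y\<^sub>a\<close>\<close>
  "Yl a p = (\<Sum>b\<in>UNIV. \<Sum>c\<in>UNIV. eps_inv b c p * cotton_york b c a p)"

definition Y :: "'m tens1" where  \<comment> \<open>\<open>Y\<^sup>a\<close>\<close>
  "Y = raise Yl"

definition phi :: "'m \<Rightarrow> real" where
  "phi p = 2 * div_vec Y p"

definition W :: "'m tens1" where
  "W a p = (\<Sum>b\<in>UNIV. Y b p * nabla_vec Y b a p) - 2 * phi p / 3 * Y a p"

definition Wl :: "'m tens1" where  \<comment> \<open>\<open>W\<^sub>a\<close>\<close>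
  "Wl = lower W"

definition rho :: "'m \<Rightarrow> real" where
  "rho p = (\<Sum>a\<in>UNIV. Yl a p * W a p)"

definition ell :: "'m \<Rightarrow> real" where
  "ell p = 5 * (phi p)^2 / 12 + 3 * Rho2 Y Y p - along Y phi p / 2"

definition a1 :: "'m \<Rightarrow> real" where
  "a1 p = 15 * (along Y rho p / rho p - 5 * phi p / 2)"

definition a2 :: "'m \<Rightarrow> real" where
  "a2 p = - (3 * along W rho p / rho p + 6 * ell p - 3 * div_vec W p)"

definition a3 :: "'m \<Rightarrow> real" where
  "a3 p = along W phi p / 2 + phi p / 2 * div_vec W p + along Y ell p + phi p * ell p / 2
     - phi p * along W rho p / (2 * rho p) - ell p * (along Y rho p / rho p)"

definition b1 :: "'m \<Rightarrow> real" where
  "b1 p = - (5 * along_form W Y Wl p / rho p) + 50 * ell p / 3"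

definition b2 :: "'m \<Rightarrow> real" where
  "b2 p = along_form W W Wl p / rho p"

definition b3 :: "'m \<Rightarrow> real" where
  "b3 p = phi p * along_form W W Wl p / (6 * rho p) + Rho2 W W p + (ell p)^2 / 9
     + ell p * along_form W Y Wl p / (3 * rho p) + along W ell p / 3"

definition c1 :: "'m \<Rightarrow> real" where
  "c1 p = - (5 * (along_form W Y Yl p + along_form Y Y Wl p) / (2 * rho p)) - 25 * phi p / 6"

definition c2 :: "'m \<Rightarrow> real" where
  "c2 p = 2 * ell p / 3 + (along_form W W Yl p + along_form Y W Wl p) / (2 * rho p)"

definition c3 :: "'m \<Rightarrow> real" where
  "c3 p = - (along W phi p / 12) + phi p * along_form W W Yl p / (12 * rho p)
     + ell p * along_form W Y Yl p / (6 * rho p) + Rho2 W Y p + along Y ell p / 6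
     + phi p * along_form Y W Wl p / (12 * rho p) - ell p * phi p / 18
     + ell p * along_form Y Y Wl p / (6 * rho p)"

definition P1 :: "'m \<Rightarrow> real poly" where
  "P1 p = monom (-90) 6 + monom (a1 p) 4 + monom (a2 p) 2 + monom (- 9 * rho p) 1 + monom (a3 p) 0"

definition P2 :: "'m \<Rightarrow> real poly" where
  "P2 p = monom (-275) 8 + monom (b1 p) 4 + monom (20 * rho p) 3 + monom (b2 p) 2 + monom (b3 p) 0"

definition P3 :: "'m \<Rightarrow> real poly" where
  "P3 p = monom (-40) 6 + monom (c1 p) 4 + monom (c2 p) 2 + monom (rho p) 1 + monom (c3 p) 0"

definition F :: "'m tens1 \<Rightarrow> 'm \<Rightarrow> real" where
  "F \<alpha> p = (\<Sum>a\<in>UNIV. \<Sum>b\<in>UNIV.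
     eps_inv a b p * ((nabla_form \<alpha> a b p - nabla_form \<alpha> b a p) / 2))"

end


section \<open>Projective structures, the pEW equation and projective invariance\<close>

definition parallel :: "'m chart set \<Rightarrow> ('m chart \<Rightarrow> 'm tens2) \<Rightarrow> ('m chart \<Rightarrow> 'm tens3) \<Rightarrow> bool" where
  "parallel A e N \<longleftrightarrow>
     (\<forall>\<kappa>\<in>A. \<forall>p\<in>fst \<kappa>. \<forall>a b c. nabla_form2 \<kappa> (N \<kappa>) (e \<kappa>) a b c p = 0)"

text \<open>\<open>\<nabla>'\<^sub>a \<omega>\<^sub>b = \<nabla>\<^sub>a \<omega>\<^sub>b - \<Upsilon>\<^sub>a \<omega>\<^sub>b - \<Upsilon>\<^sub>b \<omega>\<^sub>a\<close>, for all smooth 1-forms on chart domains.\<close>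

definition projective_change ::
  "'m chart set \<Rightarrow> ('m chart \<Rightarrow> 'm tens1) \<Rightarrow> ('m chart \<Rightarrow> 'm tens3) \<Rightarrow> ('m chart \<Rightarrow> 'm tens3) \<Rightarrow> bool" where
  "projective_change A \<Upsilon> N N' \<longleftrightarrow>
     (\<forall>\<kappa>\<in>A. \<forall>\<omega>. (\<forall>a. smooth_in \<kappa> (fst \<kappa>) (\<omega> a)) \<longrightarrow>
        (\<forall>p\<in>fst \<kappa>. \<forall>a b. nabla_form \<kappa> (N' \<kappa>) \<omega> a b p =
           nabla_form \<kappa> (N \<kappa>) \<omega> a b p - \<Upsilon> \<kappa> a p * \<omega> b p - \<Upsilon> \<kappa> b p * \<omega> a p))"

definition projective_structure :: "'m chart set \<Rightarrow> ('m chart \<Rightarrow> 'm tens3) set \<Rightarrow> bool" where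
  "projective_structure A C \<longleftrightarrow>
     (\<exists>N. affine_connection A N \<and> torsion_free A N \<and>
        C = {N'. affine_connection A N' \<and> torsion_free A N' \<and>
                 (\<exists>\<Upsilon>. one_form A \<Upsilon> \<and> projective_change A \<Upsilon> N N')})"

definition pEW :: "'m chart set \<Rightarrow> ('m chart \<Rightarrow> 'm tens3) \<Rightarrow> ('m chart \<Rightarrow> 'm tens1) \<Rightarrow> bool" where
  "pEW A N \<alpha> \<longleftrightarrow> one_form A \<alpha> \<and>
     (\<forall>\<kappa>\<in>A. \<forall>p\<in>fst \<kappa>. \<forall>a b.
        (nabla_form \<kappa> (N \<kappa>) (\<alpha> \<kappa>) a b p + nabla_form \<kappa> (N \<kappa>) (\<alpha> \<kappa>) b a p) / 2
        + \<alpha> \<kappa> a p * \<alpha> \<kappa> b p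
        + (Rho \<kappa> (N \<kappa>) a b p + Rho \<kappa> (N \<kappa>) b a p) / 2 = 0)"

definition rho_nonzero :: "'m chart set \<Rightarrow> ('m chart \<Rightarrow> 'm tens2) \<Rightarrow> ('m chart \<Rightarrow> 'm tens3) \<Rightarrow> bool" where
  "rho_nonzero A e N \<longleftrightarrow> (\<forall>\<kappa>\<in>A. \<forall>p\<in>fst \<kappa>. rho \<kappa> (e \<kappa>) (N \<kappa>) p \<noteq> 0)"

text \<open>\<open>Q\<close> is a scalar expression in the volume form and the connection, evaluated in a chart. Its
  weight \<open>w\<close> depends neither on \<open>g\<close> nor on the pair \<open>(\<epsilon>, \<nabla>)\<close>. The assumption \<open>\<rho> \<noteq> 0\<close> is there
  because the expressions of interest have powers of \<open>\<rho>\<close> in the denominator.\<close>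

definition projective_invariant ::
  "'m chart set \<Rightarrow> ('m chart \<Rightarrow> 'm tens2 \<Rightarrow> 'm tens3 \<Rightarrow> 'm \<Rightarrow> real) \<Rightarrow> bool" where
  "projective_invariant A Q \<longleftrightarrow>
     (\<exists>w::real. \<forall>e N N' g.
        volume_form A e \<longrightarrow> affine_connection A N \<longrightarrow> torsion_free A N \<longrightarrow> parallel A e N \<longrightarrow>
        rho_nonzero A e N \<longrightarrow> smooth_function A g \<longrightarrow>
        affine_connection A N' \<longrightarrow> torsion_free A N' \<longrightarrow>
        projective_change A (\<lambda>\<kappa> a. pd \<kappa> a g) N N' \<longrightarrow>
        (\<forall>\<kappa>\<in>A. \<forall>p\<in>fst \<kappa>.
           Q \<kappa> (\<lambda>a b q. exp (3 * g q) * e \<kappa> a b q) (N' \<kappa>) p = exp (w * g p) * Q \<kappa> (e \<kappa>) (N \<kappa>) p))"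


section \<open>Checks of the conventions\<close>

lemma pd_const: "pd \<kappa> a (\<lambda>_. c) p = 0"
  by (simp add: pd_def partial_def in_chart_def o_def)

text \<open>\<open>(\<nabla>\<^sub>a \<nabla>\<^sub>b - \<nabla>\<^sub>b \<nabla>\<^sub>a) X\<^sup>c = R\<^sub>a\<^sub>b\<^sup>c\<^sub>d\<close> for the coordinate vector field \<open>X = \<partial>\<^sub>d\<close>\<close>

lemma riem_commutator:
  assumes tf: "\<And>c a b. G c a b p = G c b a p"
  defines "X d \<equiv> (\<lambda>c q. if c = d then 1 else 0)"
  shows "nabla_mixed \<kappa> G (nabla_vec \<kappa> G (X d)) a b c p - nabla_mixed \<kappa> G (nabla_vec \<kappa> G (X d)) b a c p
         = riem \<kappa> G a b c d p"
proof -
  have v: "nabla_vec \<kappa> G (X d) = (\<lambda>a c q. G c a d q)" for d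
    by (intro ext) (simp add: nabla_vec_def X_def pd_const if_distrib cong: if_cong)
  show ?thesis
    unfolding v by (simp add: nabla_mixed_def riem_def tf[of _ a b])
qed

lemma eps_inv:
  assumes skew: "\<And>a b. e a b p = - e b a p" and nz: "e 1 2 p \<noteq> 0"
  shows "(\<Sum>c\<in>UNIV. eps_inv e a c p * e b c p) = (if a = b then 1 else 0)"
    and "(\<Sum>a\<in>UNIV. \<Sum>b\<in>UNIV. eps_inv e a b p * e a b p) = 2"
proof -
  let ?M = "transpose (\<chi> c d. e c d p) :: real^2^2"
  have z: "e 1 1 p = 0" "e 2 2 p = 0"
    using skew[of 1 1] skew[of 2 2] by auto
  have "det ?M \<noteq> 0"
    using nz skew[of 1 2] by (simp add: det_2 transpose_def z)
  then have "matrix_inv ?M ** ?M = mat 1"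
    unfolding invertible_det_nz[symmetric] invertible_def matrix_inv_def
    by (rule someI2_ex) blast
  then have "(matrix_inv ?M ** ?M) $ a $ b = (mat 1 :: real^2^2) $ a $ b" for a b
    by simp
  then show *: "(\<Sum>c\<in>UNIV. eps_inv e a c p * e b c p) = (if a = b then 1 else 0)" for a b
    by (simp add: matrix_matrix_mult_def transpose_def mat_def eps_inv_def)
  show "(\<Sum>a\<in>UNIV. \<Sum>b\<in>UNIV. eps_inv e a b p * e a b p) = 2"
    by (simp add: *)
qed

end

theory Submission
  imports Defs
begin

text \<open>
  Write \<open>\<alpha>(X)\<close> for \<open>\<alpha>\<^sub>a X\<^sup>a\<close>. The pEW equation together with the definition of \<open>F\<close> says
  \<open>\<nabla>\<^sub>a \<alpha>\<^sub>b = - \<alpha>\<^sub>a \<alpha>\<^sub>b - P\<^sub>a\<^sub>b + F/2 \<epsilon>\<^sub>a\<^sub>b\<close> (\<open>nabla_\<alpha>\<close>), a system of first order for \<open>\<alpha>\<close> in which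
  \<open>F\<close> is unknown. Commuting the second derivatives of \<open>\<alpha>\<close> closes the system: \<open>dF = - 3 F \<alpha> - Y\<close>
  (\<open>pd_F\<close>). Commuting those of \<open>F\<close> gives the first algebraic consequence, \<open>\<alpha>(Y) = - F\<^sup>2 - \<phi>/6\<close>
  (\<open>\<alpha>_Y\<close>), and its derivative along \<open>Y\<close> the second, \<open>\<alpha>(W) = - 5 F\<^sup>4 + ell/3\<close> (\<open>\<alpha>_W\<close>). Because
  \<open>\<rho> = \<epsilon>(Y, W)\<close> does not vanish, \<open>Y\<close> and \<open>W\<close> form a frame and \<open>\<alpha>\<close> is now a known function of \<open>F\<close>
  and the projective quantities. Three derivatives are left: that of \<open>\<alpha>(Y)\<close> along \<open>W\<close> and those of
  \<open>\<alpha>(W)\<close> along \<open>Y\<close> and along \<open>W\<close>. Each is an algebraic equation for \<open>F\<close>. The last is \<open>P2(F) = 0\<close>;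
  the sum and the difference of the first two are, up to constant factors, \<open>P3(F) = 0\<close> and
  \<open>P1(F) = 0\<close>, the difference involving the derivatives of \<open>Y\<close> and \<open>W\<close> only through their bracket,
  whose components are given by divergences and derivatives of \<open>\<rho>\<close> (\<open>bracket_frame\<close>).

  For the projective invariance let \<open>U = dg\<close>. The Cotton-York tensor does not change at all
  (\<open>cotton_york_change\<close>), so \<open>Y\<close>, \<open>W\<close> and \<open>\<rho>\<close> are merely rescaled, while \<open>\<phi>\<close> and \<open>ell\<close> change by
  multiples of \<open>U(Y)\<close> and \<open>U(W)\<close>. The coefficients are built from these quantities by derivatives
  along \<open>Y\<close> and \<open>W\<close> and from the components of \<open>\<nabla>Y\<close> and \<open>\<nabla>W\<close> in the frame, whose changes follow
  from that of a covariant derivative of rescaled fields (\<open>cov_scaled\<close>). In each coefficient the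
  terms with \<open>g\<close> cancel, and what is left is a power of \<open>e\<^sup>g\<close> determined by the weight \<open>- 3\<close> of
  \<open>F\<close> (\<open>coeff_change\<close>).

  That the coefficients are functions on the surface means that the formulas give the same value
  in any two charts. The only object involved that is not a tensor is the connection. Its
  transformation law, contracted with the Jacobian matrix (\<open>G'_J\<close>), shows that \<open>\<nabla>\<^sub>X Z\<close> is a vector
  field and, after one more differentiation, that the curvature and hence \<open>P\<close> and \<open>Y\<close> are tensors
  (\<open>riem_chart_change\<close>, \<open>Rho_rel\<close>, \<open>Y_rel\<close>). Everything else is obtained from these by
  covariant differentiation and contraction.
\<close>

section \<open>Smooth functions on the plane\<close>

lemma partial_eqI:
  "(f has_derivative f') (at x) \<Longrightarrow> partial a f x = f' (axis a 1)"
  by (simp add: partial_def frechet_derivative_at[symmetric])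

lemma partial_cong:
  assumes "open U" "x \<in> U" "\<And>y. y \<in> U \<Longrightarrow> f y = g y"
  shows "partial a f x = partial a g x"
proof -
  have "(f has_derivative D) (at x) \<longleftrightarrow> (g has_derivative D) (at x)" for D
    using assms has_derivative_transform_within_open[of f D x UNIV U g]
      has_derivative_transform_within_open[of g D x UNIV U f] by auto
  then show ?thesis
    by (simp add: partial_def frechet_derivative_def)
qed

lemma partial_add:
  "f differentiable (at x) \<Longrightarrow> g differentiable (at x) \<Longrightarrow>
     partial a (\<lambda>y. f y + g y) x = partial a f x + partial a g x"
  unfolding frechet_derivative_works
  by (subst partial_eqI, rule has_derivative_add, assumption+) (simp add: partial_def)

lemma partial_mult:
  "f differentiable (at x) \<Longrightarrow> g differentiable (at x) \<Longrightarrow>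
     partial a (\<lambda>y. f y * g y) x = f x * partial a g x + partial a f x * g x"
  unfolding frechet_derivative_works
  by (subst partial_eqI, rule has_derivative_mult, assumption+) (simp add: partial_def)

lemma partial_inverse:
  assumes "f differentiable (at x)" "f x \<noteq> 0"
  shows "partial a (\<lambda>y. inverse (f y)) x = - (inverse (f x) * partial a f x * inverse (f x))"
proof -
  have "((\<lambda>y. inverse (f y)) has_derivative
      (\<lambda>h. - (inverse (f x) * frechet_derivative f (at x) h * inverse (f x)))) (at x)"
    using assms unfolding frechet_derivative_works by (intro Deriv.has_derivative_inverse)
  from partial_eqI[OF this] show ?thesis
    by (simp add: partial_def)
qed

lemma Ck_on_cong:
  assumes "open U" "\<And>y. y \<in> U \<Longrightarrow> f y = g y"
  shows "Ck_on k U f \<longleftrightarrow> Ck_on k U g"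
  using assms(2)
proof (induction k arbitrary: f g)
  case 0
  then show ?case by (auto cong: continuous_on_cong)
next
  case (Suc k)
  have "f differentiable_on U \<longleftrightarrow> g differentiable_on U"
    using Suc.prems unfolding differentiable_on_def
    by (metis differentiable_transform_within zero_less_one)
  moreover have "Ck_on k U (partial a f) \<longleftrightarrow> Ck_on k U (partial a g)" for a
    using Suc.prems assms(1) by (intro Suc.IH partial_cong[of U])
  ultimately show ?case by simp
qed

lemma Ck_on_differentiable:
  "Ck_on (Suc k) U f \<Longrightarrow> open U \<Longrightarrow> x \<in> U \<Longrightarrow> f differentiable (at x)"
  by (auto simp: differentiable_on_eq_differentiable_at)

lemma Ck_on_SucD: "Ck_on (Suc k) U f \<Longrightarrow> Ck_on k U f"
proof (induction k arbitrary: f)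
  case 0
  then show ?case by (auto intro: differentiable_imp_continuous_on)
next
  case (Suc k)
  then show ?case by (metis Ck_on.simps(2))
qed

lemma Ck_on_subset: "Ck_on k U f \<Longrightarrow> V \<subseteq> U \<Longrightarrow> Ck_on k V f"
  by (induction k arbitrary: f) (auto intro: continuous_on_subset differentiable_on_subset)

lemma partial_const: "partial a (\<lambda>_. c) = (\<lambda>_. 0)"
  by (simp add: partial_def fun_eq_iff)

lemma Ck_on_const: "Ck_on k U (\<lambda>_. c)"
  by (induction k arbitrary: c) (auto simp: partial_const)

lemma Ck_on_add:
  "open U \<Longrightarrow> Ck_on k U f \<Longrightarrow> Ck_on k U g \<Longrightarrow> Ck_on k U (\<lambda>x. f x + g x)"
proof (induction k arbitrary: f g)
  case 0
  then show ?case by (auto intro: continuous_on_add)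
next
  case (Suc k)
  have "Ck_on k U (partial a (\<lambda>x. f x + g x))" for a
    using Suc.prems Suc.IH[of "partial a f" "partial a g"]
    by (subst Ck_on_cong[of U _ "\<lambda>x. partial a f x + partial a g x"])
      (auto intro!: partial_add Ck_on_differentiable[of k U])
  with Suc.prems show ?case by auto
qed

lemma Ck_on_mult:
  "open U \<Longrightarrow> Ck_on k U f \<Longrightarrow> Ck_on k U g \<Longrightarrow> Ck_on k U (\<lambda>x. f x * g x)"
proof (induction k arbitrary: f g)
  case 0
  then show ?case by (auto intro: continuous_on_mult)
next
  case (Suc k)
  have "Ck_on k U (partial a (\<lambda>x. f x * g x))" for a
    using Suc.prems Suc.IH[of f "partial a g"] Suc.IH[of "partial a f" g] Ck_on_SucD[of k U]
    by (subst Ck_on_cong[of U _ "\<lambda>x. f x * partial a g x + partial a f x * g x"])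
      (auto intro!: partial_mult Ck_on_differentiable[of k U] Ck_on_add)
  with Suc.prems show ?case by auto
qed

lemma Ck_on_inverse:
  "open U \<Longrightarrow> Ck_on k U f \<Longrightarrow> (\<And>x. x \<in> U \<Longrightarrow> f x \<noteq> 0) \<Longrightarrow> Ck_on k U (\<lambda>x. inverse (f x))"
proof (induction k arbitrary: f)
  case 0
  then show ?case by (auto intro: continuous_on_inverse)
next
  case (Suc k)
  have inv: "Ck_on k U (\<lambda>x. inverse (f x))"
    using Suc.prems Suc.IH Ck_on_SucD by blast
  have "Ck_on k U (\<lambda>x. (- 1) * (inverse (f x) * partial a f x * inverse (f x)))" for a
    using Suc.prems inv by (intro Ck_on_mult Ck_on_const) auto
  then have "Ck_on k U (partial a (\<lambda>x. inverse (f x)))" for a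
    using Suc.prems partial_inverse[OF Ck_on_differentiable[OF Suc.prems(2,1)]]
    by (subst Ck_on_cong[of U _ "\<lambda>x. (- 1) * (inverse (f x) * partial a f x * inverse (f x))"]) auto
  with Suc.prems show ?case
    by (auto simp: differentiable_on_def intro: differentiable_inverse)
qed

lemma has_derivative_exp_comp:
  fixes f :: "real^2 \<Rightarrow> real"
  assumes "f differentiable (at x)"
  shows "((\<lambda>y. exp (f y)) has_derivative (\<lambda>h. frechet_derivative f (at x) h * exp (f x))) (at x)"
  using assms unfolding frechet_derivative_works by (rule has_derivative_exp)

lemma partial_exp: "f differentiable (at x) \<Longrightarrow> partial a (\<lambda>y. exp (f y)) x = exp (f x) * partial a f x"
  using partial_eqI[OF has_derivative_exp_comp] by (simp add: partial_def)

lemma Ck_on_exp: "open U \<Longrightarrow> Ck_on k U f \<Longrightarrow> Ck_on k U (\<lambda>x. exp (f x))"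
proof (induction k arbitrary: f)
  case 0
  then show ?case by (auto intro: continuous_on_exp)
next
  case (Suc k)
  have "Ck_on k U (\<lambda>x. exp (f x) * partial a f x)" for a
    using Suc.prems Suc.IH[OF _ Ck_on_SucD] by (intro Ck_on_mult) auto
  then have "Ck_on k U (partial a (\<lambda>x. exp (f x)))" for a
    using Suc.prems partial_exp[OF Ck_on_differentiable[OF Suc.prems(2,1)]]
    by (subst Ck_on_cong[of U _ "\<lambda>x. exp (f x) * partial a f x"]) auto
  moreover have "(\<lambda>x. exp (f x)) differentiable_on U"
    using Suc.prems(1) differentiableI[OF has_derivative_exp_comp[OF Ck_on_differentiable[OF Suc.prems(2,1)]]]
    by (simp add: differentiable_on_eq_differentiable_at)
  ultimately show ?case by simp
qed

text \<open>The mean value theorem is applied twice: to the increment in direction \<open>b\<close>, as a function of the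
  \<open>a\<close>-coordinate, and then to \<open>\<partial>\<^sub>a f\<close> in direction \<open>b\<close>.\<close>

lemma mixed_difference_mean_value:
  fixes f :: "real^2 \<Rightarrow> real" and u v :: "real^2"
  assumes h: "0 < h"
    and box: "\<And>s t. 0 \<le> s \<Longrightarrow> s \<le> h \<Longrightarrow> 0 \<le> t \<Longrightarrow> t \<le> h \<Longrightarrow>
      f differentiable (at (x + s *\<^sub>R axis a 1 + t *\<^sub>R axis b 1)) \<and>
      partial a f differentiable (at (x + s *\<^sub>R axis a 1 + t *\<^sub>R axis b 1))"
  obtains s t where "0 < s" "s < h" "0 < t" "t < h"
    "f (x + h *\<^sub>R axis a 1 + h *\<^sub>R axis b 1) - f (x + h *\<^sub>R axis a 1)
       - f (x + h *\<^sub>R axis b 1) + f x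
     = h * h * partial b (partial a f) (x + s *\<^sub>R axis a 1 + t *\<^sub>R axis b 1)"
proof -
  let ?P = "\<lambda>s t. x + s *\<^sub>R axis a 1 + t *\<^sub>R axis b (1::real)"
  have line: "((\<lambda>s. g (y + s *\<^sub>R axis c 1)) has_real_derivative partial c g (y + s *\<^sub>R axis c 1)) (at s)"
    if "g differentiable (at (y + s *\<^sub>R axis c 1))" for g :: "real^2 \<Rightarrow> real" and y s c
  proof -
    let ?D = "frechet_derivative g (at (y + s *\<^sub>R axis c 1))"
    have D: "(g has_derivative ?D) (at (y + s *\<^sub>R axis c 1))"
      using that by (simp add: frechet_derivative_works)
    have "((\<lambda>s. g (y + s *\<^sub>R axis c 1)) has_derivative (\<lambda>k. ?D (k *\<^sub>R axis c 1))) (at s)"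
      by (rule has_derivative_compose[where g = g and f = "\<lambda>s. y + s *\<^sub>R axis c 1", OF _ D]) (auto intro!: derivative_eq_intros)
    moreover have "?D (k *\<^sub>R axis c 1) = k *\<^sub>R ?D (axis c 1)" for k
      using has_derivative_linear[OF D] by (rule linear_scale)
    ultimately show ?thesis
      by (simp add: has_field_derivative_def partial_def mult.commute[of _ "?D (axis c 1)"] mult_commute_abs)
  qed
  have "\<exists>s>0. s < h \<and> (f (?P h h) - f (?P h 0)) - (f (?P 0 h) - f (?P 0 0))
      = (h - 0) * (partial a f (?P s h) - partial a f (?P s 0))"
  proof (rule MVT2[OF h, where f = "\<lambda>s. f (?P s h) - f (?P s 0)"])
    fix s assume s: "0 \<le> s" "s \<le> h"
    have shift: "?P s t = (x + t *\<^sub>R axis b 1) + s *\<^sub>R axis a 1" for s t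
      by (simp add: algebra_simps)
    show "((\<lambda>s. f (?P s h) - f (?P s 0)) has_real_derivative
        partial a f (?P s h) - partial a f (?P s 0)) (at s)"
      unfolding shift using box[of s h] box[of s 0] s h
      by (intro DERIV_diff line) (simp_all add: algebra_simps)
  qed
  then obtain s where s: "0 < s" "s < h" and
    d1: "(f (?P h h) - f (?P h 0)) - (f (?P 0 h) - f (?P 0 0))
      = h * (partial a f (?P s h) - partial a f (?P s 0))" by auto
  have "\<exists>t>0. t < h \<and> partial a f (?P s h) - partial a f (?P s 0)
      = (h - 0) * partial b (partial a f) (?P s t)"
    using box[of s] s by (intro MVT2[OF h] line) auto
  then obtain t where "0 < t" "t < h" "partial a f (?P s h) - partial a f (?P s 0)
      = h * partial b (partial a f) (?P s t)" by auto
  with s d1 show ?thesis by (intro that[of s t]) auto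
qed

text \<open>The second difference of \<open>f\<close> over a small square is symmetric in the two directions, and either
  order of taking mean values expresses it by one of the two mixed derivatives at a point of the
  square. If they differed at \<open>x\<close>, continuity would keep them apart on a whole neighbourhood.\<close>

lemma partial_commute:
  assumes C2: "Ck_on 2 U f" and U: "open U" "x \<in> U"
  shows "partial a (partial b f) x = partial b (partial a f) x"
proof (rule ccontr)
  define \<delta> where "\<delta> = \<bar>partial a (partial b f) x - partial b (partial a f) x\<bar> / 2"
  assume "partial a (partial b f) x \<noteq> partial b (partial a f) x"
  then have \<delta>: "\<delta> > 0" by (simp add: \<delta>_def)
  have C: "Ck_on (Suc (Suc 0)) U f" using C2 by (simp only: numeral_2_eq_2)
  then have diff: "f differentiable (at y)" "partial c f differentiable (at y)" if "y \<in> U" for y c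
    using that U Ck_on_differentiable[of "Suc 0" U f] Ck_on_differentiable[of 0 U "partial c f"]
    by auto
  have near: "\<exists>d>0. \<forall>y. dist y x < d \<longrightarrow>
      \<bar>partial c (partial c' f) y - partial c (partial c' f) x\<bar> < \<delta>" for c c'
  proof -
    have "continuous (at x) (partial c (partial c' f))"
      using C U by (simp add: continuous_on_eq_continuous_at)
    then show ?thesis
      using \<delta> unfolding continuous_at_eps_delta dist_real_def by blast
  qed
  obtain d1 where d1_pos: "d1 > 0"
    and d1: "\<And>y. dist y x < d1 \<Longrightarrow> \<bar>partial a (partial b f) y - partial a (partial b f) x\<bar> < \<delta>"
    using near[of a b] by blast
  obtain d2 where d2_pos: "d2 > 0"
    and d2: "\<And>y. dist y x < d2 \<Longrightarrow> \<bar>partial b (partial a f) y - partial b (partial a f) x\<bar> < \<delta>"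
    using near[of b a] by blast
  obtain d3 where d3_pos: "d3 > 0" and d3: "\<And>y. dist y x < d3 \<Longrightarrow> y \<in> U"
    using U unfolding open_dist by blast
  note d = d1_pos d2_pos d3_pos
  \<comment> \<open>Points of the square with side \<open>h\<close> have distance at most \<open>2 h\<close> from \<open>x\<close>.\<close>
  define h where "h = min d1 (min d2 d3) / 3"
  have h: "0 < h" "3 * h \<le> d1" "3 * h \<le> d2" "3 * h \<le> d3" using d by (auto simp: h_def)
  have close: "dist (x + s *\<^sub>R axis c 1 + t *\<^sub>R axis c' 1) x < 3 * h"
    if "0 \<le> s" "s \<le> h" "0 \<le> t" "t \<le> h" for s t and c c' :: 2
  proof -
    have "norm (s *\<^sub>R axis c (1::real) + t *\<^sub>R axis c' 1) \<le> s + t"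
      using that by (intro order_trans[OF norm_triangle_ineq]) (simp add: norm_axis_1)
    moreover have "x + s *\<^sub>R axis c 1 + t *\<^sub>R axis c' 1 - x = s *\<^sub>R axis c (1::real) + t *\<^sub>R axis c' 1"
      by simp
    ultimately show ?thesis using that h(1) by (simp add: dist_norm)
  qed
  have inU: "x + s *\<^sub>R axis c 1 + t *\<^sub>R axis c' 1 \<in> U"
    if "0 \<le> s" "s \<le> h" "0 \<le> t" "t \<le> h" for s t and c c' :: 2
    using close[OF that, of c c'] h d3 by force
  obtain s t where st: "0 < s" "s < h" "0 < t" "t < h"
    and e1: "f (x + h *\<^sub>R axis a 1 + h *\<^sub>R axis b 1) - f (x + h *\<^sub>R axis a 1)
       - f (x + h *\<^sub>R axis b 1) + f x
     = h * h * partial b (partial a f) (x + s *\<^sub>R axis a 1 + t *\<^sub>R axis b 1)"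
    using mixed_difference_mean_value[of h f x a b] h(1) diff inU by metis
  obtain s' t' where st': "0 < s'" "s' < h" "0 < t'" "t' < h"
    and e2: "f (x + h *\<^sub>R axis b 1 + h *\<^sub>R axis a 1) - f (x + h *\<^sub>R axis b 1)
       - f (x + h *\<^sub>R axis a 1) + f x
     = h * h * partial a (partial b f) (x + s' *\<^sub>R axis b 1 + t' *\<^sub>R axis a 1)"
    using mixed_difference_mean_value[of h f x b a] h(1) diff inU by metis
  have "h * h * partial b (partial a f) (x + s *\<^sub>R axis a 1 + t *\<^sub>R axis b 1)
      = h * h * partial a (partial b f) (x + s' *\<^sub>R axis b 1 + t' *\<^sub>R axis a 1)"
    using e1 e2 by (simp add: algebra_simps)
  then have "partial b (partial a f) (x + s *\<^sub>R axis a 1 + t *\<^sub>R axis b 1)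
      = partial a (partial b f) (x + s' *\<^sub>R axis b 1 + t' *\<^sub>R axis a 1)"
    using h(1) by simp
  moreover have "\<bar>partial b (partial a f) (x + s *\<^sub>R axis a 1 + t *\<^sub>R axis b 1)
      - partial b (partial a f) x\<bar> < \<delta>"
    using st close[of s t a b] h by (intro d2) auto
  moreover have "\<bar>partial a (partial b f) (x + s' *\<^sub>R axis b 1 + t' *\<^sub>R axis a 1)
      - partial a (partial b f) x\<bar> < \<delta>"
    using st' close[of s' t' b a] h by (intro d1) auto
  moreover have False if "z = w" "\<bar>z - B\<bar> < \<bar>A - B\<bar> / 2" "\<bar>w - A\<bar> < \<bar>A - B\<bar> / 2" for z w A B :: real
    using dist_triangle_half_l[of A z "\<bar>A - B\<bar>" B] that
    by (simp add: dist_real_def abs_minus_commute)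
  ultimately show False
    unfolding \<delta>_def by blast
qed

section \<open>Differentiation of functions in a chart\<close>

text \<open>Differentiability at a single point is enough for the rules of \<open>pd\<close>, and by the chain rule it
  passes from one chart to another.\<close>

definition differentiable_in :: "'m chart \<Rightarrow> ('m \<Rightarrow> real) \<Rightarrow> 'm \<Rightarrow> bool" where
  "differentiable_in \<kappa> f p \<longleftrightarrow> in_chart \<kappa> f differentiable (at (snd \<kappa> p))"

lemma in_chart_comp: "in_chart \<kappa> (\<lambda>q. h (f q)) = (\<lambda>x. h (in_chart \<kappa> f x))"
  "in_chart \<kappa> (\<lambda>q. h2 (f q) (g q)) = (\<lambda>x. h2 (in_chart \<kappa> f x) (in_chart \<kappa> g x))"
  by (auto simp: in_chart_def)

lemma differentiable_in_const [simp]: "differentiable_in \<kappa> (\<lambda>_. c) p"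
  by (simp add: differentiable_in_def in_chart_def o_def)

lemma differentiable_in_add [simp]:
  "differentiable_in \<kappa> f p \<Longrightarrow> differentiable_in \<kappa> g p \<Longrightarrow> differentiable_in \<kappa> (\<lambda>q. f q + g q) p"
  by (simp add: differentiable_in_def in_chart_comp(2)[where ?h2.0 = plus])

lemma differentiable_in_mult [simp]:
  "differentiable_in \<kappa> f p \<Longrightarrow> differentiable_in \<kappa> g p \<Longrightarrow> differentiable_in \<kappa> (\<lambda>q. f q * g q) p"
  by (simp add: differentiable_in_def in_chart_comp(2)[where ?h2.0 = times])

lemma differentiable_in_minus [simp]:
  "differentiable_in \<kappa> f p \<Longrightarrow> differentiable_in \<kappa> (\<lambda>q. - f q) p"
  by (simp add: differentiable_in_def in_chart_comp(1)[where h = uminus])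

lemma differentiable_in_diff [simp]:
  "differentiable_in \<kappa> f p \<Longrightarrow> differentiable_in \<kappa> g p \<Longrightarrow> differentiable_in \<kappa> (\<lambda>q. f q - g q) p"
  by (simp add: differentiable_in_def in_chart_comp(2)[where ?h2.0 = minus])

lemma differentiable_in_power [simp]:
  "differentiable_in \<kappa> f p \<Longrightarrow> differentiable_in \<kappa> (\<lambda>q. f q ^ n) p"
  by (induction n) simp_all

lemma differentiable_in_exp [simp]:
  "differentiable_in \<kappa> f p \<Longrightarrow> differentiable_in \<kappa> (\<lambda>q. exp (f q)) p"
  unfolding differentiable_in_def in_chart_comp(1)[where h = exp]
  by (rule differentiableI) (rule has_derivative_exp_comp)

lemma pd_add:
  "differentiable_in \<kappa> f p \<Longrightarrow> differentiable_in \<kappa> g p \<Longrightarrow>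
     pd \<kappa> a (\<lambda>q. f q + g q) p = pd \<kappa> a f p + pd \<kappa> a g p"
  by (simp add: differentiable_in_def pd_def in_chart_comp(2)[where ?h2.0 = plus] partial_add)

locale surface_chart =
  fixes \<kappa> :: "('m::{t2_space,second_countable_topology}) chart"
  assumes open_domain: "open (fst \<kappa>)"
    and open_range: "open (snd \<kappa> ` fst \<kappa>)"
    and homeomorphic: "\<exists>\<psi>. homeomorphism (fst \<kappa>) (snd \<kappa> ` fst \<kappa>) (snd \<kappa>) \<psi>"
begin

abbreviation V where "V \<equiv> fst \<kappa>"

lemma inj: "inj_on (snd \<kappa>) V"
proof -
  obtain \<psi> where "homeomorphism V (snd \<kappa> ` V) (snd \<kappa>) \<psi>"
    using homeomorphic ..
  then show ?thesis
    by (intro inj_on_inverseI[of _ \<psi>]) (simp add: homeomorphism_def)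
qed

lemma in_chart_at [simp]: "p \<in> V \<Longrightarrow> in_chart \<kappa> f (snd \<kappa> p) = f p"
  by (simp add: in_chart_def inj)

lemma open_image:
  assumes "open U" "U \<subseteq> V"
  shows "open (snd \<kappa> ` U)"
proof -
  obtain \<psi> where "homeomorphism V (snd \<kappa> ` V) (snd \<kappa>) \<psi>"
    using homeomorphic ..
  moreover have "openin (top_of_set V) U"
    using assms open_domain by (simp add: openin_open_eq)
  ultimately have "openin (top_of_set (snd \<kappa> ` V)) (snd \<kappa> ` U)"
    using homeomorphism_imp_open_map by blast
  then show ?thesis
    using open_range openin_open_trans by blast
qed

lemma in_chart_cong:
  assumes "U \<subseteq> V" "\<And>q. q \<in> U \<Longrightarrow> f q = g q" "x \<in> snd \<kappa> ` U"
  shows "in_chart \<kappa> f x = in_chart \<kappa> g x"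
  using assms in_chart_at by (metis imageE subsetD)

lemma pd_cong:
  assumes "open U" "U \<subseteq> V" "p \<in> U" "\<And>q. q \<in> U \<Longrightarrow> f q = g q"
  shows "pd \<kappa> a f p = pd \<kappa> a g p"
  unfolding pd_def
  by (rule partial_cong[OF open_image[OF assms(1,2)]])
    (use assms(3) in_chart_cong[of U f g, OF assms(2,4)] in auto)

lemma pd_mult:
  assumes "differentiable_in \<kappa> f p" "differentiable_in \<kappa> g p" "p \<in> V"
  shows "pd \<kappa> a (\<lambda>q. f q * g q) p = f p * pd \<kappa> a g p + pd \<kappa> a f p * g p"
  using assms
  by (simp add: differentiable_in_def pd_def in_chart_comp(2)[where ?h2.0 = times] partial_mult)

lemma pd_minus: "differentiable_in \<kappa> f p \<Longrightarrow> p \<in> V \<Longrightarrow> pd \<kappa> a (\<lambda>q. - f q) p = - pd \<kappa> a f p"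
  using pd_mult[of "\<lambda>_. - 1" p f] by (simp add: pd_const)

lemma pd_diff:
  "differentiable_in \<kappa> f p \<Longrightarrow> differentiable_in \<kappa> g p \<Longrightarrow> p \<in> V \<Longrightarrow>
     pd \<kappa> a (\<lambda>q. f q - g q) p = pd \<kappa> a f p - pd \<kappa> a g p"
  using pd_add[of \<kappa> f p "\<lambda>q. - g q" a] by (simp add: pd_minus)

lemma differentiable_in_inverse [simp]:
  assumes "differentiable_in \<kappa> f p" "f p \<noteq> 0" "p \<in> V"
  shows "differentiable_in \<kappa> (\<lambda>q. inverse (f q)) p"
  using assms unfolding differentiable_in_def in_chart_comp(1)[where h = inverse]
  by (intro differentiable_inverse) auto

lemma pd_inverse:
  assumes "differentiable_in \<kappa> f p" "f p \<noteq> 0" "p \<in> V"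
  shows "pd \<kappa> a (\<lambda>q. inverse (f q)) p = - (inverse (f p) * pd \<kappa> a f p * inverse (f p))"
  using assms
  by (simp add: differentiable_in_def pd_def in_chart_comp(1)[where h = inverse] partial_inverse)

lemma differentiable_in_divide [simp]:
  assumes "differentiable_in \<kappa> f p" "differentiable_in \<kappa> g p" "g p \<noteq> 0" "p \<in> V"
  shows "differentiable_in \<kappa> (\<lambda>q. f q / g q) p"
  using assms by (simp add: divide_inverse)

lemma pd_divide:
  assumes "differentiable_in \<kappa> f p" "differentiable_in \<kappa> g p" "g p \<noteq> 0" "p \<in> V"
  shows "pd \<kappa> a (\<lambda>q. f q / g q) p = (pd \<kappa> a f p - f p * pd \<kappa> a g p / g p) / g p"
  using assms by (simp add: divide_inverse pd_mult pd_inverse algebra_simps)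

lemma pd_power2:
  "differentiable_in \<kappa> f p \<Longrightarrow> p \<in> V \<Longrightarrow> pd \<kappa> a (\<lambda>q. (f q)\<^sup>2) p = 2 * f p * pd \<kappa> a f p"
  by (simp add: power2_eq_square pd_mult)

lemma pd_power4:
  "differentiable_in \<kappa> f p \<Longrightarrow> p \<in> V \<Longrightarrow> pd \<kappa> a (\<lambda>q. (f q)^4) p = 4 * (f p)^3 * pd \<kappa> a f p"
  by (simp add: numeral_eq_Suc pd_mult algebra_simps)

lemma pd_exp:
  assumes "differentiable_in \<kappa> f p" "p \<in> V"
  shows "pd \<kappa> a (\<lambda>q. exp (f q)) p = exp (f p) * pd \<kappa> a f p"
  using assms partial_eqI[OF has_derivative_exp_comp[of "in_chart \<kappa> f" "snd \<kappa> p"], of a]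
  by (simp add: differentiable_in_def pd_def in_chart_comp(1)[where h = exp] partial_def)

lemmas pd_rules = pd_const pd_add pd_mult pd_minus pd_diff pd_divide pd_power2 pd_power4 pd_exp

lemma smooth_in_differentiable:
  "smooth_in \<kappa> U f \<Longrightarrow> open U \<Longrightarrow> U \<subseteq> V \<Longrightarrow> p \<in> U \<Longrightarrow> differentiable_in \<kappa> f p"
  unfolding smooth_in_def smooth_on_def differentiable_in_def
  by (rule Ck_on_differentiable[of 0 "snd \<kappa> ` U"]) (auto intro: open_image)

lemma smooth_in_cong:
  assumes "open U" "U \<subseteq> V" "\<And>q. q \<in> U \<Longrightarrow> f q = g q"
  shows "smooth_in \<kappa> U f \<longleftrightarrow> smooth_in \<kappa> U g"
  unfolding smooth_in_def smooth_on_def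
  using Ck_on_cong[OF open_image[OF assms(1,2)] in_chart_cong[OF assms(2,3)]] by simp

lemma smooth_in_pd:
  assumes "smooth_in \<kappa> U f" "open U" "U \<subseteq> V"
  shows "smooth_in \<kappa> U (pd \<kappa> a f)"
proof -
  have "in_chart \<kappa> (pd \<kappa> a f) x = partial a (in_chart \<kappa> f) x" if "x \<in> snd \<kappa> ` U" for x
    using that assms(3) by (auto simp: pd_def dest: subsetD)
  then have "Ck_on k (snd \<kappa> ` U) (in_chart \<kappa> (pd \<kappa> a f))
      \<longleftrightarrow> Ck_on k (snd \<kappa> ` U) (partial a (in_chart \<kappa> f))" for k
    by (intro Ck_on_cong open_image assms) auto
  then show ?thesis
    using assms(1) unfolding smooth_in_def smooth_on_def by (metis Ck_on.simps(2))
qed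

lemma pd_commute:
  assumes "smooth_in \<kappa> U f" "open U" "U \<subseteq> V" "p \<in> U"
  shows "pd \<kappa> a (pd \<kappa> b f) p = pd \<kappa> b (pd \<kappa> a f) p"
proof -
  have eq: "pd \<kappa> a (pd \<kappa> b f) p = partial a (partial b (in_chart \<kappa> f)) (snd \<kappa> p)" for a b
    unfolding pd_def[of \<kappa> a]
    by (rule partial_cong[OF open_image[OF assms(2,3)]]) (use assms(3,4) in \<open>auto simp: pd_def dest: subsetD\<close>)
  show ?thesis
    unfolding eq using assms(1,4) open_image[OF assms(2,3)]
    by (intro partial_commute) (auto simp: smooth_in_def smooth_on_def)
qed

lemma smooth_in_const [simp]: "smooth_in \<kappa> U (\<lambda>_. c)"
  by (simp add: smooth_in_def smooth_on_def in_chart_def o_def Ck_on_const)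

context
  fixes U assumes U: "open U" "U \<subseteq> V"
begin

lemma smooth_in_add:
  "smooth_in \<kappa> U f \<Longrightarrow> smooth_in \<kappa> U g \<Longrightarrow> smooth_in \<kappa> U (\<lambda>q. f q + g q)"
  by (simp add: smooth_in_def smooth_on_def in_chart_comp(2)[where ?h2.0 = plus]
      Ck_on_add[OF open_image[OF U]])

lemma smooth_in_mult:
  "smooth_in \<kappa> U f \<Longrightarrow> smooth_in \<kappa> U g \<Longrightarrow> smooth_in \<kappa> U (\<lambda>q. f q * g q)"
  by (simp add: smooth_in_def smooth_on_def in_chart_comp(2)[where ?h2.0 = times]
      Ck_on_mult[OF open_image[OF U]])

lemma smooth_in_inverse:
  "smooth_in \<kappa> U f \<Longrightarrow> (\<And>q. q \<in> U \<Longrightarrow> f q \<noteq> 0) \<Longrightarrow> smooth_in \<kappa> U (\<lambda>q. inverse (f q))"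
  unfolding smooth_in_def smooth_on_def in_chart_comp(1)[where h = inverse]
  using U(2) by (auto intro!: Ck_on_inverse[OF open_image[OF U]] dest: subsetD)

lemma smooth_in_minus: "smooth_in \<kappa> U f \<Longrightarrow> smooth_in \<kappa> U (\<lambda>q. - f q)"
  using smooth_in_mult[of "\<lambda>_. - 1" f] by simp

lemma smooth_in_diff:
  "smooth_in \<kappa> U f \<Longrightarrow> smooth_in \<kappa> U g \<Longrightarrow> smooth_in \<kappa> U (\<lambda>q. f q - g q)"
  using smooth_in_add[of f "\<lambda>q. - g q"] smooth_in_minus[of g] by simp

lemma smooth_in_divide:
  "smooth_in \<kappa> U f \<Longrightarrow> smooth_in \<kappa> U g \<Longrightarrow> (\<And>q. q \<in> U \<Longrightarrow> g q \<noteq> 0) \<Longrightarrow>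
     smooth_in \<kappa> U (\<lambda>q. f q / g q)"
  using smooth_in_mult[of f "\<lambda>q. inverse (g q)"] smooth_in_inverse[of g] by (simp add: divide_inverse)

lemma smooth_in_exp: "smooth_in \<kappa> U f \<Longrightarrow> smooth_in \<kappa> U (\<lambda>q. exp (f q))"
  by (simp add: smooth_in_def smooth_on_def in_chart_comp(1)[where h = exp] Ck_on_exp[OF open_image[OF U]])

lemma smooth_in_power: "smooth_in \<kappa> U f \<Longrightarrow> smooth_in \<kappa> U (\<lambda>q. f q ^ n)"
  by (induction n) (simp_all add: smooth_in_mult)

end

end

section \<open>Covariant calculus in a chart with a parallel area form\<close>

definition pairing :: "'m tens1 \<Rightarrow> 'm tens1 \<Rightarrow> 'm \<Rightarrow> real" where
  "pairing \<omega> X p = (\<Sum>a\<in>UNIV. \<omega> a p * X a p)"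

definition area :: "'m tens2 \<Rightarrow> 'm tens1 \<Rightarrow> 'm tens1 \<Rightarrow> 'm \<Rightarrow> real" where
  "area e X Z p = (\<Sum>a\<in>UNIV. \<Sum>b\<in>UNIV. e a b p * X a p * Z b p)"

text \<open>The covariant derivative \<open>\<nabla>\<^sub>X Z\<close> as a vector field. Together with \<open>area\<close>, which is \<open>\<epsilon>(X, Z)\<close>,
  and \<open>pairing\<close> it allows most of the argument to be carried out without components.\<close>

definition cov :: "'m chart \<Rightarrow> 'm tens3 \<Rightarrow> 'm tens1 \<Rightarrow> 'm tens1 \<Rightarrow> 'm tens1" where
  "cov \<kappa> G X Z c p = (\<Sum>a\<in>UNIV. X a p * nabla_vec \<kappa> G Z a c p)"

text \<open>The tensor operations are rewritten as functions of the point, with the index sums written out,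
  so that \<open>pd\<close> can be moved through them by the rules of differentiation.\<close>

lemma nabla_vec_fun: "nabla_vec \<kappa> G X a c = (\<lambda>p. pd \<kappa> a (X c) p + (G c a 1 p * X 1 p + G c a 2 p * X 2 p))"
  by (simp add: fun_eq_iff nabla_vec_def sum_2)

lemma nabla_form_fun: "nabla_form \<kappa> G \<omega> a b = (\<lambda>p. pd \<kappa> a (\<omega> b) p - (G 1 a b p * \<omega> 1 p + G 2 a b p * \<omega> 2 p))"
  by (simp add: fun_eq_iff nabla_form_def sum_2)

lemma nabla_form2_fun: "nabla_form2 \<kappa> G T a b c = (\<lambda>p. pd \<kappa> a (T b c) p
    - (G 1 a b p * T 1 c p + G 2 a b p * T 2 c p) - (G 1 a c p * T b 1 p + G 2 a c p * T b 2 p))"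
  by (simp add: fun_eq_iff nabla_form2_def sum_2)

lemma pairing_fun: "pairing \<omega> X = (\<lambda>p. \<omega> 1 p * X 1 p + \<omega> 2 p * X 2 p)"
  by (simp add: fun_eq_iff pairing_def sum_2)

lemma area_fun: "area e X Z = (\<lambda>p. e 1 1 p * X 1 p * Z 1 p + e 1 2 p * X 1 p * Z 2 p
    + (e 2 1 p * X 2 p * Z 1 p + e 2 2 p * X 2 p * Z 2 p))"
  by (simp add: fun_eq_iff area_def sum_2)

lemma cov_fun: "cov \<kappa> G X Z c = (\<lambda>p. X 1 p * nabla_vec \<kappa> G Z 1 c p + X 2 p * nabla_vec \<kappa> G Z 2 c p)"
  by (simp add: fun_eq_iff cov_def sum_2)

lemma along_fun: "along \<kappa> X f = (\<lambda>p. X 1 p * pd \<kappa> 1 f p + X 2 p * pd \<kappa> 2 f p)"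
  by (simp add: fun_eq_iff along_def sum_2)

lemma along_form_fun: "along_form \<kappa> G X Z \<omega> =
    (\<lambda>p. X 1 p * Z 1 p * nabla_form \<kappa> G \<omega> 1 1 p + X 1 p * Z 2 p * nabla_form \<kappa> G \<omega> 1 2 p
      + (X 2 p * Z 1 p * nabla_form \<kappa> G \<omega> 2 1 p + X 2 p * Z 2 p * nabla_form \<kappa> G \<omega> 2 2 p))"
  by (simp add: fun_eq_iff along_form_def sum_2)

lemma div_vec_fun: "div_vec \<kappa> G X = (\<lambda>p. nabla_vec \<kappa> G X 1 1 p + nabla_vec \<kappa> G X 2 2 p)"
  by (simp add: fun_eq_iff div_vec_def sum_2)

lemma riem_fun: "riem \<kappa> G a b c d = (\<lambda>p. pd \<kappa> a (G c b d) p - pd \<kappa> b (G c a d) p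
    + (G c a 1 p * G 1 b d p + G c a 2 p * G 2 b d p)
    - (G c b 1 p * G 1 a d p + G c b 2 p * G 2 a d p))"
  by (simp add: fun_eq_iff riem_def sum_2)

lemma ric_fun: "ric \<kappa> G a b = (\<lambda>p. riem \<kappa> G 1 a 1 b p + riem \<kappa> G 2 a 2 b p)"
  by (simp add: fun_eq_iff ric_def sum_2)

lemma Rho_fun: "Rho \<kappa> G a b = (\<lambda>p. 2/3 * ric \<kappa> G a b p + 1/3 * ric \<kappa> G b a p)"
  by (simp add: fun_eq_iff Rho_def)

lemma Rho2_fun: "Rho2 \<kappa> G X Z = (\<lambda>p. Rho \<kappa> G 1 1 p * X 1 p * Z 1 p + Rho \<kappa> G 1 2 p * X 1 p * Z 2 p
    + (Rho \<kappa> G 2 1 p * X 2 p * Z 1 p + Rho \<kappa> G 2 2 p * X 2 p * Z 2 p))"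
  by (simp add: fun_eq_iff Rho2_def sum_2)

lemma lower_fun: "lower e X b = (\<lambda>p. X 1 p * e 1 b p + X 2 p * e 2 b p)"
  by (simp add: fun_eq_iff lower_def sum_2)

lemma phi_fun: "phi \<kappa> e G = (\<lambda>p. 2 * div_vec \<kappa> G (Y \<kappa> e G) p)"
  by (simp add: fun_eq_iff phi_def)

lemma W_fun: "W \<kappa> e G a = (\<lambda>p. cov \<kappa> G (Y \<kappa> e G) (Y \<kappa> e G) a p - 2 * phi \<kappa> e G p / 3 * Y \<kappa> e G a p)"
  by (simp add: fun_eq_iff W_def cov_def)

lemma rho_fun: "rho \<kappa> e G = pairing (Yl \<kappa> e G) (W \<kappa> e G)"
  by (simp add: fun_eq_iff rho_def pairing_def)

lemma ell_fun: "ell \<kappa> e G = (\<lambda>p. 5 * (phi \<kappa> e G p)\<^sup>2 / 12 + 3 * Rho2 \<kappa> G (Y \<kappa> e G) (Y \<kappa> e G) p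
    - along \<kappa> (Y \<kappa> e G) (phi \<kappa> e G) p / 2)"
  by (simp add: fun_eq_iff ell_def)

lemma two_cases: "a = 1 \<or> a = (2::2)"
  using exhaust_2 by blast

lemma UNIV_2_distinct [simp]: "(1::2) \<noteq> 2" "(2::2) \<noteq> 1"
  by auto

text \<open>Three vectors in the plane satisfy \<open>\<epsilon>(A, B) X = \<epsilon>(X, B) A + \<epsilon>(A, X) B\<close>.\<close>

lemma expand_in_frame:
  assumes "\<And>a b. e a b p = - e b a p"
  shows "area e A B p * pairing \<omega> X p = area e X B p * pairing \<omega> A p + area e A X p * pairing \<omega> B p"
proof -
  have "e 1 1 p = 0" "e 2 2 p = 0" "e 2 1 p = - e 1 2 p"
    using assms[of 1 1] assms[of 2 2] assms[of 2 1] by auto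
  then show ?thesis by (simp add: area_fun pairing_fun algebra_simps)
qed

locale volume_chart = surface_chart \<kappa>
  for \<kappa> :: "('m::{t2_space,second_countable_topology}) chart" +
  fixes e :: "'m tens2" and G :: "'m tens3"
  assumes smooth_e: "smooth_in \<kappa> (fst \<kappa>) (e a b)"
    and smooth_G: "smooth_in \<kappa> (fst \<kappa>) (G c a b)"
    and skew: "p \<in> fst \<kappa> \<Longrightarrow> e a b p = - e b a p"
    and e_nonzero: "p \<in> fst \<kappa> \<Longrightarrow> e 1 2 p \<noteq> 0"
    and torsion_zero: "p \<in> fst \<kappa> \<Longrightarrow> G c a b p = G c b a p"
    and e_parallel: "p \<in> fst \<kappa> \<Longrightarrow> nabla_form2 \<kappa> G e a b c p = 0"
begin

abbreviation smooth where "smooth \<equiv> smooth_in \<kappa> V"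

lemmas smooth_rules = smooth_in_const smooth_in_pd[OF _ open_domain order_refl]
  smooth_in_add[OF open_domain order_refl] smooth_in_mult[OF open_domain order_refl]
  smooth_in_minus[OF open_domain order_refl] smooth_in_diff[OF open_domain order_refl]
  smooth_in_divide[OF open_domain order_refl] smooth_in_power[OF open_domain order_refl]
  smooth_in_exp[OF open_domain order_refl]
  smooth_e smooth_G

lemma smooth_differentiable: "smooth f \<Longrightarrow> p \<in> V \<Longrightarrow> differentiable_in \<kappa> f p"
  using smooth_in_differentiable[OF _ open_domain order_refl] .

lemmas pd_cong_V = pd_cong[OF open_domain order_refl]

lemmas pd_commute_V = pd_commute[OF _ open_domain order_refl]

lemma e_simps:
  assumes "p \<in> V"
  shows "e 1 1 p = 0" "e 2 2 p = 0" "e 2 1 p = - e 1 2 p"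
  using skew[OF assms, of 1 1] skew[OF assms, of 2 2] skew[OF assms, of 2 1] by auto

lemma eps_inv_simps:
  assumes p: "p \<in> V"
  shows "eps_inv e 1 1 p = 0" "eps_inv e 2 2 p = 0"
    "eps_inv e 1 2 p = 1 / e 1 2 p" "eps_inv e 2 1 p = - (1 / e 1 2 p)"
  using eps_inv(1)[of e p 1 1, OF skew[OF p] e_nonzero[OF p]]
    eps_inv(1)[of e p 1 2, OF skew[OF p] e_nonzero[OF p]]
    eps_inv(1)[of e p 2 1, OF skew[OF p] e_nonzero[OF p]]
    eps_inv(1)[of e p 2 2, OF skew[OF p] e_nonzero[OF p]] e_nonzero[OF p]
  by (auto simp: sum_2 e_simps[OF p] field_simps)

text \<open>Since \<open>\<epsilon>\<close> is parallel, the trace of the Christoffel symbols is the logarithmic derivative of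
  \<open>\<epsilon>\<^sub>1\<^sub>2\<close>.\<close>

lemma pd_e:
  assumes p: "p \<in> V"
  shows "pd \<kappa> a (e 1 1) p = 0" "pd \<kappa> a (e 2 2) p = 0"
    "pd \<kappa> a (e 1 2) p = (G 1 a 1 p + G 2 a 2 p) * e 1 2 p"
    "pd \<kappa> a (e 2 1) p = - ((G 1 a 1 p + G 2 a 2 p) * e 1 2 p)"
  using e_parallel[OF p, of a 1 1] e_parallel[OF p, of a 2 2] e_parallel[OF p, of a 1 2] e_parallel[OF p, of a 2 1]
  by (simp_all add: nabla_form2_fun e_simps[OF p] algebra_simps)

lemma G_sym: "p \<in> V \<Longrightarrow> G c 2 1 p = G c 1 2 p"
  by (rule torsion_zero)

lemma pd_G_sym: "p \<in> V \<Longrightarrow> pd \<kappa> a (G c 2 1) p = pd \<kappa> a (G c 1 2) p"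
  by (rule pd_cong_V) (auto simp: G_sym)

text \<open>The trace of the Christoffel symbols is closed, being \<open>d log \<bar>\<epsilon>\<^sub>1\<^sub>2\<bar>\<close>. The skew part of the
  Ricci tensor is, up to sign, half its exterior derivative, which is why the Ricci tensor turns
  out symmetric.\<close>

lemma trace_closed:
  assumes p: "p \<in> V"
  shows "pd \<kappa> 1 (G 1 1 2) p + pd \<kappa> 1 (G 2 2 2) p = pd \<kappa> 2 (G 1 1 1) p + pd \<kappa> 2 (G 2 1 2) p"
proof -
  have second: "pd \<kappa> b (pd \<kappa> a (e 1 2)) p = (pd \<kappa> b (G 1 a 1) p + pd \<kappa> b (G 2 a 2) p) * e 1 2 p
      + (G 1 a 1 p + G 2 a 2 p) * ((G 1 b 1 p + G 2 b 2 p) * e 1 2 p)" for a b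
  proof -
    have "pd \<kappa> b (pd \<kappa> a (e 1 2)) p = pd \<kappa> b (\<lambda>p. (G 1 a 1 p + G 2 a 2 p) * e 1 2 p) p"
      by (rule pd_cong_V) (auto simp: p pd_e)
    then show ?thesis
      by (simp add: pd_rules smooth_differentiable smooth_e smooth_G p pd_e algebra_simps)
  qed
  have "(pd \<kappa> 1 (G 1 1 2) p + pd \<kappa> 1 (G 2 2 2) p) * e 1 2 p = (pd \<kappa> 2 (G 1 1 1) p + pd \<kappa> 2 (G 2 1 2) p) * e 1 2 p"
    using pd_commute_V[OF smooth_e p, of 1 2] second[of 1 2] second[of 2 1] pd_G_sym[OF p]
    by (simp add: algebra_simps)
  then show ?thesis using e_nonzero[OF p] by simp
qed

lemma ric_sym:
  assumes p: "p \<in> V"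
  shows "ric \<kappa> G 2 1 p = ric \<kappa> G 1 2 p"
  using trace_closed[OF p]
  by (simp add: ric_fun riem_fun G_sym pd_G_sym p algebra_simps)

lemma Rho_sym: "p \<in> V \<Longrightarrow> Rho \<kappa> G 2 1 p = Rho \<kappa> G 1 2 p"
  by (simp add: Rho_fun ric_sym)

text \<open>On a surface the only curvature components are those with first indices \<open>12\<close>, and each of them
  is, up to sign, a Ricci trace. All curvature is thereby expressed through \<open>P\<close>.\<close>

lemma riem_Rho:
  assumes p: "p \<in> V"
  shows "riem \<kappa> G 1 2 1 d p = Rho \<kappa> G 2 d p" "riem \<kappa> G 1 2 2 d p = - Rho \<kappa> G 1 d p"
proof -
  have r: "ric \<kappa> G 2 d p = riem \<kappa> G 1 2 1 d p" "ric \<kappa> G 1 d p = - riem \<kappa> G 1 2 2 d p" for d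
    by (simp_all add: ric_fun riem_fun)
  have R: "Rho \<kappa> G a b p = ric \<kappa> G a b p" for a b
    using two_cases[of a] two_cases[of b] ric_sym[OF p] by (auto simp: Rho_fun)
  show "riem \<kappa> G 1 2 1 d p = Rho \<kappa> G 2 d p" "riem \<kappa> G 1 2 2 d p = - Rho \<kappa> G 1 d p"
    by (simp_all add: R r)
qed

text \<open>The curvature formula solved for one derivative of the Christoffel symbols. Substituting it into
  a commutator of second derivatives leaves only tensorial terms.\<close>

lemma pd_G_riem:
  assumes p: "p \<in> V"
  shows "pd \<kappa> 1 (G 1 2 d) p = pd \<kappa> 2 (G 1 1 d) p + Rho \<kappa> G 2 d p
      - (G 1 1 1 p * G 1 2 d p + G 1 1 2 p * G 2 2 d p) + (G 1 2 1 p * G 1 1 d p + G 1 2 2 p * G 2 1 d p)"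
    and "pd \<kappa> 1 (G 2 2 d) p = pd \<kappa> 2 (G 2 1 d) p - Rho \<kappa> G 1 d p
      - (G 2 1 1 p * G 1 2 d p + G 2 1 2 p * G 2 2 d p) + (G 2 2 1 p * G 1 1 d p + G 2 2 2 p * G 2 1 d p)"
  using riem_Rho[OF p, of d] by (simp_all add: riem_fun)

lemma smooth_nabla_vec: "(\<And>c. smooth (X c)) \<Longrightarrow> smooth (nabla_vec \<kappa> G X a c)"
  by (simp add: nabla_vec_fun smooth_rules)

lemma smooth_nabla_form: "(\<And>c. smooth (X c)) \<Longrightarrow> smooth (nabla_form \<kappa> G X a c)"
  by (simp add: nabla_form_fun smooth_rules)

lemma smooth_cov: "(\<And>c. smooth (X c)) \<Longrightarrow> (\<And>c. smooth (Z c)) \<Longrightarrow> smooth (cov \<kappa> G X Z c)"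
  by (simp add: cov_fun smooth_rules smooth_nabla_vec)

lemma smooth_div_vec: "(\<And>c. smooth (X c)) \<Longrightarrow> smooth (div_vec \<kappa> G X)"
  by (simp add: div_vec_fun smooth_rules smooth_nabla_vec)

lemma smooth_along: "(\<And>c. smooth (X c)) \<Longrightarrow> smooth f \<Longrightarrow> smooth (along \<kappa> X f)"
  by (simp add: along_fun smooth_rules)

lemma smooth_along_form:
  "(\<And>c. smooth (X c)) \<Longrightarrow> (\<And>c. smooth (Z c)) \<Longrightarrow> (\<And>c. smooth (\<omega> c)) \<Longrightarrow> smooth (along_form \<kappa> G X Z \<omega>)"
  by (simp add: along_form_fun smooth_rules smooth_nabla_form)

lemma smooth_Rho: "smooth (Rho \<kappa> G a b)"
  by (simp add: Rho_fun ric_fun riem_fun smooth_rules)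

lemma smooth_Rho2: "(\<And>c. smooth (X c)) \<Longrightarrow> (\<And>c. smooth (Z c)) \<Longrightarrow> smooth (Rho2 \<kappa> G X Z)"
  by (simp add: Rho2_fun smooth_rules smooth_Rho)

lemma smooth_lower: "(\<And>c. smooth (X c)) \<Longrightarrow> smooth (lower e X a)"
  by (simp add: lower_fun smooth_rules)

lemma smooth_pairing: "(\<And>c. smooth (\<omega> c)) \<Longrightarrow> (\<And>c. smooth (X c)) \<Longrightarrow> smooth (pairing \<omega> X)"
  by (simp add: pairing_fun smooth_rules)

lemma along_pairing:
  assumes "\<And>c. smooth (\<omega> c)" "\<And>c. smooth (Z c)" "p \<in> V"
  shows "along \<kappa> X (pairing \<omega> Z) p = along_form \<kappa> G X Z \<omega> p + pairing \<omega> (cov \<kappa> G X Z) p"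
  by (simp add: along_fun pairing_fun pd_rules smooth_differentiable assms along_form_fun cov_fun
      nabla_vec_fun nabla_form_fun algebra_simps)

text \<open>Lowering an index commutes with \<open>\<nabla>\<close> because \<open>\<epsilon>\<close> is parallel.\<close>

lemma along_form_lower:
  assumes "\<And>c. smooth (Z c)" "p \<in> V"
  shows "along_form \<kappa> G X U (lower e Z) p = area e (cov \<kappa> G X Z) U p"
  by (simp add: along_form_fun lower_fun nabla_form_fun pd_rules smooth_differentiable assms smooth_e
      pd_e e_simps area_fun cov_fun nabla_vec_fun G_sym algebra_simps)

lemma pairing_lower: "pairing (lower e Z) U p = area e Z U p"
  by (simp add: pairing_fun lower_fun area_fun algebra_simps)

lemma along_area:
  assumes "\<And>c. smooth (Z c)" "\<And>c. smooth (U c)" "p \<in> V"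
  shows "along \<kappa> X (area e Z U) p = area e (cov \<kappa> G X Z) U p + area e Z (cov \<kappa> G X U) p"
proof -
  have eq: "area e Z U = pairing (lower e Z) U"
    by (simp add: fun_eq_iff pairing_lower)
  show ?thesis
    unfolding eq using assms
    by (simp add: along_pairing smooth_lower along_form_lower pairing_lower)
qed

text \<open>The trace of the endomorphism \<open>A \<mapsto> \<nabla>\<^sub>A X\<close> is the rate at which it changes areas.\<close>

lemma div_vec_area:
  assumes "p \<in> V"
  shows "div_vec \<kappa> G X p * area e A B p = area e (cov \<kappa> G A X) B p + area e A (cov \<kappa> G B X) p"
  by (simp add: div_vec_fun area_fun cov_fun e_simps[OF assms] algebra_simps)

lemma area_skew: "p \<in> V \<Longrightarrow> area e X Z p = - area e Z X p"
  by (simp add: area_fun e_simps algebra_simps)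

lemma area_self: "p \<in> V \<Longrightarrow> area e X X p = 0"
  by (simp add: area_fun e_simps)

section \<open>The Cotton-York tensor and the vector fields built from it\<close>

lemma Yl_eq:
  assumes p: "p \<in> V"
  shows "Yl \<kappa> e G a p = 2 * cotton_york \<kappa> G 1 2 a p / e 1 2 p"
  by (simp add: Yl_def sum_2 eps_inv_simps[OF p] cotton_york_def field_simps e_nonzero[OF p])

lemma Y_eq:
  assumes p: "p \<in> V"
  shows "Y \<kappa> e G 1 p = Yl \<kappa> e G 2 p / e 1 2 p" "Y \<kappa> e G 2 p = - (Yl \<kappa> e G 1 p / e 1 2 p)"
  by (simp_all add: Y_def raise_def sum_2 eps_inv_simps[OF p] field_simps e_nonzero[OF p])

lemma smooth_Yl: "smooth (Yl \<kappa> e G a)"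
proof -
  have "smooth (\<lambda>p. 2 * cotton_york \<kappa> G 1 2 a p / e 1 2 p)"
    unfolding cotton_york_def nabla_form2_fun
    by (simp add: smooth_rules smooth_Rho e_nonzero)
  then show ?thesis
    by (rule smooth_in_cong[OF open_domain order_refl, THEN iffD1, rotated]) (rule Yl_eq[symmetric])
qed

lemma smooth_Y: "smooth (Y \<kappa> e G a)"
proof -
  have "smooth (\<lambda>p. Yl \<kappa> e G 2 p / e 1 2 p)" "smooth (\<lambda>p. - (Yl \<kappa> e G 1 p / e 1 2 p))"
    by (simp_all add: smooth_rules smooth_Yl e_nonzero)
  then have "smooth (Y \<kappa> e G 1)" "smooth (Y \<kappa> e G 2)"
    by (simp_all only: smooth_in_cong[OF open_domain order_refl Y_eq(1)]
        smooth_in_cong[OF open_domain order_refl Y_eq(2)])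
  then show ?thesis using two_cases[of a] by auto
qed

lemma smooth_phi: "smooth (phi \<kappa> e G)"
  by (simp add: phi_fun smooth_rules smooth_div_vec smooth_Y)

lemma smooth_W: "smooth (W \<kappa> e G a)"
  by (simp add: W_fun smooth_rules smooth_cov smooth_phi smooth_Y)

lemma smooth_Wl: "smooth (Wl \<kappa> e G a)"
  by (simp add: Wl_def smooth_lower smooth_W)

lemma smooth_rho: "smooth (rho \<kappa> e G)"
  by (simp add: rho_fun smooth_pairing smooth_Yl smooth_W)

lemma smooth_ell: "smooth (ell \<kappa> e G)"
  by (simp add: ell_fun smooth_rules smooth_Rho2 smooth_along smooth_Y smooth_phi)

lemma lower_Y: "p \<in> V \<Longrightarrow> lower e (Y \<kappa> e G) a p = Yl \<kappa> e G a p"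
  using two_cases[of a] by (auto simp: lower_fun Y_eq e_simps e_nonzero)

lemma pairing_Yl: "p \<in> V \<Longrightarrow> pairing (Yl \<kappa> e G) X p = area e (Y \<kappa> e G) X p"
  by (simp flip: pairing_lower add: pairing_fun lower_Y)

lemma rho_area: "p \<in> V \<Longrightarrow> rho \<kappa> e G p = area e (Y \<kappa> e G) (W \<kappa> e G) p"
  by (simp add: rho_fun pairing_Yl)

lemma along_form_Yl:
  assumes "p \<in> V"
  shows "along_form \<kappa> G X U (Yl \<kappa> e G) p = area e (cov \<kappa> G X (Y \<kappa> e G)) U p"
proof -
  have "pd \<kappa> a (Yl \<kappa> e G b) p = pd \<kappa> a (lower e (Y \<kappa> e G) b) p" for a b
    by (rule pd_cong_V) (auto simp: assms lower_Y)
  then have "along_form \<kappa> G X U (Yl \<kappa> e G) p = along_form \<kappa> G X U (lower e (Y \<kappa> e G)) p"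
    by (simp add: along_form_fun nabla_form_fun lower_Y assms)
  then show ?thesis
    using along_form_lower smooth_Y assms by simp
qed

lemma along_form_Wl:
  assumes "p \<in> V"
  shows "along_form \<kappa> G X U (Wl \<kappa> e G) p = area e (cov \<kappa> G X (W \<kappa> e G)) U p"
  unfolding Wl_def using along_form_lower smooth_W assms by simp

text \<open>The definition of \<open>W\<close>, read as a formula for \<open>\<nabla>\<^sub>Y Y\<close>.\<close>

lemma pairing_cov_Y_Y:
  "pairing \<omega> (cov \<kappa> G (Y \<kappa> e G) (Y \<kappa> e G)) p =
     pairing \<omega> (W \<kappa> e G) p + 2 * phi \<kappa> e G p / 3 * pairing \<omega> (Y \<kappa> e G) p"
  by (simp add: pairing_fun W_fun algebra_simps)

text \<open>Where \<open>\<rho> = \<epsilon>(Y, W)\<close> does not vanish, \<open>Y\<close> and \<open>W\<close> form a frame, in which \<open>\<nabla>\<^sub>X Z\<close> has the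
  components \<open>frame_coeff X Z W\<close> and \<open>- frame_coeff X Z Y\<close>. All quotients by \<open>\<rho>\<close> in the
  coefficients of the polynomials are of this form or are logarithmic derivatives of \<open>\<rho>\<close>.\<close>

definition frame_coeff where "frame_coeff X Z B p = area e (cov \<kappa> G X Z) B p / rho \<kappa> e G p"

definition dlog_rho where "dlog_rho X p = along \<kappa> X (rho \<kappa> e G) p / rho \<kappa> e G p"

context
  fixes p assumes p: "p \<in> V"
begin

lemma a_frame:
  "a1 \<kappa> e G p = 15 * (dlog_rho (Y \<kappa> e G) p - 5 * phi \<kappa> e G p / 2)"
  "a2 \<kappa> e G p = - (3 * dlog_rho (W \<kappa> e G) p + 6 * ell \<kappa> e G p - 3 * div_vec \<kappa> G (W \<kappa> e G) p)"
  "a3 \<kappa> e G p = along \<kappa> (W \<kappa> e G) (phi \<kappa> e G) p / 2 + phi \<kappa> e G p * div_vec \<kappa> G (W \<kappa> e G) p / 2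
     + along \<kappa> (Y \<kappa> e G) (ell \<kappa> e G) p + phi \<kappa> e G p * ell \<kappa> e G p / 2
     - phi \<kappa> e G p * dlog_rho (W \<kappa> e G) p / 2 - ell \<kappa> e G p * dlog_rho (Y \<kappa> e G) p"
  by (simp_all add: a1_def a2_def a3_def dlog_rho_def mult.commute)

lemma b_frame:
  "b1 \<kappa> e G p = - 5 * frame_coeff (W \<kappa> e G) (W \<kappa> e G) (Y \<kappa> e G) p + 50 * ell \<kappa> e G p / 3"
  "b2 \<kappa> e G p = frame_coeff (W \<kappa> e G) (W \<kappa> e G) (W \<kappa> e G) p"
  "b3 \<kappa> e G p = phi \<kappa> e G p * frame_coeff (W \<kappa> e G) (W \<kappa> e G) (W \<kappa> e G) p / 6
     + Rho2 \<kappa> G (W \<kappa> e G) (W \<kappa> e G) p + (ell \<kappa> e G p)\<^sup>2 / 9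
     + ell \<kappa> e G p * frame_coeff (W \<kappa> e G) (W \<kappa> e G) (Y \<kappa> e G) p / 3
     + along \<kappa> (W \<kappa> e G) (ell \<kappa> e G) p / 3"
  by (simp_all add: b1_def b2_def b3_def frame_coeff_def along_form_Wl[OF p] mult.commute)

lemma c_frame:
  "c1 \<kappa> e G p = - 5 * (frame_coeff (W \<kappa> e G) (Y \<kappa> e G) (Y \<kappa> e G) p
     + frame_coeff (Y \<kappa> e G) (W \<kappa> e G) (Y \<kappa> e G) p) / 2 - 25 * phi \<kappa> e G p / 6"
  "c2 \<kappa> e G p = 2 * ell \<kappa> e G p / 3 + (frame_coeff (W \<kappa> e G) (Y \<kappa> e G) (W \<kappa> e G) p
     + frame_coeff (Y \<kappa> e G) (W \<kappa> e G) (W \<kappa> e G) p) / 2"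
  "c3 \<kappa> e G p = - (along \<kappa> (W \<kappa> e G) (phi \<kappa> e G) p / 12)
     + phi \<kappa> e G p * frame_coeff (W \<kappa> e G) (Y \<kappa> e G) (W \<kappa> e G) p / 12
     + ell \<kappa> e G p * frame_coeff (W \<kappa> e G) (Y \<kappa> e G) (Y \<kappa> e G) p / 6
     + Rho2 \<kappa> G (W \<kappa> e G) (Y \<kappa> e G) p + along \<kappa> (Y \<kappa> e G) (ell \<kappa> e G) p / 6
     + phi \<kappa> e G p * frame_coeff (Y \<kappa> e G) (W \<kappa> e G) (W \<kappa> e G) p / 12
     - ell \<kappa> e G p * phi \<kappa> e G p / 18
     + ell \<kappa> e G p * frame_coeff (Y \<kappa> e G) (W \<kappa> e G) (Y \<kappa> e G) p / 6"
  by (simp_all add: c1_def c2_def c3_def frame_coeff_def along_form_Wl[OF p] along_form_Yl[OF p]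
      mult.commute add_divide_distrib)

lemma along_rho: "along \<kappa> X (rho \<kappa> e G) p =
    area e (cov \<kappa> G X (Y \<kappa> e G)) (W \<kappa> e G) p + area e (Y \<kappa> e G) (cov \<kappa> G X (W \<kappa> e G)) p"
proof -
  have "along \<kappa> X (rho \<kappa> e G) p = along \<kappa> X (area e (Y \<kappa> e G) (W \<kappa> e G)) p"
    using pd_cong_V[OF p rho_area] by (simp add: along_fun)
  then show ?thesis
    using along_area[OF smooth_Y smooth_W p] by simp
qed

text \<open>Both formulas compare the derivative of \<open>\<rho> = \<epsilon>(Y, W)\<close> along \<open>Y\<close> or \<open>W\<close> with the divergence of
  the same field, computed from its effect on the area \<open>\<epsilon>(Y, W)\<close>. They express the components of
  the bracket \<open>[Y, W] = \<nabla>\<^sub>Y W - \<nabla>\<^sub>W Y\<close> by divergences and derivatives of \<open>\<rho>\<close>.\<close>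

lemma bracket_frame:
  assumes "rho \<kappa> e G p \<noteq> 0"
  shows "frame_coeff (W \<kappa> e G) (Y \<kappa> e G) (Y \<kappa> e G) p - frame_coeff (Y \<kappa> e G) (W \<kappa> e G) (Y \<kappa> e G) p
      = dlog_rho (Y \<kappa> e G) p - phi \<kappa> e G p / 2"
    and "frame_coeff (Y \<kappa> e G) (W \<kappa> e G) (W \<kappa> e G) p - frame_coeff (W \<kappa> e G) (Y \<kappa> e G) (W \<kappa> e G) p
      = div_vec \<kappa> G (W \<kappa> e G) p - dlog_rho (W \<kappa> e G) p"
  using div_vec_area[OF p, of "Y \<kappa> e G" "Y \<kappa> e G" "W \<kappa> e G"]
    div_vec_area[OF p, of "W \<kappa> e G" "Y \<kappa> e G" "W \<kappa> e G"] assms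
  by (simp_all add: frame_coeff_def dlog_rho_def along_rho phi_fun area_skew[OF p, of _ "Y \<kappa> e G"]
      flip: rho_area[OF p]) (simp_all add: field_simps area_skew[OF p, of "Y \<kappa> e G" "cov _ _ _ _"])

end

end

section \<open>Solutions of the pEW equation\<close>

lemma divide_by: "x / r = x * inverse r" for x r :: real
  by (rule divide_inverse)

lemma divide_by_product: "x / (k * r) = x * inverse r / k" for x k r :: real
  by (simp add: divide_inverse)

text \<open>In the following three lemmas \<open>t\<close>, \<open>s\<close>, \<open>w\<close> and \<open>r\<close> stand for \<open>F\<close>, \<open>\<alpha>(Y)\<close>, \<open>\<alpha>(W)\<close> and \<open>\<rho>\<close>. The
  hypotheses \<open>WY\<close>, \<open>YW\<close> and \<open>WW\<close> are the derivative of \<open>\<alpha>(Y)\<close> along \<open>W\<close>, of \<open>\<alpha>(W)\<close> along \<open>Y\<close> and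
  of \<open>\<alpha>(W)\<close> along \<open>W\<close>; the pairs \<open>x1, x2\<close> and \<open>y1, y2\<close>, divided by \<open>r\<close>, are the components of the
  covariant derivatives in the frame \<open>(Y, W)\<close>. Read as left side minus right side, minus half the
  sum of \<open>WY\<close> and \<open>YW\<close> is the third polynomial.\<close>

lemma P3_combination:
  fixes t s w \<phi> l r :: real
  assumes s: "s = - t\<^sup>2 - \<phi> / 6" and w: "w = - 5 * t ^ 4 + l / 3"
    and WY: "(x1 * s + x2 * w) / r - w * s - PWY - t / 2 * r = - 2 * t * (- 3 * t * w - r) - Wphi / 6"
    and YW: "(y1 * s + y2 * w) / r - s * w - PWY + t / 2 * r = - 20 * t ^ 3 * (- 3 * t * s) + Yell / 3"
  shows "- 40 * t ^ 6 + (- (5 * (- x2 + - y2) / (2 * r)) - 25 * \<phi> / 6) * t ^ 4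
     + (2 * l / 3 + (x1 + y1) / (2 * r)) * t\<^sup>2 + r * t
     + (- (Wphi / 12) + \<phi> * x1 / (12 * r) + l * (- x2) / (6 * r) + PWY + Yell / 6 + \<phi> * y1 / (12 * r)
        - l * \<phi> / 18 + l * (- y2) / (6 * r)) = 0"
proof -
  have "w * s + PWY - (x1 * s + x2 * w) / r / 2 - (y1 * s + y2 * w) / r / 2
      + 30 * t ^ 4 * s + Yell / 6 + 3 * t\<^sup>2 * w + t * r - Wphi / 12 = 0"
    using WY YW by (simp add: algebra_simps add_divide_distrib diff_divide_distrib numeral_eq_Suc)
  then show ?thesis unfolding s w divide_by_product[of _ _ r] divide_by[of _ r]
    by (simp add: algebra_simps add_divide_distrib diff_divide_distrib numeral_eq_Suc)
qed

text \<open>In the difference \<open>WY\<close> minus \<open>YW\<close> the terms \<open>s w\<close> and \<open>P(Y, W)\<close> cancel, and the two covariant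
  derivatives combine to the bracket \<open>[Y, W]\<close>, whose components are given by \<open>Yr\<close> and \<open>dW\<close>. Three
  times this difference is the first polynomial.\<close>

lemma P1_combination:
  fixes t s w \<phi> l r :: real
  assumes s: "s = - t\<^sup>2 - \<phi> / 6" and w: "w = - 5 * t ^ 4 + l / 3"
    and WY: "(x1 * s + x2 * w) / r - w * s - PWY - t / 2 * r = - 2 * t * (- 3 * t * w - r) - Wphi / 6"
    and YW: "(y1 * s + y2 * w) / r - s * w - PWY + t / 2 * r = - 20 * t ^ 3 * (- 3 * t * s) + Yell / 3"
    and Yr: "y2 / r - x2 / r = Yr / r - \<phi> / 2" and dW: "y1 / r - x1 / r = dW - Wr / r"
  shows "- 90 * t ^ 6 + 15 * (Yr / r - 5 * \<phi> / 2) * t ^ 4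
     + - (3 * Wr / r + 6 * l - 3 * dW) * t\<^sup>2 + - 9 * r * t
     + (Wphi / 2 + \<phi> / 2 * dW + Yell + \<phi> * l / 2 - \<phi> * Wr / (2 * r) - l * (Yr / r)) = 0"
proof -
  have "60 * t ^ 4 * s - 6 * t\<^sup>2 * w - 3 * t * r + Yell / 3 + Wphi / 6
      - ((y1 * s + y2 * w) / r - (x1 * s + x2 * w) / r) = 0"
    using WY YW by (simp add: algebra_simps add_divide_distrib diff_divide_distrib numeral_eq_Suc)
  moreover have "(y1 * s + y2 * w) / r - (x1 * s + x2 * w) / r
      = (y1 / r - x1 / r) * s + (y2 / r - x2 / r) * w"
    unfolding divide_by[of _ r] by (simp add: algebra_simps)
  ultimately have "60 * t ^ 4 * s - 6 * t\<^sup>2 * w - 3 * t * r + Yell / 3 + Wphi / 6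
      - ((dW - Wr / r) * s + (Yr / r - \<phi> / 2) * w) = 0"
    unfolding Yr dW by simp
  then show ?thesis unfolding s w divide_by_product[of _ _ r] divide_by[of _ r]
    by (simp add: algebra_simps add_divide_distrib diff_divide_distrib numeral_eq_Suc)
qed

lemma P2_combination:
  fixes t s w \<phi> l r :: real
  assumes s: "s = - t\<^sup>2 - \<phi> / 6" and w: "w = - 5 * t ^ 4 + l / 3"
    and WW: "(x1 * s + x2 * w) / r - w * w - PWW = - 20 * t ^ 3 * (- 3 * t * w - r) + Well / 3"
  shows "- 275 * t ^ 8 + (- (5 * (- x2) / r) + 50 * l / 3) * t ^ 4 + 20 * r * t ^ 3 + x1 / r * t\<^sup>2
     + (\<phi> * x1 / (6 * r) + PWW + l\<^sup>2 / 9 + l * (- x2) / (3 * r) + Well / 3) = 0"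
proof -
  have "w * w + PWW - (x1 * s + x2 * w) / r + 60 * t ^ 4 * w + 20 * r * t ^ 3 + Well / 3 = 0"
    using WW by (simp add: algebra_simps add_divide_distrib diff_divide_distrib numeral_eq_Suc)
  then show ?thesis unfolding s w divide_by_product[of _ _ r] divide_by[of _ r]
    by (simp add: algebra_simps add_divide_distrib diff_divide_distrib numeral_eq_Suc)
qed
locale pew_chart = volume_chart \<kappa> e G
  for \<kappa> :: "('m::{t2_space,second_countable_topology}) chart" and e G +
  fixes \<alpha> :: "'m tens1"
  assumes smooth_\<alpha>: "smooth_in \<kappa> (fst \<kappa>) (\<alpha> a)"
    and pEW_eq: "p \<in> fst \<kappa> \<Longrightarrow> (nabla_form \<kappa> G \<alpha> a b p + nabla_form \<kappa> G \<alpha> b a p) / 2 + \<alpha> a p * \<alpha> b p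
        + (Rho \<kappa> G a b p + Rho \<kappa> G b a p) / 2 = 0"
begin

abbreviation "f \<equiv> F \<kappa> e G \<alpha>"
abbreviation "P \<equiv> Rho \<kappa> G"

lemma F_eq: "p \<in> V \<Longrightarrow> f p = (nabla_form \<kappa> G \<alpha> 1 2 p - nabla_form \<kappa> G \<alpha> 2 1 p) / e 1 2 p"
  by (simp add: F_def sum_2 eps_inv_simps diff_divide_distrib)

lemma smooth_F: "smooth f"
proof -
  have "smooth (\<lambda>p. (nabla_form \<kappa> G \<alpha> 1 2 p - nabla_form \<kappa> G \<alpha> 2 1 p) / e 1 2 p)"
    by (simp add: smooth_rules smooth_nabla_form smooth_\<alpha> e_nonzero)
  then show ?thesis
    by (simp only: smooth_in_cong[OF open_domain order_refl F_eq])
qed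

text \<open>The pEW equation prescribes the symmetric part of \<open>\<nabla>\<alpha>\<close> and \<open>F\<close> is its skew part.\<close>

lemma nabla_\<alpha>:
  assumes p: "p \<in> V"
  shows "nabla_form \<kappa> G \<alpha> a b p = - (\<alpha> a p * \<alpha> b p) - P a b p + f p / 2 * e a b p"
proof -
  have "f p / 2 * e 1 2 p = (nabla_form \<kappa> G \<alpha> 1 2 p - nabla_form \<kappa> G \<alpha> 2 1 p) / 2"
    using e_nonzero[OF p] by (simp add: F_eq p)
  then show ?thesis
    using pEW_eq[OF p, of a b] Rho_sym[OF p] two_cases[of a] two_cases[of b]
    by (auto simp: p e_simps field_simps)
qed

lemma pd_\<alpha>:
  assumes p: "p \<in> V"
  shows "pd \<kappa> a (\<alpha> b) p = (G 1 a b p * \<alpha> 1 p + G 2 a b p * \<alpha> 2 p) - \<alpha> a p * \<alpha> b p - P a b p + f p / 2 * e a b p"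
  using nabla_\<alpha>[OF p, of a b] by (simp add: nabla_form_fun)

lemma pd_pd_\<alpha>:
  assumes p: "p \<in> V"
  shows "pd \<kappa> c (pd \<kappa> a (\<alpha> b)) p = (G 1 a b p * pd \<kappa> c (\<alpha> 1) p + pd \<kappa> c (G 1 a b) p * \<alpha> 1 p
      + (G 2 a b p * pd \<kappa> c (\<alpha> 2) p + pd \<kappa> c (G 2 a b) p * \<alpha> 2 p))
    - (\<alpha> a p * pd \<kappa> c (\<alpha> b) p + pd \<kappa> c (\<alpha> a) p * \<alpha> b p) - pd \<kappa> c (P a b) p
    + (f p / 2 * pd \<kappa> c (e a b) p + pd \<kappa> c f p / 2 * e a b p)"
proof -
  have "pd \<kappa> c (pd \<kappa> a (\<alpha> b)) p = pd \<kappa> c (\<lambda>p. (G 1 a b p * \<alpha> 1 p + G 2 a b p * \<alpha> 2 p)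
      - \<alpha> a p * \<alpha> b p - P a b p + f p / 2 * e a b p) p"
    by (rule pd_cong_V) (auto simp: p pd_\<alpha>)
  then show ?thesis
    by (simp add: pd_rules smooth_differentiable smooth_\<alpha> smooth_F smooth_G smooth_e smooth_Rho p)
qed

text \<open>Differentiating the pEW system once more and commuting the derivatives of \<open>\<alpha>\<close> gives
  \<open>dF = - 3 F \<alpha> - Y\<close>: the first term comes from the skew part \<open>F/2 \<epsilon>\<close> of \<open>\<nabla>\<alpha>\<close> in the derivative of
  \<open>\<alpha>\<^sub>a \<alpha>\<^sub>b\<close>, the second is the Cotton-York tensor produced by \<open>\<nabla>P\<close>, and the curvature acting on
  \<open>\<alpha>\<close> cancels against \<open>\<alpha> P\<close>.\<close>

lemma pd_F:
  assumes p: "p \<in> V"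
  shows "pd \<kappa> c f p = - 3 * f p * \<alpha> c p - Yl \<kappa> e G c p"
proof -
  have comm: "pd \<kappa> 1 (pd \<kappa> 2 (\<alpha> c)) p = pd \<kappa> 2 (pd \<kappa> 1 (\<alpha> c)) p"
    by (rule pd_commute_V[OF smooth_\<alpha> p])
  note riem = pd_G_riem[OF p]
  have Yl: "Yl \<kappa> e G c p * e 1 2 p = 2 * cotton_york \<kappa> G 1 2 c p"
    using e_nonzero[OF p] by (simp add: Yl_eq p)
  have "(pd \<kappa> c f p + 3 * f p * \<alpha> c p + Yl \<kappa> e G c p) * e 1 2 p = 0"
    using comm two_cases[of c]
    unfolding pd_pd_\<alpha>[OF p] pd_\<alpha>[OF p] riem distrib_right Yl cotton_york_def nabla_form2_fun
    by (auto simp: pd_e e_simps G_sym Rho_sym pd_G_sym p field_simps)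
  then show ?thesis
    using e_nonzero[OF p] by simp
qed

lemma pd_Yl:
  assumes p: "p \<in> V"
  shows "pd \<kappa> 1 (Yl \<kappa> e G 2) p - pd \<kappa> 2 (Yl \<kappa> e G 1) p = phi \<kappa> e G p / 2 * e 1 2 p"
proof -
  have "pd \<kappa> a (Yl \<kappa> e G b) p = pd \<kappa> a (lower e (Y \<kappa> e G) b) p" for a b
    by (rule pd_cong_V) (auto simp: p lower_Y)
  then show ?thesis
    by (simp add: lower_fun pd_rules smooth_differentiable smooth_Y smooth_e p pd_e e_simps phi_fun
        div_vec_fun nabla_vec_fun G_sym algebra_simps)
qed

text \<open>The exterior derivative of \<open>dF = - 3 F \<alpha> - Y\<close> vanishes. Since \<open>d\<alpha> = F \<epsilon>\<close> and \<open>dY\<close> is \<open>\<phi>/2\<close> times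
  \<open>\<epsilon>\<close>, it is algebraic in \<open>\<alpha>\<close> and determines \<open>\<alpha>(Y)\<close>.\<close>

lemma \<alpha>_Y:
  assumes p: "p \<in> V"
  shows "pairing \<alpha> (Y \<kappa> e G) p = - (f p)\<^sup>2 - phi \<kappa> e G p / 6"
proof -
  have second: "pd \<kappa> a (pd \<kappa> c f) p = - 3 * (f p * pd \<kappa> a (\<alpha> c) p + pd \<kappa> a f p * \<alpha> c p) - pd \<kappa> a (Yl \<kappa> e G c) p" for a c
  proof -
    have "pd \<kappa> a (pd \<kappa> c f) p = pd \<kappa> a (\<lambda>p. - 3 * f p * \<alpha> c p - Yl \<kappa> e G c p) p"
      by (rule pd_cong_V) (auto simp: p pd_F)
    then show ?thesis
      by (simp add: pd_rules smooth_differentiable smooth_\<alpha> smooth_F smooth_Yl p algebra_simps)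
  qed
  have Yl: "Yl \<kappa> e G 1 p = - (Y \<kappa> e G 2 p * e 1 2 p)" "Yl \<kappa> e G 2 p = Y \<kappa> e G 1 p * e 1 2 p"
    by (simp_all flip: lower_Y[OF p] add: lower_fun e_simps p)
  have "(pairing \<alpha> (Y \<kappa> e G) p + (f p)\<^sup>2 + phi \<kappa> e G p / 6) * e 1 2 p = 0"
    using pd_commute_V[OF smooth_F p, of 1 2] pd_Yl[OF p]
    unfolding second pd_\<alpha>[OF p] pd_F[OF p]
    by (simp add: pairing_fun Yl e_simps G_sym Rho_sym p power2_eq_square field_simps)
  then have "pairing \<alpha> (Y \<kappa> e G) p + (f p)\<^sup>2 + phi \<kappa> e G p / 6 = 0"
    using e_nonzero[OF p] by simp
  then show ?thesis by linarith
qed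

lemma along_form_\<alpha>:
  assumes p: "p \<in> V"
  shows "along_form \<kappa> G X Z \<alpha> p = - (pairing \<alpha> X p * pairing \<alpha> Z p) - Rho2 \<kappa> G X Z p + f p / 2 * area e X Z p"
  by (simp add: along_form_fun nabla_\<alpha>[OF p] pairing_fun Rho2_fun area_fun algebra_simps)

lemma along_F:
  assumes p: "p \<in> V"
  shows "along \<kappa> X f p = - 3 * f p * pairing \<alpha> X p - area e (Y \<kappa> e G) X p"
  by (simp add: pairing_Yl[OF p, symmetric] along_fun pairing_fun pd_F[OF p] algebra_simps)

lemma along_cong_V: "p \<in> V \<Longrightarrow> (\<And>q. q \<in> V \<Longrightarrow> h q = k q) \<Longrightarrow> along \<kappa> X h p = along \<kappa> X k p"
  by (simp add: along_fun pd_cong_V[of p h k])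

lemma along_\<alpha>_Y:
  assumes p: "p \<in> V"
  shows "pairing \<alpha> (cov \<kappa> G X (Y \<kappa> e G)) p - pairing \<alpha> X p * pairing \<alpha> (Y \<kappa> e G) p
      - Rho2 \<kappa> G X (Y \<kappa> e G) p + f p / 2 * area e X (Y \<kappa> e G) p
    = - 2 * f p * along \<kappa> X f p - along \<kappa> X (phi \<kappa> e G) p / 6"
proof -
  have "along \<kappa> X (pairing \<alpha> (Y \<kappa> e G)) p = along \<kappa> X (\<lambda>q. - (f q)\<^sup>2 - phi \<kappa> e G q / 6) p"
    by (rule along_cong_V[OF p \<alpha>_Y])
  also have "\<dots> = - 2 * f p * along \<kappa> X f p - along \<kappa> X (phi \<kappa> e G) p / 6"
    by (simp add: along_fun pd_rules smooth_differentiable smooth_F smooth_phi p field_simps)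
  finally show ?thesis
    by (simp add: along_pairing smooth_\<alpha> smooth_Y p along_form_\<alpha>)
qed

text \<open>The derivative of the preceding formula along \<open>Y\<close>. The definitions of \<open>W\<close> and \<open>ell\<close> collect
  precisely the terms that occur here; \<open>\<epsilon>(Y, Y) = 0\<close> removes \<open>Y\<close> from the derivative of \<open>F\<close>.\<close>

lemma \<alpha>_W:
  assumes p: "p \<in> V"
  shows "pairing \<alpha> (W \<kappa> e G) p = - 5 * (f p)^4 + ell \<kappa> e G p / 3"
proof -
  let ?s = "pairing \<alpha> (Y \<kappa> e G) p"
  have "pairing \<alpha> (W \<kappa> e G) p = ?s * ?s + Rho2 \<kappa> G (Y \<kappa> e G) (Y \<kappa> e G) p + 6 * (f p)\<^sup>2 * ?s
      - along \<kappa> (Y \<kappa> e G) (phi \<kappa> e G) p / 6 - 2 * phi \<kappa> e G p / 3 * ?s"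
    using along_\<alpha>_Y[OF p, of "Y \<kappa> e G"]
    by (simp add: pairing_cov_Y_Y along_F[OF p] area_self[OF p] power2_eq_square algebra_simps)
  then show ?thesis
    unfolding \<alpha>_Y[OF p] ell_fun
    by (simp add: power2_eq_square power4_eq_xxxx algebra_simps)
qed

lemma along_\<alpha>_W:
  assumes p: "p \<in> V"
  shows "pairing \<alpha> (cov \<kappa> G X (W \<kappa> e G)) p - pairing \<alpha> X p * pairing \<alpha> (W \<kappa> e G) p
      - Rho2 \<kappa> G X (W \<kappa> e G) p + f p / 2 * area e X (W \<kappa> e G) p
    = - 20 * (f p)^3 * along \<kappa> X f p + along \<kappa> X (ell \<kappa> e G) p / 3"
proof -
  have "along \<kappa> X (pairing \<alpha> (W \<kappa> e G)) p = along \<kappa> X (\<lambda>q. - 5 * (f q)^4 + ell \<kappa> e G q / 3) p"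
    by (rule along_cong_V[OF p \<alpha>_W])
  also have "\<dots> = - 20 * (f p)^3 * along \<kappa> X f p + along \<kappa> X (ell \<kappa> e G) p / 3"
    by (simp add: along_fun pd_rules smooth_differentiable smooth_F smooth_ell p field_simps)
  finally show ?thesis
    by (simp add: along_pairing smooth_\<alpha> smooth_W p along_form_\<alpha>)
qed

text \<open>Since \<open>\<alpha>(Y)\<close> and \<open>\<alpha>(W)\<close> are known, so is \<open>\<alpha>\<close> on every field, in particular on the covariant
  derivatives of \<open>Y\<close> and \<open>W\<close> that remain in the derivatives of the two formulas.\<close>

lemma \<alpha>_in_frame:
  assumes "p \<in> V" "rho \<kappa> e G p \<noteq> 0"
  shows "pairing \<alpha> X p = (area e X (W \<kappa> e G) p * pairing \<alpha> (Y \<kappa> e G) p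
      + area e (Y \<kappa> e G) X p * pairing \<alpha> (W \<kappa> e G) p) / rho \<kappa> e G p"
  using expand_in_frame[of e p "Y \<kappa> e G" "W \<kappa> e G" \<alpha> X, OF skew[OF assms(1)]] assms(2)
  by (simp add: rho_area[OF assms(1)] nonzero_eq_divide_eq mult.commute)

context
  fixes p assumes p: "p \<in> V" and rho_nz: "rho \<kappa> e G p \<noteq> 0"
begin

abbreviation "y \<equiv> Y \<kappa> e G"
abbreviation "w \<equiv> W \<kappa> e G"

lemma Rho2_commute: "Rho2 \<kappa> G X Z p = Rho2 \<kappa> G Z X p"
  by (simp add: Rho2_fun Rho_sym p)

lemma along_W_\<alpha>_Y:
  "(area e (cov \<kappa> G w y) w p * pairing \<alpha> y p + area e y (cov \<kappa> G w y) p * pairing \<alpha> w p) / rho \<kappa> e G p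
     - pairing \<alpha> w p * pairing \<alpha> y p - Rho2 \<kappa> G w y p - f p / 2 * rho \<kappa> e G p
   = - 2 * f p * (- 3 * f p * pairing \<alpha> w p - rho \<kappa> e G p) - along \<kappa> w (phi \<kappa> e G) p / 6"
  using along_\<alpha>_Y[OF p, of w]
  by (simp add: \<alpha>_in_frame[OF p rho_nz, of "cov \<kappa> G w y"] along_F[OF p] rho_area[OF p] area_skew[OF p, of w y])

lemma along_Y_\<alpha>_W:
  "(area e (cov \<kappa> G y w) w p * pairing \<alpha> y p + area e y (cov \<kappa> G y w) p * pairing \<alpha> w p) / rho \<kappa> e G p
     - pairing \<alpha> y p * pairing \<alpha> w p - Rho2 \<kappa> G w y p + f p / 2 * rho \<kappa> e G p
   = - 20 * (f p)^3 * (- 3 * f p * pairing \<alpha> y p) + along \<kappa> y (ell \<kappa> e G) p / 3"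
  using along_\<alpha>_W[OF p, of y]
  by (simp add: \<alpha>_in_frame[OF p rho_nz, of "cov \<kappa> G y w"] along_F[OF p] rho_area[OF p] area_self[OF p]
      Rho2_commute[of y w])

lemma along_W_\<alpha>_W:
  "(area e (cov \<kappa> G w w) w p * pairing \<alpha> y p + area e y (cov \<kappa> G w w) p * pairing \<alpha> w p) / rho \<kappa> e G p
     - pairing \<alpha> w p * pairing \<alpha> w p - Rho2 \<kappa> G w w p
   = - 20 * (f p)^3 * (- 3 * f p * pairing \<alpha> w p - rho \<kappa> e G p) + along \<kappa> w (ell \<kappa> e G) p / 3"
  using along_\<alpha>_W[OF p, of w]
  by (simp add: \<alpha>_in_frame[OF p rho_nz, of "cov \<kappa> G w w"] along_F[OF p] rho_area[OF p] area_self[OF p])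

lemma poly_P1_F: "poly (P1 \<kappa> e G p) (f p) = 0"
proof -
  have "area e y (cov \<kappa> G y w) p / rho \<kappa> e G p - area e y (cov \<kappa> G w y) p / rho \<kappa> e G p
      = along \<kappa> y (rho \<kappa> e G) p / rho \<kappa> e G p - phi \<kappa> e G p / 2"
    using bracket_frame(1)[OF p rho_nz] by (simp add: frame_coeff_def dlog_rho_def area_skew[OF p, of y])
  moreover have "area e (cov \<kappa> G y w) w p / rho \<kappa> e G p - area e (cov \<kappa> G w y) w p / rho \<kappa> e G p
      = div_vec \<kappa> G w p - along \<kappa> w (rho \<kappa> e G) p / rho \<kappa> e G p"
    using bracket_frame(2)[OF p rho_nz] by (simp add: frame_coeff_def dlog_rho_def)
  ultimately show ?thesis
    using P1_combination[OF \<alpha>_Y[OF p] \<alpha>_W[OF p] along_W_\<alpha>_Y along_Y_\<alpha>_W]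
    by (simp add: P1_def poly_monom a1_def a2_def a3_def)
qed

lemma poly_P2_F: "poly (P2 \<kappa> e G p) (f p) = 0"
  using P2_combination[OF \<alpha>_Y[OF p] \<alpha>_W[OF p] along_W_\<alpha>_W]
  by (simp add: P2_def poly_monom b1_def b2_def b3_def along_form_Wl[OF p] area_skew[OF p, of _ y])

lemma poly_P3_F: "poly (P3 \<kappa> e G p) (f p) = 0"
  using P3_combination[OF \<alpha>_Y[OF p] \<alpha>_W[OF p] along_W_\<alpha>_Y along_Y_\<alpha>_W]
  by (simp add: P3_def poly_monom c1_def c2_def c3_def along_form_Wl[OF p] along_form_Yl[OF p]
      area_skew[OF p, of _ y])

end

end

section \<open>Projective change of the connection\<close>

text \<open>The condition on \<open>G'\<close> is that of a projective change with \<open>\<Upsilon> = dg\<close>, written in Christoffel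
  symbols. The letter \<open>U\<close> denotes \<open>dg\<close> below.\<close>

locale projective_chart = volume_chart \<kappa> e G
  for \<kappa> :: "('m::{t2_space,second_countable_topology}) chart" and e G +
  fixes G' :: "'m tens3" and g :: "'m \<Rightarrow> real"
  assumes smooth_g: "smooth_in \<kappa> (fst \<kappa>) g"
    and smooth_G': "smooth_in \<kappa> (fst \<kappa>) (G' c a b)"
    and G'_eq: "p \<in> fst \<kappa> \<Longrightarrow> G' c a b p = G c a b p
      + (if c = b then pd \<kappa> a g p else 0) + (if c = a then pd \<kappa> b g p else 0)"
begin

abbreviation U where "U a \<equiv> pd \<kappa> a g"

definition e' where "e' a b q = exp (3 * g q) * e a b q"

lemma e'_fun: "e' a b = (\<lambda>q. exp (3 * g q) * e a b q)"
  by (simp add: fun_eq_iff e'_def)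

lemma smooth_U: "smooth (U a)"
  by (simp add: smooth_rules smooth_g)

lemma differentiable_g [simp]: "p \<in> V \<Longrightarrow> differentiable_in \<kappa> g p"
  by (rule smooth_differentiable[OF smooth_g])

lemma U_closed: "p \<in> V \<Longrightarrow> pd \<kappa> 2 (U 1) p = pd \<kappa> 1 (U 2) p"
  by (rule pd_commute_V[OF smooth_g])

text \<open>The factor \<open>e\<^sup>3\<^sup>g\<close> is the one that compensates the trace \<open>3 dg\<close> added to the Christoffel
  symbols.\<close>

lemma parallel_change: "p \<in> V \<Longrightarrow> nabla_form2 \<kappa> G' e' a b c p = 0"
  using two_cases[of a] two_cases[of b] two_cases[of c]
  by (auto simp: e'_fun nabla_form2_fun pd_rules smooth_differentiable smooth_e G'_eq pd_e e_simps G_sym algebra_simps)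

sublocale hat: volume_chart \<kappa> e' G'
proof
  show "smooth_in \<kappa> V (e' a b)" for a b
    by (simp add: e'_fun smooth_rules smooth_g)
  show "e' a b p = - e' b a p" if "p \<in> V" for a b p
    using skew[OF that, of a b] by (simp add: e'_def)
  show "e' 1 2 p \<noteq> 0" if "p \<in> V" for p
    using e_nonzero[OF that] by (simp add: e'_def)
  show "G' c a b p = G' c b a p" if "p \<in> V" for c a b p
    using torsion_zero[OF that, of c a b] by (simp add: G'_eq that)
qed (simp_all add: smooth_G' parallel_change)

lemma pd_G':
  assumes p: "p \<in> V"
  shows "pd \<kappa> d (G' c a b) p = pd \<kappa> d (G c a b) p
      + (if c = b then pd \<kappa> d (U a) p else 0) + (if c = a then pd \<kappa> d (U b) p else 0)"
proof -
  have "pd \<kappa> d (G' c a b) p = pd \<kappa> d (\<lambda>p. G c a b p + (if c = b then U a p else 0) + (if c = a then U b p else 0)) p"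
    by (rule pd_cong_V) (auto simp: p G'_eq)
  then show ?thesis
    by (cases "c = b"; cases "c = a") (simp_all add: pd_rules smooth_differentiable smooth_G smooth_U p)
qed

lemma Rho_change:
  assumes p: "p \<in> V"
  shows "Rho \<kappa> G' a b p = Rho \<kappa> G a b p - nabla_form \<kappa> G U a b p + U a p * U b p"
proof -
  have R: "Rho \<kappa> G a b p = ric \<kappa> G a b p" "Rho \<kappa> G' a b p = ric \<kappa> G' a b p"
    using two_cases[of a] two_cases[of b] ric_sym[OF p] hat.ric_sym[OF p] by (auto simp: Rho_fun)
  show ?thesis
    unfolding R using two_cases[of a] two_cases[of b] trace_closed[OF p]
    by (auto simp: ric_fun riem_fun nabla_form_fun pd_G'[OF p] G'_eq[OF p] U_closed[OF p] G_sym[OF p] pd_G_sym[OF p] algebra_simps)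
qed

text \<open>A projective change alters the Cotton-York tensor only by the Weyl curvature contracted with
  \<open>dg\<close>, and on a surface that curvature is zero: the third derivatives of \<open>g\<close> cancel by
  commutation, and the Christoffel symbols combine to curvature, which cancels against \<open>P\<close>.\<close>

lemma cotton_york_change:
  assumes p: "p \<in> V"
  shows "cotton_york \<kappa> G' 1 2 c p = cotton_york \<kappa> G 1 2 c p"
proof -
  have dRho: "pd \<kappa> d (Rho \<kappa> G' a b) p = pd \<kappa> d (Rho \<kappa> G a b) p
      - (pd \<kappa> d (pd \<kappa> a (U b)) p
          - (G 1 a b p * pd \<kappa> d (U 1) p + pd \<kappa> d (G 1 a b) p * U 1 p
            + (G 2 a b p * pd \<kappa> d (U 2) p + pd \<kappa> d (G 2 a b) p * U 2 p)))
      + (U a p * pd \<kappa> d (U b) p + pd \<kappa> d (U a) p * U b p)" for a b d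
  proof -
    have "pd \<kappa> d (Rho \<kappa> G' a b) p = pd \<kappa> d (\<lambda>p. Rho \<kappa> G a b p - nabla_form \<kappa> G U a b p + U a p * U b p) p"
      by (rule pd_cong_V) (auto simp: p Rho_change)
    then show ?thesis
      by (simp add: nabla_form_fun pd_rules smooth_differentiable smooth_G smooth_U smooth_Rho smooth_rules p)
  qed
  note riem = pd_G_riem[OF p]
  have comm: "pd \<kappa> 1 (pd \<kappa> 2 (U d)) p = pd \<kappa> 2 (pd \<kappa> 1 (U d)) p" for d
    by (rule pd_commute_V[OF smooth_U p])
  show ?thesis
    using two_cases[of c]
    unfolding cotton_york_def nabla_form2_fun dRho Rho_change[OF p] comm riem
    by (auto simp: nabla_form_fun G'_eq[OF p] U_closed[OF p] G_sym[OF p] pd_G_sym[OF p] Rho_sym[OF p] algebra_simps)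
qed

end

context projective_chart
begin

text \<open>A vector field built from \<open>\<epsilon>\<close> and \<open>\<nabla>\<close> that has weight \<open>k\<close>; \<open>X'\<close> is its value after the change.\<close>

definition scaled :: "real \<Rightarrow> 'm tens1 \<Rightarrow> 'm tens1 \<Rightarrow> bool" where
  "scaled k X X' \<longleftrightarrow> (\<forall>q\<in>V. \<forall>c. X' c q = exp (k * g q) * X c q)"

lemma scaledD: "scaled k X X' \<Longrightarrow> p \<in> V \<Longrightarrow> X' c p = exp (k * g p) * X c p"
  by (simp add: scaled_def)

lemma along_scaled:
  assumes "scaled k X X'" "smooth f" "\<And>q. q \<in> V \<Longrightarrow> f' q = exp (l * g q) * f q" and p: "p \<in> V"
  shows "along \<kappa> X' f' p = exp ((k + l) * g p) * (along \<kappa> X f p + l * pairing U X p * f p)"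
proof -
  have "pd \<kappa> a f' p = pd \<kappa> a (\<lambda>q. exp (l * g q) * f q) p" for a
    by (rule pd_cong_V) (auto simp: p assms(3))
  then show ?thesis
    by (simp add: along_fun pairing_fun scaledD[OF assms(1) p] pd_rules smooth_differentiable assms(2) p
        distrib_right exp_add algebra_simps)
qed

lemma nabla_vec_scaled:
  assumes "scaled l Z Z'" "\<And>c. smooth (Z c)" and p: "p \<in> V"
  shows "nabla_vec \<kappa> G' Z' a c p = exp (l * g p) * (nabla_vec \<kappa> G Z a c p + (l + 1) * U a p * Z c p
    + (if c = a then pairing U Z p else 0))"
proof -
  have "pd \<kappa> a (Z' c) p = pd \<kappa> a (\<lambda>q. exp (l * g q) * Z c q) p"
    by (rule pd_cong_V) (auto simp: p scaledD[OF assms(1)])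
  then show ?thesis
    using two_cases[of a] two_cases[of c]
    by (auto simp: nabla_vec_fun pairing_fun scaledD[OF assms(1) p] pd_rules smooth_differentiable assms(2) p
        G'_eq[OF p] algebra_simps)
qed

lemma cov_scaled:
  assumes "scaled k X X'" "scaled l Z Z'" "\<And>c. smooth (Z c)" and p: "p \<in> V"
  shows "cov \<kappa> G' X' Z' c p = exp ((k + l) * g p) * (cov \<kappa> G X Z c p + (l + 1) * pairing U X p * Z c p
    + pairing U Z p * X c p)"
  using two_cases[of c]
  by (auto simp: cov_fun nabla_vec_scaled[OF assms(2,3) p] scaledD[OF assms(1) p] pairing_fun
      distrib_right exp_add algebra_simps)

lemma div_scaled:
  assumes "scaled l Z Z'" "\<And>c. smooth (Z c)" and p: "p \<in> V"
  shows "div_vec \<kappa> G' Z' p = exp (l * g p) * (div_vec \<kappa> G Z p + (l + 3) * pairing U Z p)"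
  by (simp add: div_vec_fun nabla_vec_scaled[OF assms] pairing_fun algebra_simps)

lemma area_cov_scaled:
  assumes "scaled k X X'" "scaled l Z Z'" "scaled m B B'" "\<And>c. smooth (Z c)" and p: "p \<in> V"
  shows "area e' (cov \<kappa> G' X' Z') B' p = exp ((3 + k + l + m) * g p) *
    (area e (cov \<kappa> G X Z) B p + (l + 1) * pairing U X p * area e Z B p + pairing U Z p * area e X B p)"
  by (simp add: area_fun e'_def cov_scaled[OF assms(1,2,4) p] scaledD[OF assms(3) p]
      distrib_right exp_add algebra_simps)

abbreviation "hess X Z \<equiv> along_form \<kappa> G X Z U"

lemma Rho2_scaled:
  assumes "scaled k X X'" "scaled l Z Z'" and p: "p \<in> V"
  shows "Rho2 \<kappa> G' X' Z' p = exp ((k + l) * g p) *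
    (Rho2 \<kappa> G X Z p - hess X Z p + pairing U X p * pairing U Z p)"
  by (simp add: Rho2_fun Rho_change[OF p] scaledD[OF assms(1) p] scaledD[OF assms(2) p] along_form_fun
      pairing_fun distrib_right exp_add algebra_simps)

lemma along_U:
  assumes "\<And>c. smooth (Z c)" "p \<in> V"
  shows "along \<kappa> X (pairing U Z) p = hess X Z p + pairing U (cov \<kappa> G X Z) p"
  by (rule along_pairing) (simp_all add: smooth_U assms)

abbreviation "y \<equiv> Y \<kappa> e G"
abbreviation "w \<equiv> W \<kappa> e G"
abbreviation "y' \<equiv> Y \<kappa> e' G'"
abbreviation "w' \<equiv> W \<kappa> e' G'"
abbreviation "r \<equiv> rho \<kappa> e G"
abbreviation "\<phi> \<equiv> phi \<kappa> e G"
abbreviation "l \<equiv> ell \<kappa> e G"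

lemma Yl_change: "p \<in> V \<Longrightarrow> Yl \<kappa> e' G' a p = exp (- 3 * g p) * Yl \<kappa> e G a p"
  by (simp add: Yl_eq hat.Yl_eq cotton_york_change e'_def exp_minus field_simps)

lemma Y_scaled: "scaled (- 6) y y'"
  unfolding scaled_def
proof (intro ballI allI)
  fix q c assume q: "q \<in> V"
  have "exp (- 6 * g q) * exp (3 * g q) = exp (- 3 * g q)"
    by (simp flip: exp_add)
  then show "y' c q = exp (- 6 * g q) * y c q"
    using two_cases[of c] e_nonzero[OF q] by (auto simp: Y_eq hat.Y_eq q Yl_change e'_def field_simps)
qed

lemma exp_m12: "exp (- (t * 6)) * exp (- (t * 6)) = exp (- (t * 12))"
  "exp (- (t * 6)) * (exp (- (t * 6)) * z) = exp (- (t * 12)) * z" for t z :: real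
  by (simp_all flip: exp_add mult.assoc)

text \<open>The weight \<open>-6\<close> of \<open>Y\<close> and the shift \<open>3\<close> of the divergence leave \<open>-3 U(Y)\<close>, so \<open>\<phi>\<close> is not an
  invariant by itself.\<close>

lemma phi_change: "p \<in> V \<Longrightarrow> phi \<kappa> e' G' p = exp (- 6 * g p) * (\<phi> p - 6 * pairing U y p)"
  by (simp add: phi_fun div_scaled[OF Y_scaled smooth_Y] algebra_simps)

text \<open>In \<open>W\<close> the multiple \<open>2 \<phi>/3\<close> of \<open>Y\<close> cancels the term \<open>- 4 U(Y) Y\<close> by which \<open>\<nabla>\<^sub>Y Y\<close> changes.\<close>

lemma W_scaled: "scaled (- 12) w w'"
  by (simp add: scaled_def W_fun cov_scaled[OF Y_scaled Y_scaled smooth_Y] phi_change scaledD[OF Y_scaled]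
      exp_m12 field_simps)

lemma rho_change: "p \<in> V \<Longrightarrow> rho \<kappa> e' G' p = exp (- 15 * g p) * r p"
proof -
  have "exp (- 15 * t) = exp (- 3 * t) * exp (- 12 * t)" for t :: real
    by (simp flip: exp_add)
  then show "rho \<kappa> e' G' p = exp (- 15 * g p) * r p" if "p \<in> V"
    using that by (simp add: rho_fun pairing_fun Yl_change scaledD[OF W_scaled] algebra_simps)
qed

lemma along_phi_change:
  assumes X: "scaled k X X'" and p: "p \<in> V"
  shows "along \<kappa> X' (phi \<kappa> e' G') p = exp ((k - 6) * g p) * (along \<kappa> X \<phi> p
    - 6 * (hess X y p + pairing U (cov \<kappa> G X y) p) - 6 * pairing U X p * (\<phi> p - 6 * pairing U y p))"
proof -
  have "along \<kappa> X (\<lambda>p. \<phi> p - 6 * pairing U y p) p = along \<kappa> X \<phi> p - 6 * along \<kappa> X (pairing U y) p"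
    by (simp add: along_fun pd_rules smooth_differentiable smooth_phi smooth_pairing smooth_U smooth_Y p algebra_simps)
  then show ?thesis
    using along_scaled[OF X _ phi_change p]
    by (simp add: along_U smooth_Y p smooth_rules smooth_phi smooth_pairing smooth_U)
qed

lemma ell_change: "p \<in> V \<Longrightarrow> ell \<kappa> e' G' p = exp (- 12 * g p) * (l p + 3 * pairing U w p)"
  by (simp add: ell_fun along_phi_change[OF Y_scaled] phi_change Rho2_scaled[OF Y_scaled Y_scaled]
      pairing_cov_Y_Y exp_m12 power2_eq_square field_simps)

lemma along_ell_change:
  assumes X: "scaled k X X'" and p: "p \<in> V"
  shows "along \<kappa> X' (ell \<kappa> e' G') p = exp ((k - 12) * g p) * (along \<kappa> X l p
    + 3 * (hess X w p + pairing U (cov \<kappa> G X w) p) - 12 * pairing U X p * (l p + 3 * pairing U w p))"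
proof -
  have "along \<kappa> X (\<lambda>p. l p + 3 * pairing U w p) p = along \<kappa> X l p + 3 * along \<kappa> X (pairing U w) p"
    by (simp add: along_fun pd_rules smooth_differentiable smooth_ell smooth_pairing smooth_U smooth_W p algebra_simps)
  then show ?thesis
    using along_scaled[OF X _ ell_change p]
    by (simp add: along_U smooth_W p smooth_rules smooth_ell smooth_pairing smooth_U)
qed

lemma along_rho_change:
  assumes X: "scaled k X X'" and p: "p \<in> V"
  shows "along \<kappa> X' (rho \<kappa> e' G') p = exp ((k - 15) * g p) * (along \<kappa> X r p - 15 * pairing U X p * r p)"
  using along_scaled[OF X smooth_rho rho_change p] by simp

section \<open>Invariance of the coefficients\<close>

context
  fixes p assumes p: "p \<in> V" and r_nz: "r p \<noteq> 0"
begin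

abbreviation "E \<equiv> exp (- 3 * g p)"

text \<open>All weights that occur are multiples of \<open>3\<close>. In terms of \<open>E = e\<^sup>-\<^sup>3\<^sup>g\<close> the invariance statements
  become polynomial identities.\<close>

lemma exp_weights: "exp (- 6 * g p) = E ^ 2" "exp (- 12 * g p) = E ^ 4" "exp (- 15 * g p) = E ^ 5"
  "exp (- 18 * g p) = E ^ 6" "exp (- 21 * g p) = E ^ 7" "exp (- 24 * g p) = E ^ 8"
  "exp (- 27 * g p) = E ^ 9" "exp (- 33 * g p) = E ^ 11"
  by (simp_all flip: exp_of_nat_mult)

lemma frame_coeff_scaled:
  assumes "scaled ka X X'" "scaled kb Z Z'" "scaled kc B B'" "\<And>c. smooth (Z c)"
    and n: "18 + ka + kb + kc = - 3 * real n"
  shows "hat.frame_coeff X' Z' B' p = E ^ n * (frame_coeff X Z B p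
    + ((kb + 1) * pairing U X p * area e Z B p + pairing U Z p * area e X B p) / r p)"
proof -
  have "exp ((3 + ka + kb + kc) * g p) = exp (real n * (- 3 * g p) + - 15 * g p)"
  proof -
    have "3 + ka + kb + kc = - 3 * real n - 15"
      using n by simp
    then show ?thesis
      by (simp only:) (simp add: algebra_simps)
  qed
  also have "\<dots> = E ^ n * exp (- 15 * g p)"
    by (simp only: exp_add exp_of_nat_mult)
  finally show ?thesis
    by (simp add: hat.frame_coeff_def frame_coeff_def area_cov_scaled[OF assms(1-4) p] rho_change[OF p]
        add_divide_distrib distrib_left)
qed

lemma dlog_rho_scaled:
  assumes "scaled k X X'"
  shows "hat.dlog_rho X' p = exp (k * g p) * (dlog_rho X p - 15 * pairing U X p)"
proof -
  have "exp ((k - 15) * g p) = exp (k * g p) * exp (- 15 * g p)"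
    by (simp flip: exp_add add: algebra_simps)
  then show ?thesis
    using r_nz by (simp add: hat.dlog_rho_def dlog_rho_def along_rho_change[OF assms p] rho_change[OF p] field_simps)
qed

lemma area_frame: "area e y w p = r p" "area e w y p = - r p" "area e y y p = 0" "area e w w p = 0"
  using area_skew[OF p, of w y] by (simp_all add: rho_area[OF p] area_self[OF p])

text \<open>The form \<open>dg\<close> in the frame \<open>(Y, W)\<close>; with it every change is expressed through \<open>U(Y)\<close>, \<open>U(W)\<close>
  and the Hessian of \<open>g\<close>.\<close>

lemma U_cov: "pairing U (cov \<kappa> G X Z) p =
    frame_coeff X Z w p * pairing U y p - frame_coeff X Z y p * pairing U w p"
  using expand_in_frame[of e p y w U "cov \<kappa> G X Z", OF skew[OF p]] r_nz
  by (simp add: area_frame frame_coeff_def area_skew[OF p, of y] field_simps)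

lemma hess_sym: "hess X Z p = hess Z X p"
  by (simp add: along_form_fun nabla_form_fun U_closed[OF p] G_sym[OF p] algebra_simps)

lemma frame_coeff_changes:
  "hat.frame_coeff w' w' w' p = E ^ 6 * frame_coeff w w w p"
  "hat.frame_coeff w' w' y' p = E ^ 4 * (frame_coeff w w y p + 10 * pairing U w p)"
  "hat.frame_coeff w' y' w' p = E ^ 4 * (frame_coeff w y w p - 5 * pairing U w p)"
  "hat.frame_coeff w' y' y' p = E ^ 2 * (frame_coeff w y y p - pairing U y p)"
  "hat.frame_coeff y' w' w' p = E ^ 4 * (frame_coeff y w w p + pairing U w p)"
  "hat.frame_coeff y' w' y' p = E ^ 2 * (frame_coeff y w y p + 11 * pairing U y p)"
  using frame_coeff_scaled[OF W_scaled W_scaled W_scaled smooth_W, of 6]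
    frame_coeff_scaled[OF W_scaled W_scaled Y_scaled smooth_W, of 4]
    frame_coeff_scaled[OF W_scaled Y_scaled W_scaled smooth_Y, of 4]
    frame_coeff_scaled[OF W_scaled Y_scaled Y_scaled smooth_Y, of 2]
    frame_coeff_scaled[OF Y_scaled W_scaled W_scaled smooth_W, of 4]
    frame_coeff_scaled[OF Y_scaled W_scaled Y_scaled smooth_W, of 2] r_nz
  by (simp_all add: area_frame)

lemma scalar_changes:
  "phi \<kappa> e' G' p = E\<^sup>2 * (\<phi> p - 6 * pairing U y p)"
  "ell \<kappa> e' G' p = E ^ 4 * (l p + 3 * pairing U w p)"
  "div_vec \<kappa> G' w' p = E ^ 4 * (div_vec \<kappa> G w p - 9 * pairing U w p)"
  "hat.dlog_rho y' p = E\<^sup>2 * (dlog_rho y p - 15 * pairing U y p)"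
  "hat.dlog_rho w' p = E ^ 4 * (dlog_rho w p - 15 * pairing U w p)"
  "Rho2 \<kappa> G' w' w' p = E ^ 8 * (Rho2 \<kappa> G w w p - hess w w p + pairing U w p * pairing U w p)"
  "Rho2 \<kappa> G' w' y' p = E ^ 6 * (Rho2 \<kappa> G w y p - hess w y p + pairing U w p * pairing U y p)"
  unfolding exp_weights[symmetric]
  by (simp_all add: phi_change[OF p] ell_change[OF p] div_scaled[OF W_scaled smooth_W p]
      dlog_rho_scaled[OF Y_scaled] dlog_rho_scaled[OF W_scaled]
      Rho2_scaled[OF W_scaled W_scaled p] Rho2_scaled[OF W_scaled Y_scaled p])

lemma derivative_changes:
  "along \<kappa> w' (phi \<kappa> e' G') p = E ^ 6 * (along \<kappa> w \<phi> p
    - 6 * (hess w y p + (frame_coeff w y w p * pairing U y p - frame_coeff w y y p * pairing U w p))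
    - 6 * pairing U w p * (\<phi> p - 6 * pairing U y p))"
  "along \<kappa> y' (ell \<kappa> e' G') p = E ^ 6 * (along \<kappa> y l p
    + 3 * (hess w y p + (frame_coeff y w w p * pairing U y p - frame_coeff y w y p * pairing U w p))
    - 12 * pairing U y p * (l p + 3 * pairing U w p))"
  "along \<kappa> w' (ell \<kappa> e' G') p = E ^ 8 * (along \<kappa> w l p
    + 3 * (hess w w p + (frame_coeff w w w p * pairing U y p - frame_coeff w w y p * pairing U w p))
    - 12 * pairing U w p * (l p + 3 * pairing U w p))"
  unfolding exp_weights[symmetric]
  by (simp_all add: along_phi_change[OF W_scaled p] along_ell_change[OF Y_scaled p]
      along_ell_change[OF W_scaled p] U_cov hess_sym[of y w])

lemmas changes = frame_coeff_changes scalar_changes derivative_changes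

text \<open>These relations tie the terms of the first polynomial together; without them the contributions
  of \<open>g\<close> to \<open>a3\<close> do not cancel.\<close>

lemma dlog_Y: "dlog_rho y p = \<phi> p / 2 + frame_coeff w y y p - frame_coeff y w y p"
  and div_W: "div_vec \<kappa> G w p = dlog_rho w p + frame_coeff y w w p - frame_coeff w y w p"
  using bracket_frame[OF p r_nz] by linarith+

lemma a_change:
  "a1 \<kappa> e' G' p = E\<^sup>2 * a1 \<kappa> e G p" "a2 \<kappa> e' G' p = E ^ 4 * a2 \<kappa> e G p" "a3 \<kappa> e' G' p = E ^ 6 * a3 \<kappa> e G p"
  unfolding a_frame[OF p] hat.a_frame[OF p] changes dlog_Y div_W
  by (simp_all add: field_simps numeral_eq_Suc)

lemma b_change:
  "b1 \<kappa> e' G' p = E ^ 4 * b1 \<kappa> e G p" "b2 \<kappa> e' G' p = E ^ 6 * b2 \<kappa> e G p" "b3 \<kappa> e' G' p = E ^ 8 * b3 \<kappa> e G p"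
  unfolding b_frame[OF p] hat.b_frame[OF p] changes
  by (simp_all add: field_simps numeral_eq_Suc)

lemma c_change:
  "c1 \<kappa> e' G' p = E\<^sup>2 * c1 \<kappa> e G p" "c2 \<kappa> e' G' p = E ^ 4 * c2 \<kappa> e G p" "c3 \<kappa> e' G' p = E ^ 6 * c3 \<kappa> e G p"
  unfolding c_frame[OF p] hat.c_frame[OF p] changes
  by (simp_all add: field_simps numeral_eq_Suc)

end

end

section \<open>Change of chart\<close>

text \<open>\<open>J a b\<close> is \<open>\<partial>x\<^sup>b/\<partial>x'\<^sup>a\<close> on the overlap of the two charts. Derivatives in \<open>\<kappa>'\<close> of components in
  \<open>\<kappa>\<close> are reduced to derivatives in \<open>\<kappa>\<close> by the chain rule.\<close>

locale transition = k: surface_chart \<kappa> + k': surface_chart \<kappa>'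
  for \<kappa> \<kappa>' :: "('m::{t2_space,second_countable_topology}) chart" +
  assumes smooth_coord: "smooth_in \<kappa>' (fst \<kappa> \<inter> fst \<kappa>') (coord \<kappa> b)"
begin

abbreviation \<Omega> where "\<Omega> \<equiv> fst \<kappa> \<inter> fst \<kappa>'"
abbreviation J where "J \<equiv> jac \<kappa>' \<kappa>"

lemma open_O: "open \<Omega>"
  using k.open_domain k'.open_domain by auto

lemma J_fun: "J a b = pd \<kappa>' a (coord \<kappa> b)"
  by (simp add: fun_eq_iff jac_def)

lemma smooth_J: "smooth_in \<kappa>' \<Omega> (J a b)"
  unfolding J_fun by (rule k'.smooth_in_pd[OF smooth_coord open_O]) auto

lemma differentiable_J: "p \<in> \<Omega> \<Longrightarrow> differentiable_in \<kappa>' (J a b) p"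
  by (rule k'.smooth_in_differentiable[OF smooth_J open_O]) auto

lemma smooth_dJ: "smooth_in \<kappa>' \<Omega> (pd \<kappa>' c (J a b))"
  by (rule k'.smooth_in_pd[OF smooth_J open_O]) auto

lemma dJ_sym: "p \<in> \<Omega> \<Longrightarrow> pd \<kappa>' 2 (J 1 b) p = pd \<kappa>' 1 (J 2 b) p"
  unfolding J_fun by (rule k'.pd_commute[OF smooth_coord open_O]) auto

lemma ddJ_sym: "p \<in> \<Omega> \<Longrightarrow> pd \<kappa>' 1 (pd \<kappa>' 2 (J c b)) p = pd \<kappa>' 2 (pd \<kappa>' 1 (J c b)) p"
  by (rule k'.pd_commute[OF smooth_J open_O]) auto

lemma chain_rule:
  assumes p: "p \<in> \<Omega>" and f: "differentiable_in \<kappa> f p"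
  shows "differentiable_in \<kappa>' f p" "pd \<kappa>' a f p = J a 1 p * pd \<kappa> 1 f p + J a 2 p * pd \<kappa> 2 f p"
proof -
  let ?x' = "snd \<kappa>' p"
  let ?T = "\<lambda>x. \<chi> b. in_chart \<kappa>' (coord \<kappa> b) x"
  let ?D = "\<lambda>h. \<chi> b. frechet_derivative (in_chart \<kappa>' (coord \<kappa> b)) (at ?x') h"
  have T_at: "(\<chi> b. coord \<kappa> b q) = snd \<kappa> q" for q
    by (simp add: coord_def vec_eq_iff)
  have dT: "(?T has_derivative ?D) (at ?x')"
  proof (subst has_derivative_componentwise_within, intro ballI)
    fix i :: "real^2" assume "i \<in> Basis"
    then obtain b where i: "i = axis b 1" by (auto simp: Basis_vec_def)
    have "differentiable_in \<kappa>' (coord \<kappa> b) p"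
      by (rule k'.smooth_in_differentiable[OF smooth_coord open_O]) (use p in auto)
    then show "((\<lambda>x. ?T x \<bullet> i) has_derivative (\<lambda>x. ?D x \<bullet> i)) (at ?x')"
      by (simp add: i inner_axis differentiable_in_def frechet_derivative_works)
  qed
  let ?f' = "frechet_derivative (in_chart \<kappa> f) (at (snd \<kappa> p))"
  have df: "(in_chart \<kappa> f has_derivative ?f') (at (?T ?x'))"
    using f p by (simp add: T_at differentiable_in_def frechet_derivative_works)
  have "((\<lambda>x. in_chart \<kappa> f (?T x)) has_derivative (\<lambda>h. ?f' (?D h))) (at ?x')"
    by (rule has_derivative_compose[OF dT df])
  then have d: "(in_chart \<kappa>' f has_derivative (\<lambda>h. ?f' (?D h))) (at ?x')"
    by (rule has_derivative_transform_within_open[OF _ k'.open_image[OF open_O]]) (use p in \<open>auto simp: T_at\<close>)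
  then show "differentiable_in \<kappa>' f p"
    unfolding differentiable_in_def by (rule differentiableI)
  have lin: "linear ?f'"
    using df by (rule has_derivative_linear)
  have D: "?D (axis a 1) = J a 1 p *\<^sub>R axis 1 1 + J a 2 p *\<^sub>R axis 2 1"
    by (simp add: vec_eq_iff forall_2 axis_def J_fun pd_def partial_def)
  show "pd \<kappa>' a f p = J a 1 p * pd \<kappa> 1 f p + J a 2 p * pd \<kappa> 2 f p"
    unfolding pd_def[of \<kappa>'] partial_eqI[OF d] D
    by (simp add: linear_add[OF lin] linear_scale[OF lin] pd_def partial_def)
qed

end

lemma (in surface_chart) pd_coord:
  assumes p: "p \<in> V"
  shows "pd \<kappa> a (coord \<kappa> b) p = (if a = b then 1 else 0)"
proof -
  have "partial a (in_chart \<kappa> (coord \<kappa> b)) (snd \<kappa> p) = partial a (\<lambda>x. x $ b) (snd \<kappa> p)"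
    by (rule partial_cong[OF open_range]) (use p in \<open>auto simp: coord_def\<close>)
  also have "\<dots> = axis a 1 $ b"
    by (rule partial_eqI) (rule bounded_linear_imp_has_derivative[OF bounded_linear_vec_nth])
  finally show ?thesis
    by (simp add: pd_def axis_def)
qed

text \<open>Conjugate matrices have the same trace; the equations say \<open>n j = j m\<close>, and the trace of both
  sides times the adjugate of \<open>j\<close> is taken.\<close>

lemma trace_similar:
  fixes m11 m12 m21 m22 :: real
  assumes "j11 * j22 - j12 * j21 \<noteq> 0"
    and "j11 * n11 + j21 * n12 = j11 * m11 + j12 * m21"
    and "j12 * n11 + j22 * n12 = j11 * m12 + j12 * m22"
    and "j11 * n21 + j21 * n22 = j21 * m11 + j22 * m21"
    and "j12 * n21 + j22 * n22 = j21 * m12 + j22 * m22"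
  shows "n11 + n22 = m11 + m22"
proof -
  have "(n11 + n22 - (m11 + m22)) * (j11 * j22 - j12 * j21)
      = j22 * (j11 * n11 + j21 * n12 - (j11 * m11 + j12 * m21)) - j21 * (j12 * n11 + j22 * n12 - (j11 * m12 + j12 * m22))
        + j11 * (j12 * n21 + j22 * n22 - (j21 * m12 + j22 * m22)) - j12 * (j11 * n21 + j21 * n22 - (j21 * m11 + j22 * m21))"
    by (simp add: algebra_simps)
  also have "\<dots> = 0"
    using assms(2-5) by simp
  finally show ?thesis using assms(1) by simp
qed

locale volume_chart_pair = v: volume_chart \<kappa> e G + v': volume_chart \<kappa>' e' G' + transition \<kappa> \<kappa>'
  for \<kappa> \<kappa>' :: "('m::{t2_space,second_countable_topology}) chart" and e e' G G' +
  assumes smooth_coord': "smooth_in \<kappa> (fst \<kappa> \<inter> fst \<kappa>') (coord \<kappa>' b)"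
    and e_change: "p \<in> fst \<kappa> \<inter> fst \<kappa>' \<Longrightarrow>
        e' a b p = (\<Sum>c\<in>UNIV. \<Sum>d\<in>UNIV. jac \<kappa>' \<kappa> a c p * jac \<kappa>' \<kappa> b d p * e c d p)"
    and G_change: "p \<in> fst \<kappa> \<inter> fst \<kappa>' \<Longrightarrow> G' c a b p =
          (\<Sum>f\<in>UNIV. jac \<kappa> \<kappa>' f c p *
             ((\<Sum>d\<in>UNIV. \<Sum>e\<in>UNIV. jac \<kappa>' \<kappa> a d p * jac \<kappa>' \<kappa> b e p * G f d e p)
              + pd \<kappa>' a (jac \<kappa>' \<kappa> b f) p))"
begin

lemma jac_inverse:
  assumes p: "p \<in> \<Omega>"
  shows "jac \<kappa> \<kappa>' a 1 p * J 1 b p + jac \<kappa> \<kappa>' a 2 p * J 2 b p = (if a = b then 1 else 0)"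
proof -
  interpret inverse: transition \<kappa>' \<kappa>
    by unfold_locales (simp add: smooth_coord' Int_commute)
  have p': "p \<in> fst \<kappa>' \<inter> fst \<kappa>" using p by auto
  have "differentiable_in \<kappa>' (coord \<kappa> b) p"
    by (rule v'.smooth_in_differentiable[OF smooth_coord open_O]) (use p in auto)
  then show ?thesis
    using inverse.chain_rule(2)[OF p', of "coord \<kappa> b" a] v.pd_coord[of p a b] p by (simp add: J_fun)
qed

text \<open>Contraction with \<open>J\<close> removes the inverse Jacobian from the transformation law of the Christoffel
  symbols. In all later computations the Christoffel symbols of \<open>\<kappa>'\<close> enter only through this
  contraction.\<close>

lemma G'_J:
  assumes p: "p \<in> \<Omega>"
  shows "G' 1 a b p * J 1 g p + G' 2 a b p * J 2 g p =
    J a 1 p * J b 1 p * G g 1 1 p + J a 1 p * J b 2 p * G g 1 2 p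
    + (J a 2 p * J b 1 p * G g 2 1 p + J a 2 p * J b 2 p * G g 2 2 p) + pd \<kappa>' a (J b g) p"
proof -
  define M where "M f = J a 1 p * J b 1 p * G f 1 1 p + J a 1 p * J b 2 p * G f 1 2 p
    + (J a 2 p * J b 1 p * G f 2 1 p + J a 2 p * J b 2 p * G f 2 2 p) + pd \<kappa>' a (J b f) p" for f
  have "G' 1 a b p * J 1 g p + G' 2 a b p * J 2 g p
      = (jac \<kappa> \<kappa>' 1 1 p * J 1 g p + jac \<kappa> \<kappa>' 1 2 p * J 2 g p) * M 1
        + (jac \<kappa> \<kappa>' 2 1 p * J 1 g p + jac \<kappa> \<kappa>' 2 2 p * J 2 g p) * M 2"
    unfolding M_def by (simp add: G_change[OF p] sum_2 algebra_simps)
  also have "\<dots> = M g"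
    using two_cases[of g] by (auto simp: jac_inverse[OF p])
  finally show ?thesis by (simp add: M_def)
qed

abbreviation "Jdet q \<equiv> J 1 1 q * J 2 2 q - J 1 2 q * J 2 1 q"

lemma e'_det:
  assumes p: "p \<in> \<Omega>"
  shows "e' 1 2 p = Jdet p * e 1 2 p" "Jdet p \<noteq> 0"
proof -
  show e': "e' 1 2 p = Jdet p * e 1 2 p"
    using p by (simp add: e_change[OF p] sum_2 v.e_simps algebra_simps)
  then show "Jdet p \<noteq> 0"
    using v'.e_nonzero[of p] p by auto
qed

lemma chain_V: "p \<in> \<Omega> \<Longrightarrow> v.smooth f \<Longrightarrow>
    pd \<kappa>' a f p = J a 1 p * pd \<kappa> 1 f p + J a 2 p * pd \<kappa> 2 f p"
  by (rule chain_rule) (auto intro: v.smooth_differentiable)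

lemma differentiable_V: "p \<in> \<Omega> \<Longrightarrow> v.smooth f \<Longrightarrow> differentiable_in \<kappa>' f p"
  by (rule chain_rule) (auto intro: v.smooth_differentiable)

lemmas pd_cong_O = v'.pd_cong[OF open_O Int_lower2]

text \<open>The relations say that two sets of components represent the same vector field, form or function
  on the overlap. Vector components are related with \<open>J\<close> on the side of \<open>\<kappa>'\<close>, which again avoids
  the inverse Jacobian.\<close>

definition vec_rel where "vec_rel X X' \<longleftrightarrow> (\<forall>c. v.smooth (X c)) \<and> (\<forall>c. v'.smooth (X' c)) \<and>
  (\<forall>p\<in>\<Omega>. \<forall>g. X g p = J 1 g p * X' 1 p + J 2 g p * X' 2 p)"

definition form_rel where "form_rel \<omega> \<omega>' \<longleftrightarrow> (\<forall>p\<in>\<Omega>. \<forall>a. \<omega>' a p = J a 1 p * \<omega> 1 p + J a 2 p * \<omega> 2 p)"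

definition scalar_rel where "scalar_rel f f' \<longleftrightarrow> v.smooth f \<and> v'.smooth f' \<and> (\<forall>p\<in>\<Omega>. f' p = f p)"

lemma vec_relD:
  assumes "vec_rel X X'"
  shows "v.smooth (X c)" "v'.smooth (X' c)" "p \<in> \<Omega> \<Longrightarrow> X c p = J 1 c p * X' 1 p + J 2 c p * X' 2 p"
  using assms by (auto simp: vec_rel_def)

text \<open>Differentiating the relation between the components of \<open>X\<close> produces second derivatives of the
  transition map, which cancel against those in the transformation law of the Christoffel symbols.\<close>

lemma nabla_vec_change:
  assumes X: "vec_rel X X'" and p: "p \<in> \<Omega>"
  shows "J 1 g p * nabla_vec \<kappa>' G' X' a 1 p + J 2 g p * nabla_vec \<kappa>' G' X' a 2 p
    = J a 1 p * nabla_vec \<kappa> G X 1 g p + J a 2 p * nabla_vec \<kappa> G X 2 g p"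
proof -
  have "J a 1 p * pd \<kappa> 1 (X g) p + J a 2 p * pd \<kappa> 2 (X g) p = pd \<kappa>' a (X g) p"
    using chain_V[OF p] vec_relD(1)[OF X] by simp
  also have "\<dots> = pd \<kappa>' a (\<lambda>p. J 1 g p * X' 1 p + J 2 g p * X' 2 p) p"
    by (rule pd_cong_O[OF p]) (simp add: vec_relD(3)[OF X])
  also have "\<dots> = J 1 g p * pd \<kappa>' a (X' 1) p + pd \<kappa>' a (J 1 g) p * X' 1 p
      + (J 2 g p * pd \<kappa>' a (X' 2) p + pd \<kappa>' a (J 2 g) p * X' 2 p)"
    using p by (simp add: v'.pd_rules differentiable_J v'.smooth_differentiable vec_relD(2)[OF X])
  finally have d: "J 1 g p * pd \<kappa>' a (X' 1) p + J 2 g p * pd \<kappa>' a (X' 2) p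
    = J a 1 p * pd \<kappa> 1 (X g) p + J a 2 p * pd \<kappa> 2 (X g) p
      - (pd \<kappa>' a (J 1 g) p * X' 1 p + pd \<kappa>' a (J 2 g) p * X' 2 p)"
    by simp
  have "J 1 g p * nabla_vec \<kappa>' G' X' a 1 p + J 2 g p * nabla_vec \<kappa>' G' X' a 2 p
      = (J 1 g p * pd \<kappa>' a (X' 1) p + J 2 g p * pd \<kappa>' a (X' 2) p)
        + (G' 1 a 1 p * J 1 g p + G' 2 a 1 p * J 2 g p) * X' 1 p
        + (G' 1 a 2 p * J 1 g p + G' 2 a 2 p * J 2 g p) * X' 2 p"
    by (simp add: nabla_vec_fun algebra_simps)
  then show ?thesis
    unfolding d G'_J[OF p] nabla_vec_fun vec_relD(3)[OF X p] by (simp add: algebra_simps)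
qed

lemma cov_rel:
  assumes X: "vec_rel X X'" and Z: "vec_rel Z Z'"
  shows "vec_rel (cov \<kappa> G X Z) (cov \<kappa>' G' X' Z')"
proof -
  have "cov \<kappa> G X Z g p = J 1 g p * cov \<kappa>' G' X' Z' 1 p + J 2 g p * cov \<kappa>' G' X' Z' 2 p"
    if p: "p \<in> \<Omega>" for p g
  proof -
    have "cov \<kappa> G X Z g p =
        X' 1 p * (J 1 1 p * nabla_vec \<kappa> G Z 1 g p + J 1 2 p * nabla_vec \<kappa> G Z 2 g p)
      + X' 2 p * (J 2 1 p * nabla_vec \<kappa> G Z 1 g p + J 2 2 p * nabla_vec \<kappa> G Z 2 g p)"
      by (simp add: cov_fun vec_relD(3)[OF X p] algebra_simps)
    then show ?thesis
      unfolding nabla_vec_change[OF Z p, symmetric] by (simp add: cov_fun algebra_simps)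
  qed
  then show ?thesis
    using v.smooth_cov[OF vec_relD(1)[OF X] vec_relD(1)[OF Z]]
      v'.smooth_cov[OF vec_relD(2)[OF X] vec_relD(2)[OF Z]]
    by (simp add: vec_rel_def)
qed

lemma div_rel:
  assumes X: "vec_rel X X'"
  shows "scalar_rel (div_vec \<kappa> G X) (div_vec \<kappa>' G' X')"
proof -
  have "div_vec \<kappa>' G' X' p = div_vec \<kappa> G X p" if p: "p \<in> \<Omega>" for p
    unfolding div_vec_fun
    by (rule trace_similar[OF e'_det(2)[OF p] nabla_vec_change[OF X p] nabla_vec_change[OF X p]
          nabla_vec_change[OF X p] nabla_vec_change[OF X p]])
  then show ?thesis
    using v.smooth_div_vec[OF vec_relD(1)[OF X]] v'.smooth_div_vec[OF vec_relD(2)[OF X]]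
    by (simp add: scalar_rel_def)
qed

lemma along_rel:
  assumes X: "vec_rel X X'" and f: "scalar_rel f f'"
  shows "scalar_rel (along \<kappa> X f) (along \<kappa>' X' f')"
proof -
  have "along \<kappa>' X' f' p = along \<kappa> X f p" if p: "p \<in> \<Omega>" for p
  proof -
    have "pd \<kappa>' a f' p = J a 1 p * pd \<kappa> 1 f p + J a 2 p * pd \<kappa> 2 f p" for a
      using pd_cong_O[OF p, of f' f a] chain_V[OF p, of f a] f by (simp add: scalar_rel_def)
    then show ?thesis
      by (simp add: along_fun vec_relD(3)[OF X p] algebra_simps)
  qed
  then show ?thesis
    using f v.smooth_along[OF vec_relD(1)[OF X]] v'.smooth_along[OF vec_relD(2)[OF X]]
    by (simp add: scalar_rel_def)
qed

lemma area_change: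
  assumes "vec_rel X X'" "vec_rel Z Z'" and p: "p \<in> \<Omega>"
  shows "area e' X' Z' p = area e X Z p"
proof -
  have V: "p \<in> fst \<kappa>" "p \<in> fst \<kappa>'" using p by auto
  show ?thesis
    by (simp add: area_fun v.e_simps[OF V(1)] v'.e_simps[OF V(2)] e'_det[OF p] vec_relD(3)[OF assms(1) p]
        vec_relD(3)[OF assms(2) p] algebra_simps)
qed

text \<open>The contracted transformation law of the Christoffel symbols is differentiated and
  skew-symmetrised. Third derivatives of the transition map drop out because they commute, and its
  second derivatives cancel against the quadratic terms.\<close>

lemma riem_chart_change:
  assumes p: "p \<in> \<Omega>"
  shows "J 1 g p * riem \<kappa>' G' 1 2 1 c p + J 2 g p * riem \<kappa>' G' 1 2 2 c p
    = Jdet p * (J c 1 p * riem \<kappa> G 1 2 g 1 p + J c 2 p * riem \<kappa> G 1 2 g 2 p)"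
proof -
  have V: "p \<in> fst \<kappa>" "p \<in> fst \<kappa>'" using p by auto
  let ?K = "\<lambda>a b g. pd \<kappa>' a (J b g) p"
  let ?dG = "\<lambda>a g d e. J a 1 p * pd \<kappa> 1 (G g d e) p + J a 2 p * pd \<kappa> 2 (G g d e) p"
  have derivative: "(pd \<kappa>' a (G' 1 b c) p * J 1 g p + pd \<kappa>' a (G' 2 b c) p * J 2 g p)
      + (G' 1 b c p * ?K a 1 g + G' 2 b c p * ?K a 2 g)
    = (?K a b 1 * J c 1 p + J b 1 p * ?K a c 1) * G g 1 1 p + J b 1 p * J c 1 p * ?dG a g 1 1
    + (?K a b 1 * J c 2 p + J b 1 p * ?K a c 2) * G g 1 2 p + J b 1 p * J c 2 p * ?dG a g 1 2
    + (?K a b 2 * J c 1 p + J b 2 p * ?K a c 1) * G g 2 1 p + J b 2 p * J c 1 p * ?dG a g 2 1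
    + (?K a b 2 * J c 2 p + J b 2 p * ?K a c 2) * G g 2 2 p + J b 2 p * J c 2 p * ?dG a g 2 2
    + pd \<kappa>' a (pd \<kappa>' b (J c g)) p" for a b
  proof -
    have "pd \<kappa>' a (\<lambda>p. G' 1 b c p * J 1 g p + G' 2 b c p * J 2 g p) p
      = pd \<kappa>' a (\<lambda>p. J b 1 p * J c 1 p * G g 1 1 p + J b 1 p * J c 2 p * G g 1 2 p
        + (J b 2 p * J c 1 p * G g 2 1 p + J b 2 p * J c 2 p * G g 2 2 p) + pd \<kappa>' b (J c g) p) p"
      by (rule pd_cong_O[OF p G'_J])
    then show ?thesis
      by (simp add: v'.pd_rules differentiable_J[OF p] V v'.smooth_differentiable[OF v'.smooth_G]
          differentiable_V[OF p v.smooth_G] chain_V[OF p v.smooth_G]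
          v'.smooth_in_differentiable[OF smooth_dJ open_O Int_lower2 p] algebra_simps)
  qed
  have product: "J 1 g p * (G' 1 a 1 p * G' 1 b c p + G' 1 a 2 p * G' 2 b c p)
      + J 2 g p * (G' 2 a 1 p * G' 1 b c p + G' 2 a 2 p * G' 2 b c p)
    = J a 1 p * G g 1 1 p * (G' 1 b c p * J 1 1 p + G' 2 b c p * J 2 1 p)
    + J a 1 p * G g 1 2 p * (G' 1 b c p * J 1 2 p + G' 2 b c p * J 2 2 p)
    + J a 2 p * G g 2 1 p * (G' 1 b c p * J 1 1 p + G' 2 b c p * J 2 1 p)
    + J a 2 p * G g 2 2 p * (G' 1 b c p * J 1 2 p + G' 2 b c p * J 2 2 p)
    + (G' 1 b c p * ?K a 1 g + G' 2 b c p * ?K a 2 g)" for a b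
  proof -
    have "J 1 g p * (G' 1 a 1 p * G' 1 b c p + G' 1 a 2 p * G' 2 b c p)
      + J 2 g p * (G' 2 a 1 p * G' 1 b c p + G' 2 a 2 p * G' 2 b c p)
      = (G' 1 a 1 p * J 1 g p + G' 2 a 1 p * J 2 g p) * G' 1 b c p
        + (G' 1 a 2 p * J 1 g p + G' 2 a 2 p * J 2 g p) * G' 2 b c p"
      by (simp add: algebra_simps)
    then show ?thesis
      unfolding G'_J[OF p, of a] by (simp add: algebra_simps)
  qed
  have "J 1 g p * riem \<kappa>' G' 1 2 1 c p + J 2 g p * riem \<kappa>' G' 1 2 2 c p
    = (pd \<kappa>' 1 (G' 1 2 c) p * J 1 g p + pd \<kappa>' 1 (G' 2 2 c) p * J 2 g p)
    - (pd \<kappa>' 2 (G' 1 1 c) p * J 1 g p + pd \<kappa>' 2 (G' 2 1 c) p * J 2 g p)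
    + (J 1 g p * (G' 1 1 1 p * G' 1 2 c p + G' 1 1 2 p * G' 2 2 c p)
      + J 2 g p * (G' 2 1 1 p * G' 1 2 c p + G' 2 1 2 p * G' 2 2 c p))
    - (J 1 g p * (G' 1 2 1 p * G' 1 1 c p + G' 1 2 2 p * G' 2 1 c p)
      + J 2 g p * (G' 2 2 1 p * G' 1 1 c p + G' 2 2 2 p * G' 2 1 c p))"
    by (simp add: riem_fun algebra_simps)
  also have "\<dots> = (pd \<kappa>' 1 (G' 1 2 c) p * J 1 g p + pd \<kappa>' 1 (G' 2 2 c) p * J 2 g p
      + (G' 1 2 c p * ?K 1 1 g + G' 2 2 c p * ?K 1 2 g))
    - (pd \<kappa>' 2 (G' 1 1 c) p * J 1 g p + pd \<kappa>' 2 (G' 2 1 c) p * J 2 g p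
      + (G' 1 1 c p * ?K 2 1 g + G' 2 1 c p * ?K 2 2 g))
    + (J 1 1 p * G g 1 1 p * (G' 1 2 c p * J 1 1 p + G' 2 2 c p * J 2 1 p)
    + J 1 1 p * G g 1 2 p * (G' 1 2 c p * J 1 2 p + G' 2 2 c p * J 2 2 p)
    + J 1 2 p * G g 2 1 p * (G' 1 2 c p * J 1 1 p + G' 2 2 c p * J 2 1 p)
    + J 1 2 p * G g 2 2 p * (G' 1 2 c p * J 1 2 p + G' 2 2 c p * J 2 2 p))
    - (J 2 1 p * G g 1 1 p * (G' 1 1 c p * J 1 1 p + G' 2 1 c p * J 2 1 p)
    + J 2 1 p * G g 1 2 p * (G' 1 1 c p * J 1 2 p + G' 2 1 c p * J 2 2 p)
    + J 2 2 p * G g 2 1 p * (G' 1 1 c p * J 1 1 p + G' 2 1 c p * J 2 1 p)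
    + J 2 2 p * G g 2 2 p * (G' 1 1 c p * J 1 2 p + G' 2 1 c p * J 2 2 p))"
    unfolding product by simp
  also have "\<dots> = Jdet p * (J c 1 p * riem \<kappa> G 1 2 g 1 p + J c 2 p * riem \<kappa> G 1 2 g 2 p)"
    unfolding derivative G'_J[OF p]
    unfolding riem_fun ddJ_sym[OF p] dJ_sym[OF p] v.G_sym[OF V(1)] v.pd_G_sym[OF V(1)]
    by (simp add: algebra_simps)
  finally show ?thesis .
qed

text \<open>The curvature law gives two linear equations for the components of \<open>P\<close> in \<open>\<kappa>'\<close>, with matrix \<open>J\<close>.\<close>

lemma Rho_rel:
  assumes p: "p \<in> \<Omega>"
  shows "Rho \<kappa>' G' a b p = J a 1 p * (J b 1 p * Rho \<kappa> G 1 1 p + J b 2 p * Rho \<kappa> G 1 2 p)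
    + J a 2 p * (J b 1 p * Rho \<kappa> G 2 1 p + J b 2 p * Rho \<kappa> G 2 2 p)"
proof -
  have V: "p \<in> fst \<kappa>" "p \<in> fst \<kappa>'" using p by auto
  have solve: "x1 = j11 * q1 + j12 * q2 \<and> x2 = j21 * q1 + j22 * q2"
    if nz: "j11 * j22 - j12 * j21 \<noteq> 0"
      and 1: "j11 * x2 - j21 * x1 = (j11 * j22 - j12 * j21) * q2"
      and 2: "j12 * x2 - j22 * x1 = - ((j11 * j22 - j12 * j21) * q1)"
    for x1 x2 q1 q2 j11 j12 j21 j22 :: real
  proof -
    have "(x1 - (j11 * q1 + j12 * q2)) * (j11 * j22 - j12 * j21) = 0"
      "(x2 - (j21 * q1 + j22 * q2)) * (j11 * j22 - j12 * j21) = 0"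
      using 1 2 by algebra+
    then show ?thesis using nz by simp
  qed
  have "J 1 1 p * Rho \<kappa>' G' 2 b p - J 2 1 p * Rho \<kappa>' G' 1 b p
      = Jdet p * (J b 1 p * Rho \<kappa> G 2 1 p + J b 2 p * Rho \<kappa> G 2 2 p)"
    "J 1 2 p * Rho \<kappa>' G' 2 b p - J 2 2 p * Rho \<kappa>' G' 1 b p
      = - (Jdet p * (J b 1 p * Rho \<kappa> G 1 1 p + J b 2 p * Rho \<kappa> G 1 2 p))"
    using riem_chart_change[OF p, of 1 b] riem_chart_change[OF p, of 2 b]
    by (simp_all add: v.riem_Rho[OF V(1)] v'.riem_Rho[OF V(2)] algebra_simps)
  from solve[OF e'_det(2)[OF p] this] show ?thesis
    using two_cases[of a] by auto
qed

text \<open>The Christoffel symbols with both differentiation indices are symmetric and cancel in the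
  Cotton-York tensor, so only those contracted with the last index of \<open>P\<close> remain.\<close>

lemma cotton_york_chart_change:
  assumes p: "p \<in> \<Omega>"
  shows "cotton_york \<kappa>' G' 1 2 c p
    = Jdet p * (J c 1 p * cotton_york \<kappa> G 1 2 1 p + J c 2 p * cotton_york \<kappa> G 1 2 2 p)"
proof -
  have V: "p \<in> fst \<kappa>" "p \<in> fst \<kappa>'" using p by auto
  let ?P = "Rho \<kappa> G"
  let ?dP = "\<lambda>a g h. J a 1 p * pd \<kappa> 1 (?P g h) p + J a 2 p * pd \<kappa> 2 (?P g h) p"
  let ?PJ = "\<lambda>a g. J a 1 p * ?P 1 g p + J a 2 p * ?P 2 g p"
  have derivative: "pd \<kappa>' a (Rho \<kappa>' G' b c) p =
      J b 1 p * (J c 1 p * ?dP a 1 1 + J c 2 p * ?dP a 1 2) + J b 2 p * (J c 1 p * ?dP a 2 1 + J c 2 p * ?dP a 2 2)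
    + (pd \<kappa>' a (J b 1) p * (J c 1 p * ?P 1 1 p + J c 2 p * ?P 1 2 p)
      + pd \<kappa>' a (J b 2) p * (J c 1 p * ?P 2 1 p + J c 2 p * ?P 2 2 p))
    + (pd \<kappa>' a (J c 1) p * ?PJ b 1 + pd \<kappa>' a (J c 2) p * ?PJ b 2)" for a b
  proof -
    have "pd \<kappa>' a (Rho \<kappa>' G' b c) p = pd \<kappa>' a (\<lambda>p. J b 1 p * (J c 1 p * ?P 1 1 p + J c 2 p * ?P 1 2 p)
        + J b 2 p * (J c 1 p * ?P 2 1 p + J c 2 p * ?P 2 2 p)) p"
      by (rule pd_cong_O[OF p Rho_rel])
    then show ?thesis
      by (simp add: v'.pd_rules differentiable_J[OF p] V differentiable_V[OF p v.smooth_Rho]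
          chain_V[OF p v.smooth_Rho] algebra_simps)
  qed
  have connection: "G' 1 a c p * Rho \<kappa>' G' b 1 p + G' 2 a c p * Rho \<kappa>' G' b 2 p
    = (G' 1 a c p * J 1 1 p + G' 2 a c p * J 2 1 p) * ?PJ b 1
      + (G' 1 a c p * J 1 2 p + G' 2 a c p * J 2 2 p) * ?PJ b 2" for a b
    unfolding Rho_rel[OF p] by (simp add: algebra_simps)
  have "cotton_york \<kappa>' G' 1 2 c p = pd \<kappa>' 1 (Rho \<kappa>' G' 2 c) p - pd \<kappa>' 2 (Rho \<kappa>' G' 1 c) p
    - (G' 1 1 c p * Rho \<kappa>' G' 2 1 p + G' 2 1 c p * Rho \<kappa>' G' 2 2 p)
    + (G' 1 2 c p * Rho \<kappa>' G' 1 1 p + G' 2 2 c p * Rho \<kappa>' G' 1 2 p)"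
    by (simp add: cotton_york_def nabla_form2_fun v'.G_sym[OF V(2)])
  also have "\<dots> = Jdet p * (J c 1 p * cotton_york \<kappa> G 1 2 1 p + J c 2 p * cotton_york \<kappa> G 1 2 2 p)"
    unfolding connection derivative G'_J[OF p]
    unfolding cotton_york_def nabla_form2_fun dJ_sym[OF p] v.G_sym[OF V(1)]
    by (simp add: algebra_simps)
  finally show ?thesis .
qed

lemma Yl_rel: "form_rel (Yl \<kappa> e G) (Yl \<kappa>' e' G')"
proof -
  have "Yl \<kappa>' e' G' a p = J a 1 p * Yl \<kappa> e G 1 p + J a 2 p * Yl \<kappa> e G 2 p" if p: "p \<in> \<Omega>" for p a
  proof -
    have V: "p \<in> fst \<kappa>" "p \<in> fst \<kappa>'" using p by auto
    have "2 * (Jdet p * x) / (Jdet p * e 1 2 p) = 2 * x / e 1 2 p" for x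
      using e'_det(2)[OF p] by simp
    then show ?thesis
      by (simp add: v.Yl_eq[OF V(1)] v'.Yl_eq[OF V(2)] cotton_york_chart_change[OF p] e'_det(1)[OF p]
          add_divide_distrib distrib_left mult.left_commute)
  qed
  then show ?thesis by (simp add: form_rel_def)
qed

lemma Y_rel: "vec_rel (Y \<kappa> e G) (Y \<kappa>' e' G')"
proof -
  have "Y \<kappa> e G g p = J 1 g p * Y \<kappa>' e' G' 1 p + J 2 g p * Y \<kappa>' e' G' 2 p" if p: "p \<in> \<Omega>" for p g
  proof -
    have V: "p \<in> fst \<kappa>" "p \<in> fst \<kappa>'" using p by auto
    have Yl: "Yl \<kappa>' e' G' a p = J a 1 p * Yl \<kappa> e G 1 p + J a 2 p * Yl \<kappa> e G 2 p" for a
      using Yl_rel p by (simp add: form_rel_def)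
    have "J 1 g p * Y \<kappa>' e' G' 1 p + J 2 g p * Y \<kappa>' e' G' 2 p
        = (J 1 g p * (J 2 1 p * Yl \<kappa> e G 1 p + J 2 2 p * Yl \<kappa> e G 2 p)
          - J 2 g p * (J 1 1 p * Yl \<kappa> e G 1 p + J 1 2 p * Yl \<kappa> e G 2 p)) / (Jdet p * e 1 2 p)"
      by (simp add: v'.Y_eq[OF V(2)] Yl e'_det(1)[OF p] diff_divide_distrib)
    also have "\<dots> = Jdet p * (if g = 1 then Yl \<kappa> e G 2 p else - Yl \<kappa> e G 1 p) / (Jdet p * e 1 2 p)"
      using two_cases[of g] by (auto simp: algebra_simps)
    also have "\<dots> = Y \<kappa> e G g p"
      using two_cases[of g] e'_det(2)[OF p] by (auto simp: v.Y_eq[OF V(1)])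
    finally show ?thesis by simp
  qed
  then show ?thesis
    by (simp add: vec_rel_def v.smooth_Y v'.smooth_Y)
qed

lemma scalar_relD: "scalar_rel f f' \<Longrightarrow> p \<in> \<Omega> \<Longrightarrow> f' p = f p"
  by (simp add: scalar_rel_def)

lemma phi_rel: "scalar_rel (phi \<kappa> e G) (phi \<kappa>' e' G')"
  using div_rel[OF Y_rel] v.smooth_phi v'.smooth_phi by (simp add: scalar_rel_def phi_fun)

lemma W_rel: "vec_rel (W \<kappa> e G) (W \<kappa>' e' G')"
proof -
  have "W \<kappa> e G g p = J 1 g p * W \<kappa>' e' G' 1 p + J 2 g p * W \<kappa>' e' G' 2 p" if p: "p \<in> \<Omega>" for p g
    unfolding W_fun vec_relD(3)[OF cov_rel[OF Y_rel Y_rel] p] vec_relD(3)[OF Y_rel p, of g] scalar_relD[OF phi_rel p]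
    by (simp add: algebra_simps)
  then show ?thesis
    by (simp add: vec_rel_def v.smooth_W v'.smooth_W)
qed

lemma rho_rel: "scalar_rel (rho \<kappa> e G) (rho \<kappa>' e' G')"
  using area_change[OF Y_rel W_rel]
  by (auto simp: scalar_rel_def v.smooth_rho v'.smooth_rho v.rho_area v'.rho_area)

lemma Rho2_change:
  assumes "vec_rel X X'" "vec_rel Z Z'" and p: "p \<in> \<Omega>"
  shows "Rho2 \<kappa>' G' X' Z' p = Rho2 \<kappa> G X Z p"
  by (simp add: Rho2_fun Rho_rel[OF p] vec_relD(3)[OF assms(1) p] vec_relD(3)[OF assms(2) p] algebra_simps)

lemma ell_rel: "scalar_rel (ell \<kappa> e G) (ell \<kappa>' e' G')"
proof -
  have "ell \<kappa>' e' G' p = ell \<kappa> e G p" if "p \<in> \<Omega>" for p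
    unfolding ell_fun scalar_relD[OF along_rel[OF Y_rel phi_rel] that] scalar_relD[OF phi_rel that]
      Rho2_change[OF Y_rel Y_rel that] ..
  then show ?thesis
    by (simp add: scalar_rel_def v.smooth_ell v'.smooth_ell)
qed

lemma frame_coeff_change:
  assumes "vec_rel X X'" "vec_rel Z Z'" "vec_rel B B'" and p: "p \<in> \<Omega>"
  shows "v'.frame_coeff X' Z' B' p = v.frame_coeff X Z B p"
  unfolding v.frame_coeff_def v'.frame_coeff_def
  using area_change[OF cov_rel[OF assms(1,2)] assms(3) p] scalar_relD[OF rho_rel p] by simp

lemma dlog_rho_change:
  assumes "vec_rel X X'" and p: "p \<in> \<Omega>"
  shows "v'.dlog_rho X' p = v.dlog_rho X p"
  unfolding v.dlog_rho_def v'.dlog_rho_def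
  using scalar_relD[OF along_rel[OF assms(1) rho_rel] p] scalar_relD[OF rho_rel p] by simp

context
  fixes p assumes p: "p \<in> \<Omega>"
begin

lemma V: "p \<in> fst \<kappa>" "p \<in> fst \<kappa>'"
  using p by auto

lemmas frame_change = scalar_relD[OF phi_rel p] scalar_relD[OF ell_rel p] scalar_relD[OF div_rel[OF W_rel] p]
  scalar_relD[OF along_rel[OF W_rel phi_rel] p] scalar_relD[OF along_rel[OF Y_rel ell_rel] p]
  scalar_relD[OF along_rel[OF W_rel ell_rel] p] dlog_rho_change[OF Y_rel p] dlog_rho_change[OF W_rel p]
  Rho2_change[OF W_rel W_rel p] Rho2_change[OF W_rel Y_rel p]
  frame_coeff_change[OF W_rel W_rel W_rel p] frame_coeff_change[OF W_rel W_rel Y_rel p]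
  frame_coeff_change[OF W_rel Y_rel W_rel p] frame_coeff_change[OF W_rel Y_rel Y_rel p]
  frame_coeff_change[OF Y_rel W_rel W_rel p] frame_coeff_change[OF Y_rel W_rel Y_rel p]

lemma coefficients_agree:
  "a1 \<kappa>' e' G' p = a1 \<kappa> e G p" "a2 \<kappa>' e' G' p = a2 \<kappa> e G p" "a3 \<kappa>' e' G' p = a3 \<kappa> e G p"
  "b1 \<kappa>' e' G' p = b1 \<kappa> e G p" "b2 \<kappa>' e' G' p = b2 \<kappa> e G p" "b3 \<kappa>' e' G' p = b3 \<kappa> e G p"
  "c1 \<kappa>' e' G' p = c1 \<kappa> e G p" "c2 \<kappa>' e' G' p = c2 \<kappa> e G p" "c3 \<kappa>' e' G' p = c3 \<kappa> e G p"
  by (simp_all add: v.a_frame[OF V(1)] v'.a_frame[OF V(2)] v.b_frame[OF V(1)] v'.b_frame[OF V(2)]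
      v.c_frame[OF V(1)] v'.c_frame[OF V(2)] frame_change)

lemma polynomials_agree:
  "P1 \<kappa>' e' G' p = P1 \<kappa> e G p" "P2 \<kappa>' e' G' p = P2 \<kappa> e G p" "P3 \<kappa>' e' G' p = P3 \<kappa> e G p"
  by (simp_all add: P1_def P2_def P3_def coefficients_agree scalar_relD[OF rho_rel p])

end

end

section \<open>Smoothness, weights and the polynomials on the surface\<close>

context volume_chart
begin

lemma smooth_if: "smooth h \<Longrightarrow> smooth (\<lambda>p. if b then h p else 0)"
  by (cases b) simp_all

lemma smooth_coeff:
  assumes nz: "\<And>p. p \<in> V \<Longrightarrow> rho \<kappa> e G p \<noteq> 0" and P: "P \<in> {P1, P2, P3}"
  shows "smooth (\<lambda>p. coeff (P \<kappa> e G p) i)"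
proof -
  have coefficients: "smooth (a1 \<kappa> e G)" "smooth (a2 \<kappa> e G)" "smooth (a3 \<kappa> e G)"
    "smooth (b1 \<kappa> e G)" "smooth (b2 \<kappa> e G)" "smooth (b3 \<kappa> e G)"
    "smooth (c1 \<kappa> e G)" "smooth (c2 \<kappa> e G)" "smooth (c3 \<kappa> e G)"
    unfolding a1_def[abs_def] a2_def[abs_def] a3_def[abs_def] b1_def[abs_def] b2_def[abs_def] b3_def[abs_def]
      c1_def[abs_def] c2_def[abs_def] c3_def[abs_def]
    by (simp_all add: smooth_rules nz smooth_rho smooth_phi smooth_ell smooth_along smooth_along_form
        smooth_div_vec smooth_Rho2 smooth_Y smooth_W smooth_Yl smooth_Wl)
  have "smooth (\<lambda>p. coeff (P1 \<kappa> e G p) i)" "smooth (\<lambda>p. coeff (P2 \<kappa> e G p) i)"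
    "smooth (\<lambda>p. coeff (P3 \<kappa> e G p) i)"
    unfolding P1_def P2_def P3_def coeff_add coeff_monom
    by (simp_all split del: if_split add: smooth_rules smooth_if coefficients smooth_rho)
  then show ?thesis using P by auto
qed

end

text \<open>Since \<open>F\<close> has weight \<open>- 3\<close>, a homogeneous polynomial of weight \<open>- 3 n\<close> in \<open>F\<close> and its
  coefficients has its \<open>i\<close>-th coefficient of weight \<open>3 i - 3 n\<close>; the leading coefficients are
  constants, so \<open>n\<close> is the degree.\<close>

lemma (in projective_chart) coeff_change:
  assumes "p \<in> V" "rho \<kappa> e G p \<noteq> 0"
  shows "coeff (P1 \<kappa> e' G' p) i = exp ((3 * real i - 18) * g p) * coeff (P1 \<kappa> e G p) i"
    "coeff (P2 \<kappa> e' G' p) i = exp ((3 * real i - 24) * g p) * coeff (P2 \<kappa> e G p) i"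
    "coeff (P3 \<kappa> e' G' p) i = exp ((3 * real i - 18) * g p) * coeff (P3 \<kappa> e G p) i"
  unfolding P1_def P2_def P3_def
  by (auto simp: coeff_monom a_change[OF assms] b_change[OF assms] c_change[OF assms]
      rho_change[OF assms(1)] simp flip: exp_of_nat_mult)

context
  fixes A :: "('m::{t2_space,second_countable_topology}) chart set"
  assumes atlas: "smooth_atlas A"
begin

lemma atlas_chart: "\<kappa> \<in> A \<Longrightarrow> surface_chart \<kappa>"
  using atlas unfolding smooth_atlas_def surface_chart_def by blast

lemma atlas_coord: "\<kappa> \<in> A \<Longrightarrow> \<kappa>' \<in> A \<Longrightarrow> smooth_in \<kappa> (fst \<kappa> \<inter> fst \<kappa>') (coord \<kappa>' b)"
  using atlas unfolding smooth_atlas_def by blast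

context
  fixes e :: "'m chart \<Rightarrow> 'm tens2" and N :: "'m chart \<Rightarrow> 'm tens3"
  assumes e: "volume_form A e" and N: "affine_connection A N" "torsion_free A N" and parallel: "parallel A e N"
begin

lemma atlas_volume_chart:
  assumes \<kappa>: "\<kappa> \<in> A"
  shows "volume_chart \<kappa> (e \<kappa>) (N \<kappa>)"
proof (intro volume_chart.intro atlas_chart[OF \<kappa>] volume_chart_axioms.intro)
  show "smooth_in \<kappa> (fst \<kappa>) (e \<kappa> a b)" for a b
    using e \<kappa> unfolding volume_form_def by blast
  show "smooth_in \<kappa> (fst \<kappa>) (N \<kappa> c a b)" for c a b
    using N \<kappa> unfolding affine_connection_def by blast
  fix p assume p: "p \<in> fst \<kappa>"
  show "e \<kappa> a b p = - e \<kappa> b a p" "e \<kappa> 1 2 p \<noteq> 0" for a b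
    using e \<kappa> p unfolding volume_form_def by blast+
  show "N \<kappa> c a b p = N \<kappa> c b a p" for c a b
    using N \<kappa> p unfolding torsion_free_def by blast
  show "nabla_form2 \<kappa> (N \<kappa>) (e \<kappa>) a b c p = 0" for a b c
    using parallel \<kappa> p unfolding parallel_def by blast
qed

lemma atlas_pair:
  assumes "\<kappa> \<in> A" "\<kappa>' \<in> A"
  shows "volume_chart_pair \<kappa> \<kappa>' (e \<kappa>) (e \<kappa>') (N \<kappa>) (N \<kappa>')"
proof -
  interpret v: volume_chart \<kappa> "e \<kappa>" "N \<kappa>" by (rule atlas_volume_chart[OF assms(1)])
  interpret v': volume_chart \<kappa>' "e \<kappa>'" "N \<kappa>'" by (rule atlas_volume_chart[OF assms(2)])
  show ?thesis
  proof
    show "smooth_in \<kappa>' (fst \<kappa> \<inter> fst \<kappa>') (coord \<kappa> b)" for b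
      using atlas_coord[OF assms(2,1)] by (simp add: Int_commute)
    show "smooth_in \<kappa> (fst \<kappa> \<inter> fst \<kappa>') (coord \<kappa>' b)" for b
      using atlas_coord[OF assms] .
  qed (use e N assms in \<open>simp_all add: volume_form_def affine_connection_def\<close>)
qed

lemma smooth_scalar_coeff:
  assumes nz: "rho_nonzero A e N" and P: "P \<in> {P1, P2, P3}"
  shows "smooth_scalar A (\<lambda>\<kappa> p. coeff (P \<kappa> (e \<kappa>) (N \<kappa>) p) i)"
proof -
  have agree: "P \<kappa>' (e \<kappa>') (N \<kappa>') p = P \<kappa> (e \<kappa>) (N \<kappa>) p"
    if "\<kappa> \<in> A" "\<kappa>' \<in> A" "p \<in> fst \<kappa>" "p \<in> fst \<kappa>'" for \<kappa> \<kappa>' p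
    using volume_chart_pair.polynomials_agree[OF atlas_pair[OF that(1,2)]] that(3,4) P by auto
  \<comment> \<open>The function on the surface takes its value at each point from an arbitrary chart around it.\<close>
  define chart_at where "chart_at p = (SOME \<kappa>. \<kappa> \<in> A \<and> p \<in> fst \<kappa>)" for p
  have "\<exists>\<kappa>. \<kappa> \<in> A \<and> p \<in> fst \<kappa>" for p
    using atlas unfolding smooth_atlas_def by blast
  then have chart_at: "chart_at p \<in> A" "p \<in> fst (chart_at p)" for p
    using someI_ex[of "\<lambda>\<kappa>. \<kappa> \<in> A \<and> p \<in> fst \<kappa>"] unfolding chart_at_def by auto
  define h where "h p = coeff (P (chart_at p) (e (chart_at p)) (N (chart_at p)) p) i" for p
  have h: "coeff (P \<kappa> (e \<kappa>) (N \<kappa>) p) i = h p" if "\<kappa> \<in> A" "p \<in> fst \<kappa>" for \<kappa> p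
    unfolding h_def using agree[OF that(1) chart_at(1) that(2) chart_at(2)] by simp
  have "smooth_in \<kappa> (fst \<kappa>) h" if \<kappa>: "\<kappa> \<in> A" for \<kappa>
  proof -
    interpret volume_chart \<kappa> "e \<kappa>" "N \<kappa>" by (rule atlas_volume_chart[OF \<kappa>])
    have "smooth (\<lambda>p. coeff (P \<kappa> (e \<kappa>) (N \<kappa>) p) i)"
      using nz \<kappa> P by (intro smooth_coeff) (auto simp: rho_nonzero_def)
    then show ?thesis
      by (rule smooth_in_cong[OF open_domain order_refl, THEN iffD1, rotated]) (rule h[OF \<kappa>])
  qed
  then show ?thesis
    unfolding smooth_scalar_def smooth_function_def using h by blast
qed

lemma poly_F_eq_0:
  assumes nz: "rho_nonzero A e N" and P: "P \<in> {P1, P2, P3}" and \<alpha>: "pEW A N \<alpha>" and \<kappa>: "\<kappa> \<in> A" "p \<in> fst \<kappa>"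
  shows "poly (P \<kappa> (e \<kappa>) (N \<kappa>) p) (F \<kappa> (e \<kappa>) (N \<kappa>) (\<alpha> \<kappa>) p) = 0"
proof -
  interpret volume_chart \<kappa> "e \<kappa>" "N \<kappa>" by (rule atlas_volume_chart[OF \<kappa>(1)])
  interpret pew_chart \<kappa> "e \<kappa>" "N \<kappa>" "\<alpha> \<kappa>"
  proof
    show "smooth (\<alpha> \<kappa> a)" for a
      using \<alpha> \<kappa>(1) unfolding pEW_def one_form_def by blast
  qed (use \<alpha> \<kappa>(1) in \<open>simp add: pEW_def\<close>)
  have "rho \<kappa> (e \<kappa>) (N \<kappa>) p \<noteq> 0"
    using nz \<kappa> by (auto simp: rho_nonzero_def)
  then show ?thesis
    using P poly_P1_F poly_P2_F poly_P3_F \<kappa>(2) by auto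
qed

lemma atlas_projective_chart:
  assumes g: "smooth_function A g" and N': "affine_connection A N'"
    and change: "projective_change A (\<lambda>\<kappa> a. pd \<kappa> a g) N N'" and \<kappa>: "\<kappa> \<in> A"
  shows "projective_chart \<kappa> (e \<kappa>) (N \<kappa>) (N' \<kappa>) g"
proof -
  interpret volume_chart \<kappa> "e \<kappa>" "N \<kappa>" by (rule atlas_volume_chart[OF \<kappa>])
  show ?thesis
  proof
    show "smooth g" using g \<kappa> by (simp add: smooth_function_def)
    show "smooth (N' \<kappa> c a b)" for c a b
      using N' \<kappa> by (simp add: affine_connection_def)
    show "N' \<kappa> c a b p = N \<kappa> c a b p + (if c = b then pd \<kappa> a g p else 0) + (if c = a then pd \<kappa> b g p else 0)"
      if p: "p \<in> V" for p c a b
    proof -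
      \<comment> \<open>The definition of a projective change is tested on the coordinate forms.\<close>
      let ?dx = "\<lambda>b (_ :: 'm). if b = c then 1 else 0 :: real"
      have "nabla_form \<kappa> (N' \<kappa>) ?dx a b p
          = nabla_form \<kappa> (N \<kappa>) ?dx a b p - pd \<kappa> a g p * ?dx b p - pd \<kappa> b g p * ?dx a p"
        using change \<kappa> p unfolding projective_change_def by simp
      then show ?thesis
        using two_cases[of c] by (auto simp: nabla_form_fun pd_const)
    qed
  qed
qed

end

lemma projective_invariant_coeff:
  assumes P: "P \<in> {P1, P2, P3}"
  shows "projective_invariant A (\<lambda>\<kappa> e' N' p. coeff (P \<kappa> e' N' p) i)"
proof -
  define w where "w = 3 * real i - (if P = P2 then 24 else 18)"
  have "coeff (P \<kappa> (\<lambda>a b q. exp (3 * g q) * e \<kappa> a b q) (N' \<kappa>) p) i = exp (w * g p) * coeff (P \<kappa> (e \<kappa>) (N \<kappa>) p) i"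
    if "volume_form A e" "affine_connection A N" "torsion_free A N" "parallel A e N" "rho_nonzero A e N"
      "smooth_function A g" "affine_connection A N'" "projective_change A (\<lambda>\<kappa> a. pd \<kappa> a g) N N'"
      and \<kappa>: "\<kappa> \<in> A" "p \<in> fst \<kappa>" for e N N' g \<kappa> p
  proof -
    interpret projective_chart \<kappa> "e \<kappa>" "N \<kappa>" "N' \<kappa>" g
      using that by (intro atlas_projective_chart)
    have nz: "rho \<kappa> (e \<kappa>) (N \<kappa>) p \<noteq> 0"
      using that by (auto simp: rho_nonzero_def)
    have "(\<lambda>a b q. exp (3 * g q) * e \<kappa> a b q) = e'"
      by (simp add: fun_eq_iff e'_def)
    then show ?thesis
      using coeff_change[OF \<kappa>(2) nz, of i] P unfolding w_def by auto
  qed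
  then show ?thesis
    unfolding projective_invariant_def by blast
qed

end

theorem theorem3p1:
  fixes A :: "('m::{t2_space,second_countable_topology}) chart set"
    and C :: "('m chart \<Rightarrow> 'm tens3) set"
    and e :: "'m chart \<Rightarrow> 'm tens2"
    and N :: "'m chart \<Rightarrow> 'm tens3"
    and \<alpha> :: "'m chart \<Rightarrow> 'm tens1"
  assumes "smooth_atlas A"
    and "projective_structure A C"
    and "volume_form A e"
    and "N \<in> C" and "parallel A e N"
    and "rho_nonzero A e N"
    and "pEW A N \<alpha>"
  shows "\<forall>P\<in>{P1, P2, P3}.
     (\<forall>i. smooth_scalar A (\<lambda>\<kappa> p. coeff (P \<kappa> (e \<kappa>) (N \<kappa>) p) i) \<and>
          projective_invariant A (\<lambda>\<kappa> e' N' p. coeff (P \<kappa> e' N' p) i)) \<and>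
     (\<forall>\<kappa>\<in>A. \<forall>p\<in>fst \<kappa>. poly (P \<kappa> (e \<kappa>) (N \<kappa>) p) (F \<kappa> (e \<kappa>) (N \<kappa>) (\<alpha> \<kappa>) p) = 0)"
proof -
  have N: "affine_connection A N" "torsion_free A N"
    using assms(2,4) unfolding projective_structure_def by auto
  show ?thesis
    using smooth_scalar_coeff[OF assms(1,3) N assms(5,6)] projective_invariant_coeff[OF assms(1)]
      poly_F_eq_0[OF assms(1,3) N assms(5,6) _ assms(7)]
    by blast
qed

end
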